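(* For each $n$ let $G_n$ be a random simple graph on the vertex set $[n]=\{1,\dots,n\}$, with law denoted $\mathbb P$. Fix $u\in[0,1]$ and $\theta>0$, and put $c_{\theta,u}:=1+\theta\max\{u,1-u\}$. Assume: (a) for every $\varepsilon>0$ there exists $\eta>0$ such that $\mathbb P\bigl(\mathcal E_n(\eta,\varepsilon)\bigr)\to 1$ as $n\to\infty$, where $\mathcal E_n(\eta,\varepsilon)$ is the event that $e_{G_n}(S)\le(1+\varepsilon)|S|$ for every $S\subset[n]$ with $|S|\le\eta n$; (b) there exists $\alpha>0$ such that $|E(G_n)|/n\to\alpha$ in probability as $n\to\infty$. Assume moreover that $\alpha>c_{\theta,u}$. Then there exist $\eta>0$, $s>0$ and $c>0$ such that for every $a\ge 0$, $$\mathbb P\left(\frac1s\int_a^{a+s}\mathbb P^{G_n}_{\theta,t,u}(A_\eta)\,\mathrm dt\ge c\right)\xrightarrow[n\to\infty]{}1.$$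
   Context: For a graph $G$ and a set $S$ of vertices, $e_G(S)$ is the number of edges of $G$ with both endpoints in $S$. Random loop model. Let $G=(V,E)$ be a finite simple graph with $|V|=n$, and $S^1=\mathbb R/\mathbb Z$. For $t\ge0$ and $u\in[0,1]$, let $\omega=(\omega_e)_{e\in E}$ be independent marked Poisson point processes on $S^1\times\{\times,\mid\}$ with intensity measure $t\,\mathrm ds\otimes(u\,\delta_\times+(1-u)\,\delta_\mid)$; the law of $\omega$ is $\rho^G_{t,u}$. A point $(s,\times)\in\omega_e$ is a cross, and a point $(s,\mid)\in\omega_e$ a bar, on the edge $e$ at time $s$. Almost surely there are finitely many marks, at distinct times. Loops: a particle moves in $G\times S^1\times\{-1,+1\}$, the third coordinate being its vertical direction. Between marks it moves vertically (in the $S^1$ coordinate) at unit speed in its current direction; when at vertex $x$ it meets a mark on an edge $\{x,y\}$, it jumps instantaneously from $x$ to $y$, keeping its direction if the mark is a cross and reversing it if the mark is a bar. All trajectories are closed; the resulting closed trajectories, regarded as (unoriented) subsets of $V\times S^1$, are the loops. $\mathcal L(\omega)$ is the set of loops and $\lambda(\omega)=|\mathcal L(\omega)|$. For a loop $\gamma$, $\operatorname{supp}_V(\gamma)=\{x\in V:\exists s\in S^1,\ (x,s)\in\gamma\}$. For $\theta>0$, the weighted measure is $\mathbb P^G_{\theta,t,u}(\mathrm d\omega)=Z_G(\theta,t,u)^{-1}\theta^{\lambda(\omega)}\rho^G_{t,u}(\mathrm d\omega)$ with $Z_G(\theta,t,u)=\int\theta^{\lambda(\omega)}\rho^G_{t,u}(\mathrm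 d\omega)$. For $\eta>0$, $A_\eta=\{\exists\gamma\in\mathcal L(\omega):|\operatorname{supp}_V(\gamma)|>\eta n\}$. For a random graph $G_n$, $\mathbb P^{G_n}_{\theta,t,u}$ is the loop measure conditional on $G_n$, so $\mathbb P^{G_n}_{\theta,t,u}(A_\eta)$ is a random variable depending on $G_n$. *)

theory Defs
  imports "HOL-Probability.Probability"
begin

text \<open>A simple graph on a vertex set \<open>V\<close> is given by its edge set, a set of two-element subsets
  of \<open>V\<close>.\<close>

definition simple_edges :: "'v set \<Rightarrow> 'v set set" where
  "simple_edges V = {e. e \<subseteq> V \<and> card e = 2}"

definition edges_inside :: "'v set set \<Rightarrow> 'v set \<Rightarrow> nat" where
  "edges_inside E S = card {e \<in> E. e \<subseteq> S}"


section \<open>The marked Poisson processes\<close>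

text \<open>The circle $\mathbb R/\mathbb Z$ is represented by \<open>{0..<1}\<close>, with \<^const>\<open>frac\<close> as the
  projection from the real line.\<close>

datatype mark = Cross | Bar

type_synonym 'v config = "'v set \<Rightarrow> (real \<times> mark) set"

definition mark_measure :: "real \<Rightarrow> (real \<times> mark) measure" where
  "mark_measure u = restrict_space lborel {0..<1} \<Otimes>\<^sub>M
     measure_pmf (map_pmf (\<lambda>b. if b then Cross else Bar) (bernoulli_pmf u))"

text \<open>\<^const>\<open>poisson_pmf\<close> is unspecified at rate 0.\<close>

definition poisson0_pmf :: "real \<Rightarrow> nat pmf" where
  "poisson0_pmf t = (if t = 0 then return_pmf 0 else poisson_pmf t)"

text \<open>The Poisson point process with finite intensity measure \<open>t \<cdot> mark_measure u\<close>, in its usual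
  construction: \<open>N\<close> points \<open>X 0, \<dots>, X (N - 1)\<close>, where \<open>N\<close> is Poisson with parameter \<open>t\<close> and
  independent of the sequence \<open>X\<close>, which is i.i.d. with law \<open>mark_measure u\<close>. A sample is the
  pair \<open>(N, X)\<close>.\<close>

definition poisson_process :: "real \<Rightarrow> real \<Rightarrow> (nat \<times> (nat \<Rightarrow> real \<times> mark)) measure" where
  "poisson_process t u = measure_pmf (poisson0_pmf t) \<Otimes>\<^sub>M (\<Pi>\<^sub>M i\<in>UNIV. mark_measure u)"

type_synonym 'v sample = "'v set \<Rightarrow> nat \<times> (nat \<Rightarrow> real \<times> mark)"

definition config_law :: "'v set set \<Rightarrow> real \<Rightarrow> real \<Rightarrow> 'v sample measure" where
  "config_law E t u = (\<Pi>\<^sub>M e\<in>E. poisson_process t u)"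

definition config_of :: "'v set set \<Rightarrow> 'v sample \<Rightarrow> 'v config" where
  "config_of E w e = (if e \<in> E then snd (w e) ` {..<fst (w e)} else {})"

lemma prob_space_mark_measure: "prob_space (mark_measure u)"
proof -
  interpret L: prob_space "restrict_space lborel {0..<1::real}"
    by (rule prob_spaceI) (simp add: emeasure_restrict_space space_restrict_space)
  interpret pair_prob_space "restrict_space lborel {0..<1::real}"
    "measure_pmf (map_pmf (\<lambda>b. if b then Cross else Bar) (bernoulli_pmf u))" ..
  show ?thesis unfolding mark_measure_def by (rule prob_space_axioms)
qed

lemma prob_space_poisson_process: "prob_space (poisson_process t u)"
proof -
  interpret S: prob_space "\<Pi>\<^sub>M i\<in>(UNIV :: nat set). mark_measure u"
    by (rule prob_space_PiM) (rule prob_space_mark_measure)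
  interpret pair_prob_space "measure_pmf (poisson0_pmf t)" "\<Pi>\<^sub>M i\<in>(UNIV :: nat set). mark_measure u" ..
  show ?thesis unfolding poisson_process_def by (rule prob_space_axioms)
qed

lemma prob_space_config_law: "prob_space (config_law E t u)"
  unfolding config_law_def by (rule prob_space_PiM) (rule prob_space_poisson_process)


section \<open>Loops\<close>

text \<open>A state \<open>(x, s, d)\<close> of the particle is its vertex, its time and its vertical direction
  \<open>d \<in> {1, -1}\<close>. If there is a mark at \<open>(x, s)\<close>, the state is the one after the jump: the particle
  leaves \<open>(x, s)\<close> in direction \<open>d\<close>. This is why \<open>unobstructed\<close> excludes the starting time.\<close>

definition marked :: "'v config \<Rightarrow> 'v \<Rightarrow> real \<Rightarrow> bool" where
  "marked \<omega> x s \<longleftrightarrow> (\<exists>e m. x \<in> e \<and> (s, m) \<in> \<omega> e)"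

definition unobstructed :: "'v config \<Rightarrow> 'v \<Rightarrow> real \<Rightarrow> real \<Rightarrow> real \<Rightarrow> bool" where
  "unobstructed \<omega> x s d r \<longleftrightarrow> (\<forall>q\<in>{0<..<r}. \<not> marked \<omega> x (frac (s + d * q)))"

text \<open>One move of the particle: vertical motion up to the next mark met, followed by the jump
  across it.\<close>

inductive move :: "'v config \<Rightarrow> 'v \<times> real \<times> real \<Rightarrow> 'v \<times> real \<times> real \<Rightarrow> bool" for \<omega> where
  "\<lbrakk>0 < r; unobstructed \<omega> x s d r; s' = frac (s + d * r); (s', m) \<in> \<omega> {x, y}; x \<noteq> y;
    d' = (case m of Cross \<Rightarrow> d | Bar \<Rightarrow> - d)\<rbrakk>
   \<Longrightarrow> move \<omega> (x, s, d) (y, s', d')"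

text \<open>The set of points visited from a given state on. The vertical segments include both
  endpoints, so at a jump from \<open>x\<close> to \<open>y\<close> at time \<open>s\<close> both \<open>(x, s)\<close> and \<open>(y, s)\<close> are visited; this
  makes the set independent of the direction in which the closed trajectory is traversed.\<close>

definition trajectory :: "'v config \<Rightarrow> 'v \<times> real \<times> real \<Rightarrow> ('v \<times> real) set" where
  "trajectory \<omega> a = {(x, frac (s + d * r)) | x s d r.
     (move \<omega>)\<^sup>*\<^sup>* a (x, s, d) \<and> 0 \<le> r \<and> unobstructed \<omega> x s d r}"

definition loops :: "'v set \<Rightarrow> 'v config \<Rightarrow> ('v \<times> real) set set" where
  "loops V \<omega> = {trajectory \<omega> (x, s, d) | x s d. x \<in> V \<and> s \<in> {0..<1} \<and> d \<in> {1, -1}}"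

definition num_loops :: "'v set \<Rightarrow> 'v config \<Rightarrow> nat" where
  "num_loops V \<omega> = card (loops V \<omega>)"

definition loop_support :: "('v \<times> real) set \<Rightarrow> 'v set" where
  "loop_support \<gamma> = {x. \<exists>s. (x, s) \<in> \<gamma>}"


section \<open>The weighted loop measure\<close>

definition partition_function :: "'v set \<Rightarrow> 'v set set \<Rightarrow> real \<Rightarrow> real \<Rightarrow> real \<Rightarrow> real" where
  "partition_function V E \<theta> t u = (\<integral>w. \<theta> ^ num_loops V (config_of E w) \<partial>config_law E t u)"

definition loop_measure :: "'v set \<Rightarrow> 'v set set \<Rightarrow> real \<Rightarrow> real \<Rightarrow> real \<Rightarrow> 'v sample measure" where
  "loop_measure V E \<theta> t u = density (config_law E t u)
     (\<lambda>w. ennreal (\<theta> ^ num_loops V (config_of E w) / partition_function V E \<theta> t u))"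

definition large_loop :: "'v set \<Rightarrow> real \<Rightarrow> 'v config \<Rightarrow> bool" where
  "large_loop V \<eta> \<omega> \<longleftrightarrow> (\<exists>\<gamma>\<in>loops V \<omega>. real (card (loop_support \<gamma>)) > \<eta> * real (card V))"

definition prob_large_loop ::
    "'v set \<Rightarrow> 'v set set \<Rightarrow> real \<Rightarrow> real \<Rightarrow> real \<Rightarrow> real \<Rightarrow> real" where
  "prob_large_loop V E \<theta> t u \<eta> =
     measure (loop_measure V E \<theta> t u)
       {w \<in> space (loop_measure V E \<theta> t u). large_loop V \<eta> (config_of E w)}"

end

theory Submission
  imports Defs
begin

text \<open>The loops of a configuration depend on its marks only through their cyclic order in time. A
  sample of the Poisson processes therefore enters only through the word of marks met while going
  once around the circle. If there are \<open>m\<close> edges, a word \<open>w\<close> of length \<open>k\<close> in which the crosses and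
  bars contribute a factor \<open>p(w)\<close> appears with probability \<open>e\<^sup>-\<^sup>t\<^sup>m t\<^sup>k p(w) / k!\<close>. So the partition
  function is \<open>e\<^sup>-\<^sup>t\<^sup>m W(t)\<close>, where \<open>W\<close> is the exponential generating series of \<open>\<theta>\<close> to the number of
  loops of \<open>w\<close>, and the probability of a large loop is a quotient of two such series
  (\<open>partition_function_eq\<close>, \<open>prob_large_loop_eq\<close>).

  Differentiating such a series in \<open>t\<close> appends one letter to the words. A letter on the edge \<open>xy\<close>
  merges two loops if \<open>x\<close> and \<open>y\<close> lie on different loops at the end of the word. If they lie on the
  same loop, then one of cross and bar splits it and the other one leaves the number of loops
  unchanged (\<open>word_loops_append\<close>). If no loop is large, the loops cut the vertex set at a given time
  into small classes; by the sparsity hypothesis at most \<open>(1 + \<epsilon>) n\<close> edges lie inside these classes,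
  and all others merge. Merging multiplies the weight by \<open>1 / \<theta>\<close> and splitting by \<open>\<theta>\<close>. Hence the mean
  growth, which is \<open>(W' / W - m) / (\<theta> - 1)\<close> for \<open>\<theta> \<noteq> 1\<close> and the derivative of the mean number of loops
  for \<open>\<theta> = 1\<close>, would be at most \<open>- (m - (1 + \<epsilon>) (1 + \<theta> max u (1 - u)) n) / \<theta>\<close> in the absence of large
  loops, and this is negative of order \<open>n\<close> under the hypothesis on \<open>\<alpha>\<close>.

  The mean growth cannot stay that negative. If \<open>w\<close> is prolonged to \<open>w w'\<close>, all loops of \<open>w\<close> that
  do not cross the time where it is cut open survive, so at most \<open>n\<close> loops are lost
  (\<open>word_loops_concat\<close>). This bounds the integral of the mean growth over \<open>[a, a + s]\<close> from below by
  \<open>- \<kappa> n\<close> with \<open>\<kappa>\<close> depending on \<open>\<theta>\<close> only (\<open>integral_mean_growth_ge\<close>). For a sufficiently large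
  constant \<open>s\<close>, large loops must then have probability bounded away from \<open>0\<close> on average over
  \<open>[a, a + s]\<close>, uniformly in \<open>a\<close> (\<open>integral_prob_large_loop_ge\<close>).\<close>

section \<open>Changes of time\<close>

text \<open>An increasing bijection of \<open>[0, 1)\<close> fixes \<open>0\<close>, so it is an
  orientation-preserving homeomorphism of the circle that fixes the base point.\<close>

definition time_change :: "(real \<Rightarrow> real) \<Rightarrow> bool" where
  "time_change \<phi> \<longleftrightarrow> strict_mono_on {0..<1} \<phi> \<and> \<phi> ` {0..<1} = {0..<1}"

text \<open>The lift to the real line that commutes with integer translations. Along it the
  particle moves monotonically, so that the arcs of the circle in
  \<^const>\<open>unobstructed\<close> become intervals.\<close>

definition lift_circle :: "(real \<Rightarrow> real) \<Rightarrow> real \<Rightarrow> real" where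
  "lift_circle \<phi> x = \<phi> (frac x) + of_int \<lfloor>x\<rfloor>"

definition transport :: "(real \<Rightarrow> real) \<Rightarrow> 'v config \<Rightarrow> 'v config" where
  "transport \<phi> \<omega> = (\<lambda>e. map_prod \<phi> id ` \<omega> e)"

text \<open>A time change is injective on \<open>[0, 1)\<close> only; marks elsewhere could be
  identified with marks on the circle.\<close>

definition circle_config :: "'v config \<Rightarrow> bool" where
  "circle_config \<omega> \<longleftrightarrow> (\<forall>e. fst ` \<omega> e \<subseteq> {0..<1})"

lemma frac_circle: "frac (x::real) \<in> {0..<1}"
  using frac_ge_0[of x] frac_lt_1[of x] by simp

lemma frac_on_circle: "x \<in> {0..<1::real} \<Longrightarrow> frac x = x"
  by (simp add: frac_eq)

lemma time_change_circle: "time_change \<phi> \<Longrightarrow> x \<in> {0..<1} \<Longrightarrow> \<phi> x \<in> {0..<1}"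
  unfolding time_change_def by blast

lemma time_change_inj: "time_change \<phi> \<Longrightarrow> inj_on \<phi> {0..<1}"
  unfolding time_change_def by (simp add: strict_mono_on_imp_inj_on)

lemma frac_lift_circle:
  assumes "time_change \<phi>"
  shows "frac (lift_circle \<phi> x) = \<phi> (frac x)"
proof -
  have "\<phi> (frac x) \<in> {0..<1}" using assms frac_circle time_change_circle by blast
  then show ?thesis
    by (simp add: lift_circle_def frac_eq)
qed

lemma strict_mono_lift_circle:
  assumes "time_change \<phi>"
  shows "strict_mono (lift_circle \<phi>)"
proof
  fix x y :: real assume xy: "x < y"
  have r: "\<phi> (frac x) \<in> {0..<1}" "\<phi> (frac y) \<in> {0..<1}"
    using assms frac_circle time_change_circle by blast+
  show "lift_circle \<phi> x < lift_circle \<phi> y"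
  proof (cases "\<lfloor>x\<rfloor> = \<lfloor>y\<rfloor>")
    case True
    then have "frac x < frac y" using xy by (simp add: frac_def)
    then have "\<phi> (frac x) < \<phi> (frac y)"
      using assms frac_circle unfolding time_change_def strict_mono_on_def by blast
    then show ?thesis using True by (simp add: lift_circle_def)
  next
    case False
    then have "\<lfloor>x\<rfloor> + 1 \<le> \<lfloor>y\<rfloor>" using xy floor_mono[of x y] by linarith
    then have "real_of_int \<lfloor>x\<rfloor> + 1 \<le> real_of_int \<lfloor>y\<rfloor>" by linarith
    then show ?thesis using r by (simp add: lift_circle_def)
  qed
qed

lemma surj_lift_circle:
  assumes "time_change \<phi>"
  shows "\<exists>x. lift_circle \<phi> x = y"
proof -
  have "frac y \<in> \<phi> ` {0..<1}" using assms frac_circle unfolding time_change_def by blast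
  then obtain z where z: "z \<in> {0..<1}" "\<phi> z = frac y" by auto
  have "\<lfloor>z\<rfloor> = 0" using z(1) by (simp add: floor_eq_iff)
  then have "lift_circle \<phi> (z + of_int \<lfloor>y\<rfloor>) = y"
    using z(2) by (simp add: lift_circle_def frac_def)
  then show ?thesis by blast
qed

lemma lift_circle_on_circle: "x \<in> {0..<1} \<Longrightarrow> lift_circle \<phi> x = \<phi> x"
  by (simp add: lift_circle_def frac_on_circle floor_eq_iff)

lemma marked_transport:
  assumes "time_change \<phi>" "circle_config \<omega>" "s \<in> {0..<1}"
  shows "marked (transport \<phi> \<omega>) x (\<phi> s) \<longleftrightarrow> marked \<omega> x s"
proof -
  have "(\<phi> s, m) \<in> transport \<phi> \<omega> e \<longleftrightarrow> (s, m) \<in> \<omega> e" for e m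
  proof
    assume "(\<phi> s, m) \<in> transport \<phi> \<omega> e"
    then obtain s' where s': "(s', m) \<in> \<omega> e" "\<phi> s = \<phi> s'" by (auto simp: transport_def)
    then have "s' \<in> {0..<1}" using assms(2) unfolding circle_config_def by force
    then have "s = s'" using s' assms time_change_inj[OF assms(1)] by (metis inj_onD)
    then show "(s, m) \<in> \<omega> e" using s' by simp
  next
    assume "(s, m) \<in> \<omega> e" then show "(\<phi> s, m) \<in> transport \<phi> \<omega> e"
      unfolding transport_def by force
  qed
  then show ?thesis by (simp add: marked_def)
qed

text \<open>The image of the arc of length \<open>r\<close> that starts at \<open>s\<close> in
  direction \<open>d\<close> is an arc in the same direction of this length.\<close>

definition transport_length :: "(real \<Rightarrow> real) \<Rightarrow> real \<Rightarrow> real \<Rightarrow> real \<Rightarrow> real" where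
  "transport_length \<phi> s d r = d * (lift_circle \<phi> (s + d * r) - lift_circle \<phi> s)"

lemma transport_length_less_iff:
  assumes "time_change \<phi>" "d \<in> {1, -1}"
  shows "transport_length \<phi> s d q < transport_length \<phi> s d r \<longleftrightarrow> q < r"
  using assms(2) strict_mono_less[OF strict_mono_lift_circle[OF assms(1)]]
  by (auto simp: transport_length_def)

lemma transport_length_0 [simp]: "transport_length \<phi> s d 0 = 0"
  by (simp add: transport_length_def)

lemma transport_length_pos:
  assumes "time_change \<phi>" "d \<in> {1, -1}"
  shows "0 < transport_length \<phi> s d r \<longleftrightarrow> 0 < r"
  using transport_length_less_iff[OF assms, of s 0 r] by simp

lemma transport_length_surj:
  assumes "time_change \<phi>" "d \<in> {1, -1}"
  obtains q where "transport_length \<phi> s d q = q'"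
proof -
  obtain x where x: "lift_circle \<phi> x = lift_circle \<phi> s + d * q'"
    using surj_lift_circle[OF assms(1)] by blast
  have dd: "d * (d * z) = z" for z using assms(2) by auto
  have "transport_length \<phi> s d (d * (x - s)) = q'"
    by (simp add: transport_length_def dd x)
  then show ?thesis using that by blast
qed

lemma frac_transport_length:
  assumes "time_change \<phi>" "d \<in> {1, -1}" "s \<in> {0..<1}"
  shows "frac (\<phi> s + d * transport_length \<phi> s d r) = \<phi> (frac (s + d * r))"
proof -
  have dd: "d * (d * z) = z" for z using assms(2) by auto
  show ?thesis
    using frac_lift_circle[OF assms(1), of "s + d * r"]
    by (simp add: transport_length_def dd lift_circle_on_circle[OF assms(3)])
qed

lemma unobstructed_transport:
  assumes "time_change \<phi>" "circle_config \<omega>" "s \<in> {0..<1}" "d \<in> {1, -1}"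
    and "unobstructed \<omega> x s d r"
  shows "unobstructed (transport \<phi> \<omega>) x (\<phi> s) d (transport_length \<phi> s d r)"
  unfolding unobstructed_def
proof
  fix q' assume q': "q' \<in> {0<..<transport_length \<phi> s d r}"
  obtain q where q: "transport_length \<phi> s d q = q'"
    using transport_length_surj[OF assms(1,4)] by blast
  have "q \<in> {0<..<r}"
    using q' transport_length_less_iff[OF assms(1,4)] transport_length_pos[OF assms(1,4)]
    unfolding q[symmetric] by auto
  then have "\<not> marked \<omega> x (frac (s + d * q))" using assms(5) by (auto simp: unobstructed_def)
  then show "\<not> marked (transport \<phi> \<omega>) x (frac (\<phi> s + d * q'))"
    unfolding q[symmetric] frac_transport_length[OF assms(1,4,3)]
    using marked_transport[OF assms(1,2) frac_circle] by blast
qed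

lemma move_circle:
  assumes "move \<omega> (x, s, d) (y, s', d')" "d \<in> {1, -1}"
  shows "s' \<in> {0..<1} \<and> d' \<in> {1, -1}"
  using assms by cases (auto split: mark.splits simp: frac_lt_1)

lemma move_transport:
  assumes "time_change \<phi>" "circle_config \<omega>" "s \<in> {0..<1}" "d \<in> {1, -1}"
    and "move \<omega> (x, s, d) (y, s', d')"
  shows "move (transport \<phi> \<omega>) (x, \<phi> s, d) (y, \<phi> s', d')"
  using assms(5)
proof cases
  case (1 r m)
  show ?thesis
  proof (rule move.intros)
    show "0 < transport_length \<phi> s d r" using 1 transport_length_pos[OF assms(1,4)] by simp
    show "unobstructed (transport \<phi> \<omega>) x (\<phi> s) d (transport_length \<phi> s d r)"
      using unobstructed_transport[OF assms(1-4)] 1 by blast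
    show "\<phi> s' = frac (\<phi> s + d * transport_length \<phi> s d r)"
      using frac_transport_length[OF assms(1,4,3)] 1 by simp
    show "(\<phi> s', m) \<in> transport \<phi> \<omega> {x, y}" using 1 by (force simp: transport_def)
  qed (use 1 in auto)
qed

lemma moves_transport:
  assumes "time_change \<phi>" "circle_config \<omega>" "s \<in> {0..<1}" "d \<in> {1, -1}"
    and "(move \<omega>)\<^sup>*\<^sup>* (x, s, d) (y, s', d')"
  shows "(move (transport \<phi> \<omega>))\<^sup>*\<^sup>* (x, \<phi> s, d) (y, \<phi> s', d') \<and> s' \<in> {0..<1} \<and> d' \<in> {1, -1}"
  using assms(5)
proof (induction "(y, s', d')" arbitrary: y s' d' rule: rtranclp_induct)
  case base
  then show ?case using assms by auto
next
  case (step b)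
  obtain z t c where b: "b = (z, t, c)" by (cases b)
  have IH: "(move (transport \<phi> \<omega>))\<^sup>*\<^sup>* (x, \<phi> s, d) (z, \<phi> t, c)" "t \<in> {0..<1}" "c \<in> {1, -1}"
    using step(3)[OF b] by auto
  have "move (transport \<phi> \<omega>) (z, \<phi> t, c) (y, \<phi> s', d')"
    using move_transport[OF assms(1,2) IH(2,3)] step(2) b by blast
  then show ?case using IH move_circle[of \<omega> z t c y s' d'] step(2) b
    by (meson rtranclp.rtrancl_into_rtrancl)
qed

lemma trajectory_transport_subset:
  assumes "time_change \<phi>" "circle_config \<omega>" "s \<in> {0..<1}" "d \<in> {1, -1}"
  shows "map_prod id \<phi> ` trajectory \<omega> (x, s, d) \<subseteq> trajectory (transport \<phi> \<omega>) (x, \<phi> s, d)"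
proof
  fix p assume "p \<in> map_prod id \<phi> ` trajectory \<omega> (x, s, d)"
  then obtain y t c r where *: "p = (y, \<phi> (frac (t + c * r)))" "(move \<omega>)\<^sup>*\<^sup>* (x, s, d) (y, t, c)"
    "0 \<le> r" "unobstructed \<omega> y t c r"
    unfolding trajectory_def by auto
  note m = moves_transport[OF assms *(2)]
  have "p = (y, frac (\<phi> t + c * transport_length \<phi> t c r))"
    using frac_transport_length[OF assms(1)] m * by simp
  moreover have "unobstructed (transport \<phi> \<omega>) y (\<phi> t) c (transport_length \<phi> t c r)"
    using unobstructed_transport[OF assms(1,2)] m * by blast
  moreover have "0 \<le> transport_length \<phi> t c r"
    using *(3) transport_length_less_iff[OF assms(1), of c t r 0] m by force
  ultimately show "p \<in> trajectory (transport \<phi> \<omega>) (x, \<phi> s, d)"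
    using m unfolding trajectory_def by blast
qed

lemma time_change_inverse:
  assumes "time_change \<phi>"
  defines "\<psi> \<equiv> the_inv_into {0..<1} \<phi>"
  shows "time_change \<psi>" "\<And>x. x \<in> {0..<1} \<Longrightarrow> \<psi> (\<phi> x) = x" "\<And>x. x \<in> {0..<1} \<Longrightarrow> \<phi> (\<psi> x) = x"
proof -
  note inj = time_change_inj[OF assms(1)]
  have im: "\<phi> ` {0..<1} = {0..<1}" using assms(1) by (simp add: time_change_def)
  show a: "\<psi> (\<phi> x) = x" if "x \<in> {0..<1}" for x
    unfolding \<psi>_def by (rule the_inv_into_f_f[OF inj that])
  show b: "\<phi> (\<psi> x) = x" if "x \<in> {0..<1}" for x
    unfolding \<psi>_def using f_the_inv_into_f[OF inj] that im by blast
  have c: "\<psi> ` {0..<1} = {0..<1}"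
    unfolding \<psi>_def using the_inv_into_onto[OF inj] im by simp
  have "strict_mono_on {0..<1} \<psi>"
  proof (rule strict_mono_onI)
    fix x y :: real assume h: "x \<in> {0..<1}" "y \<in> {0..<1}" "x < y"
    have i: "\<psi> x \<in> {0..<1}" "\<psi> y \<in> {0..<1}" using c h by blast+
    show "\<psi> x < \<psi> y"
    proof (rule ccontr)
      assume "\<not> \<psi> x < \<psi> y"
      then have "\<phi> (\<psi> y) \<le> \<phi> (\<psi> x)"
        using assms(1) i unfolding time_change_def
        by (metis linorder_not_less order_le_less strict_mono_onD)
      then show False using b h by simp
    qed
  qed
  then show "time_change \<psi>" using c by (simp add: time_change_def)
qed

lemma circle_config_transport:
  assumes "time_change \<phi>" "circle_config \<omega>" shows "circle_config (transport \<phi> \<omega>)"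
  unfolding circle_config_def
proof (intro allI subsetI)
  fix e y assume "y \<in> fst ` transport \<phi> \<omega> e"
  then obtain s m where "(s, m) \<in> \<omega> e" "y = \<phi> s" by (auto simp: transport_def)
  then have "s \<in> {0..<1}" using assms(2) unfolding circle_config_def by force
  then show "y \<in> {0..<1}" using \<open>y = \<phi> s\<close> time_change_circle[OF assms(1)] by blast
qed

lemma transport_inverse:
  assumes "time_change \<phi>" "circle_config \<omega>"
  shows "transport (the_inv_into {0..<1} \<phi>) (transport \<phi> \<omega>) = \<omega>"
proof
  fix e
  have "map_prod (the_inv_into {0..<1} \<phi>) id (map_prod \<phi> id p) = p" if "p \<in> \<omega> e" for p
  proof -
    have "fst p \<in> {0..<1}" using that assms(2) unfolding circle_config_def by blast
    then show ?thesis using time_change_inverse(2)[OF assms(1)] by (cases p) auto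
  qed
  then show "transport (the_inv_into {0..<1} \<phi>) (transport \<phi> \<omega>) e = \<omega> e"
    by (force simp: transport_def image_image)
qed

lemma trajectory_circle: "p \<in> trajectory \<omega> a \<Longrightarrow> snd p \<in> {0..<1}"
  unfolding trajectory_def using frac_circle by auto

text \<open>One inclusion holds for every time change; applied to the inverse time change and
  the transported configuration it gives the other one.\<close>

lemma trajectory_transport:
  assumes "time_change \<phi>" "circle_config \<omega>" "s \<in> {0..<1}" "d \<in> {1, -1}"
  shows "trajectory (transport \<phi> \<omega>) (x, \<phi> s, d) = map_prod id \<phi> ` trajectory \<omega> (x, s, d)"
proof
  let ?\<psi> = "the_inv_into {0..<1} \<phi>" and ?T = "trajectory (transport \<phi> \<omega>) (x, \<phi> s, d)"
  note inv = time_change_inverse[OF assms(1)]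
  have sub: "map_prod id ?\<psi> ` ?T \<subseteq> trajectory \<omega> (x, s, d)"
    using trajectory_transport_subset[OF inv(1) circle_config_transport[OF assms(1,2)]
        time_change_circle[OF assms(1,3)] assms(4), of x]
    by (simp add: inv(2)[OF assms(3)] transport_inverse[OF assms(1,2)])
  show "?T \<subseteq> map_prod id \<phi> ` trajectory \<omega> (x, s, d)"
  proof
    fix p assume p: "p \<in> ?T"
    then have "p = map_prod id \<phi> (map_prod id ?\<psi> p)"
      using inv(3)[OF trajectory_circle[OF p]] by (cases p) auto
    moreover have "map_prod id ?\<psi> p \<in> trajectory \<omega> (x, s, d)" using sub p by blast
    ultimately show "p \<in> map_prod id \<phi> ` trajectory \<omega> (x, s, d)" by (rule image_eqI)
  qed
qed (rule trajectory_transport_subset[OF assms])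

lemma loops_transport:
  assumes "time_change \<phi>" "circle_config \<omega>"
  shows "loops V (transport \<phi> \<omega>) = (\<lambda>\<gamma>. map_prod id \<phi> ` \<gamma>) ` loops V \<omega>"
proof
  show "loops V (transport \<phi> \<omega>) \<subseteq> (\<lambda>\<gamma>. map_prod id \<phi> ` \<gamma>) ` loops V \<omega>"
  proof
    fix \<gamma> assume "\<gamma> \<in> loops V (transport \<phi> \<omega>)"
    then obtain x s d where *: "\<gamma> = trajectory (transport \<phi> \<omega>) (x, s, d)" "x \<in> V" "s \<in> {0..<1}"
      "d \<in> {1, -1}" unfolding loops_def by blast
    obtain s0 where s0: "s0 \<in> {0..<1}" "s = \<phi> s0"
      using *(3) assms(1) unfolding time_change_def by blast
    have "\<gamma> = map_prod id \<phi> ` trajectory \<omega> (x, s0, d)"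
      using trajectory_transport[OF assms s0(1) *(4)] * s0 by simp
    then show "\<gamma> \<in> (\<lambda>\<gamma>. map_prod id \<phi> ` \<gamma>) ` loops V \<omega>"
      using * s0 unfolding loops_def by blast
  qed
  show "(\<lambda>\<gamma>. map_prod id \<phi> ` \<gamma>) ` loops V \<omega> \<subseteq> loops V (transport \<phi> \<omega>)"
  proof
    fix \<gamma> assume "\<gamma> \<in> (\<lambda>\<gamma>. map_prod id \<phi> ` \<gamma>) ` loops V \<omega>"
    then obtain x s d where *: "\<gamma> = map_prod id \<phi> ` trajectory \<omega> (x, s, d)" "x \<in> V" "s \<in> {0..<1}"
      "d \<in> {1, -1}" unfolding loops_def by blast
    then have "\<gamma> = trajectory (transport \<phi> \<omega>) (x, \<phi> s, d)"
      using trajectory_transport[OF assms *(3,4)] by simp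
    then show "\<gamma> \<in> loops V (transport \<phi> \<omega>)"
      using * time_change_circle[OF assms(1) *(3)] unfolding loops_def by blast
  qed
qed

text \<open>A time change carries trajectories to trajectories and does not move vertices. This
  is the precise form of the statement that only the order of the marks matters: two
  configurations with the same order of marks differ by a time change, by
  \<open>time_change_exists\<close>.\<close>

lemma num_loops_transport:
  assumes "time_change \<phi>" "circle_config \<omega>"
  shows "num_loops V (transport \<phi> \<omega>) = num_loops V \<omega>"
proof -
  have inj: "inj_on (map_prod id \<phi>) (UNIV \<times> {0..<1} :: ('a \<times> real) set)"
    using time_change_inj[OF assms(1)] by (intro map_prod_inj_on) simp_all
  have sub: "\<gamma> \<subseteq> UNIV \<times> {0..<1}" if \<gamma>: "\<gamma> \<in> loops V \<omega>" for \<gamma> :: "('a \<times> real) set"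
  proof
    fix p assume "p \<in> \<gamma>"
    then have "snd p \<in> {0..<1}" using \<gamma> trajectory_circle[of p \<omega>] unfolding loops_def by blast
    then show "p \<in> UNIV \<times> {0..<1}" by (cases p) simp
  qed
  have "inj_on (\<lambda>\<gamma>. map_prod id \<phi> ` \<gamma>) (loops V \<omega>)"
  proof (rule inj_onI)
    fix \<gamma> \<gamma>' assume h: "\<gamma> \<in> loops V \<omega>" "\<gamma>' \<in> loops V \<omega>" "map_prod id \<phi> ` \<gamma> = map_prod id \<phi> ` \<gamma>'"
    then show "\<gamma> = \<gamma>'" using inj_on_image_eq_iff[OF inj sub[OF h(1)] sub[OF h(2)]] by blast
  qed
  then show ?thesis
    unfolding num_loops_def loops_transport[OF assms] by (rule card_image)
qed

lemma large_loop_transport: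
  assumes "time_change \<phi>" "circle_config \<omega>"
  shows "large_loop V \<eta> (transport \<phi> \<omega>) \<longleftrightarrow> large_loop V \<eta> \<omega>"
proof -
  have "loop_support (map_prod id \<phi> ` \<gamma>) = loop_support \<gamma>" for \<gamma> :: "('a \<times> real) set"
  proof -
    have "loop_support \<gamma>' = fst ` \<gamma>'" for \<gamma>' :: "('a \<times> real) set"
      unfolding loop_support_def by force
    then show ?thesis by (simp add: image_image)
  qed
  then show ?thesis unfolding large_loop_def loops_transport[OF assms] by simp
qed

text \<open>Induction on the number of prescribed values: a prescribed point cuts both intervals
  in two, and without prescribed points an affine map will do. The half-open intervals glue to
  half-open intervals.\<close>

lemma interpolation_exists:
  fixes l r l' r' :: real
  assumes "finite A" "A \<subseteq> {l<..<r}" "strict_mono_on A f" "f ` A \<subseteq> {l'<..<r'}" "l < r" "l' < r'"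
  shows "\<exists>\<phi>. strict_mono_on {l..<r} \<phi> \<and> \<phi> ` {l..<r} = {l'..<r'} \<and> (\<forall>a\<in>A. \<phi> a = f a)"
  using assms
proof (induction A arbitrary: l r l' r' rule: finite_psubset_induct)
  case (psubset A)
  show ?case
  proof (cases "A = {}")
    case True
    define c where "c = (r' - l') / (r - l)"
    define \<phi> where "\<phi> x = l' + c * (x - l)" for x
    have c: "c > 0" "c * (r - l) = r' - l'" using psubset.prems by (auto simp: c_def)
    have "strict_mono_on {l..<r} \<phi>"
      using c by (auto simp: strict_mono_on_def \<phi>_def)
    moreover have "\<phi> ` {l..<r} = {l'..<r'}"
    proof
      show "\<phi> ` {l..<r} \<subseteq> {l'..<r'}"
      proof
        fix y assume "y \<in> \<phi> ` {l..<r}"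
        then obtain x where x: "l \<le> x" "x < r" "y = \<phi> x" by auto
        have "c * (x - l) < c * (r - l)" using x c(1) by (intro mult_strict_left_mono) auto
        then have "c * (x - l) < r' - l'" using c(2) by simp
        moreover have "0 \<le> c * (x - l)" using x c(1) by simp
        ultimately show "y \<in> {l'..<r'}" using x(3) by (simp add: \<phi>_def)
      qed
      show "{l'..<r'} \<subseteq> \<phi> ` {l..<r}"
      proof
        fix y assume y: "y \<in> {l'..<r'}"
        define x where "x = l + (y - l') / c"
        have "y - l' < (r - l) * c" using y c(2) by (simp add: mult.commute)
        then have "(y - l') / c < r - l" using c(1) by (simp only: pos_divide_less_eq)
        moreover have "0 \<le> (y - l') / c" using y c(1) by simp
        ultimately have "x \<in> {l..<r}" by (simp add: x_def)
        moreover have "\<phi> x = y" using c(1) by (simp add: x_def \<phi>_def)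
        ultimately
        show "y \<in> \<phi> ` {l..<r}" by blast
      qed
    qed
    ultimately show ?thesis using True by blast
  next
    case False
    then obtain a where a: "a \<in> A" by blast
    let ?L = "A \<inter> {l<..<a}" and ?R = "A \<inter> {a<..<r}"
    have fa: "l' < f a" "f a < r'" "l < a" "a < r" using a psubset.prems by auto
    have "?L \<subset> A" "?R \<subset> A" using a by auto
    note mono = strict_mono_onD[OF \<open>strict_mono_on A f\<close>]
    have sm: "strict_mono_on ?L f" "strict_mono_on ?R f"
      using psubset.prems(2) by (auto simp: strict_mono_on_def)
    have "f ` ?L \<subseteq> {l'<..<f a}"
    proof (rule image_subsetI)
      fix x assume x: "x \<in> ?L"
      then have "f x < f a" using a by (intro mono) auto
      then show "f x \<in> {l'<..<f a}" using x psubset.prems(3) by auto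
    qed
    have "f ` ?R \<subseteq> {f a<..<r'}"
    proof (rule image_subsetI)
      fix x assume x: "x \<in> ?R"
      then have "f a < f x" using a by (intro mono) auto
      then show "f x \<in> {f a<..<r'}" using x psubset.prems(3) by auto
    qed
    obtain \<phi>1 where 1: "strict_mono_on {l..<a} \<phi>1" "\<phi>1 ` {l..<a} = {l'..<f a}" "\<forall>x\<in>?L. \<phi>1 x = f x"
      using psubset.IH[OF \<open>?L \<subset> A\<close> _ sm(1) \<open>f ` ?L \<subseteq> _\<close> fa(3,1)] by auto
    obtain \<phi>2 where 2: "strict_mono_on {a..<r} \<phi>2" "\<phi>2 ` {a..<r} = {f a..<r'}" "\<forall>x\<in>?R. \<phi>2 x = f x"
      using psubset.IH[OF \<open>?R \<subset> A\<close> _ sm(2) \<open>f ` ?R \<subseteq> _\<close> fa(4,2)] by auto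
    have \<phi>2a: "\<phi>2 a = f a"
    proof -
      have "f a \<in> \<phi>2 ` {a..<r}" using 2 fa by simp
      then obtain z where z: "z \<in> {a..<r}" "\<phi>2 z = f a" by auto
      have "\<phi>2 a \<in> \<phi>2 ` {a..<r}" using fa by (intro imageI) simp
      then have "f a \<le> \<phi>2 a" unfolding 2(2) by simp
      then have "\<not> a < z" using strict_mono_onD[OF 2(1), of a z] z fa by fastforce
      then have "z = a" using z(1) by simp
      then show ?thesis using z(2) by simp
    qed
    define \<phi> where "\<phi> x = (if x < a then \<phi>1 x else \<phi>2 x)" for x
    have "strict_mono_on {l..<r} \<phi>"
    proof (rule strict_mono_onI)
      fix x y assume h: "x \<in> {l..<r}" "y \<in> {l..<r}" "x < y"
      consider "y < a" | "x < a" "a \<le> y" | "a \<le> x" by linarith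
      then show "\<phi> x < \<phi> y"
      proof cases
        case c1: 1
        then show ?thesis using h strict_mono_onD[OF 1(1), of x y] by (simp add: \<phi>_def)
      next
        case c2: 2
        have "\<phi>1 x \<in> \<phi>1 ` {l..<a}" "\<phi>2 y \<in> \<phi>2 ` {a..<r}" using h c2 by auto
        then have "\<phi>1 x < f a" "f a \<le> \<phi>2 y" unfolding 1(2) 2(2) by auto
        then show ?thesis using c2 by (simp add: \<phi>_def)
      next
        case c3: 3
        then show ?thesis using h strict_mono_onD[OF 2(1), of x y] by (simp add: \<phi>_def)
      qed
    qed
    moreover have "\<phi> ` {l..<r} = {l'..<r'}"
    proof -
      have "{l..<r} = {l..<a} \<union> {a..<r}" using fa by auto
      moreover have "\<phi> ` {l..<a} = \<phi>1 ` {l..<a}" "\<phi> ` {a..<r} = \<phi>2 ` {a..<r}"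
        by (auto simp: \<phi>_def)
      moreover have "{l'..<f a} \<union> {f a..<r'} = {l'..<r'}" using fa by auto
      ultimately show ?thesis using 1 2 by (simp add: image_Un)
    qed
    moreover have "\<phi> x = f x" if "x \<in> A" for x
    proof -
      consider "x < a" | "x = a" | "a < x" by linarith
      then show ?thesis
      proof cases
        case c1: 1
        then have "x \<in> ?L" using that psubset.prems(1) by auto
        then show ?thesis using 1(3) c1 by (simp add: \<phi>_def)
      next
        case c2: 2
        then show ?thesis using \<phi>2a by (simp add: \<phi>_def)
      next
        case c3: 3
        then have "x \<in> ?R" using that psubset.prems(1) by auto
        then show ?thesis using 2(3) c3 by (simp add: \<phi>_def)
      qed
    qed
    ultimately show ?thesis by blast
  qed
qed

lemma time_change_exists:
  assumes "finite A" "A \<subseteq> {0..<1}" "strict_mono_on A f" "f ` A \<subseteq> {0..<1}"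
    and "\<And>a. a \<in> A \<Longrightarrow> a = 0 \<longleftrightarrow> f a = 0"
  shows "\<exists>\<phi>. time_change \<phi> \<and> (\<forall>a\<in>A. \<phi> a = f a)"
proof -
  let ?A = "A - {0}"
  have *: "?A \<subseteq> {0<..<1}" using assms(2) by (auto simp: order_less_le)
  have **: "f ` ?A \<subseteq> {0<..<1}"
  proof (rule image_subsetI)
    fix x assume x: "x \<in> ?A"
    then have "f x \<in> {0..<1}" "f x \<noteq> 0" using assms(4,5) by blast+
    then show "f x \<in> {0<..<1}" by simp
  qed
  have "strict_mono_on ?A f" using assms(3) by (auto simp: strict_mono_on_def)
  then have "\<exists>\<phi>. strict_mono_on {0..<1} \<phi> \<and> \<phi> ` {0..<1} = {0..<1} \<and> (\<forall>a\<in>?A. \<phi> a = f a)"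
    using * ** assms(1) by (intro interpolation_exists) simp_all
  then obtain \<phi> where \<phi>: "strict_mono_on {0..<1} \<phi>" "\<phi> ` {0..<1} = {0..<1}" "\<forall>a\<in>?A. \<phi> a = f a"
    by blast
  have "\<phi> 0 = 0"
  proof -
    have "0 \<in> \<phi> ` {0..<1::real}" using \<phi>(2) by simp
    then obtain z where z: "z \<in> {0..<1}" "0 = \<phi> z" by blast
    have "\<phi> 0 \<in> \<phi> ` {0..<1::real}" by (rule imageI) simp
    then have "\<phi> 0 \<ge> 0" unfolding \<phi>(2) by simp
    then have "\<not> 0 < z" using strict_mono_onD[OF \<phi>(1), of 0 z] z by auto
    then have "z = 0" using z by simp
    then show ?thesis using z by simp
  qed
  then have "\<forall>a\<in>A. \<phi> a = f a" using \<phi>(3) assms(5) by (metis Diff_iff singletonD)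
  then show ?thesis using \<phi> by (auto simp: time_change_def)
qed

section \<open>Connected components of a set of links\<close>

text \<open>The equivalence relation generated by \<open>L\<close>, on the whole type.\<close>

definition conn :: "('a \<times> 'a) set \<Rightarrow> ('a \<times> 'a) set" where
  "conn L = (L \<union> L\<inverse>)\<^sup>*"

lemma conn_refl [simp, intro]: "(x, x) \<in> conn L"
  by (simp add: conn_def)

lemma conn_sym: "(x, y) \<in> conn L \<Longrightarrow> (y, x) \<in> conn L"
  unfolding conn_def by (meson sym_Un_converse sym_rtrancl symD)

lemma conn_trans: "(x, y) \<in> conn L \<Longrightarrow> (y, z) \<in> conn L \<Longrightarrow> (x, z) \<in> conn L"
  unfolding conn_def by (rule rtrancl_trans)

lemma conn_link: "(x, y) \<in> L \<Longrightarrow> (x, y) \<in> conn L"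
  unfolding conn_def by blast

lemma links_subset_conn: "L \<subseteq> conn L"
  by (rule subrelI) (rule conn_link)

lemma conn_induct [consumes 1, case_names refl link link_rev]:
  assumes "(x, y) \<in> conn L" "P x"
    and "\<And>y z. (x, y) \<in> conn L \<Longrightarrow> P y \<Longrightarrow> (y, z) \<in> L \<Longrightarrow> P z"
    and "\<And>y z. (x, y) \<in> conn L \<Longrightarrow> P y \<Longrightarrow> (z, y) \<in> L \<Longrightarrow> P z"
  shows "P y"
  using assms(1) unfolding conn_def
proof (induction rule: rtrancl_induct)
  case (step y z)
  then show ?case using assms(3,4) unfolding conn_def by blast
qed (rule assms(2))

lemma conn_least:
  assumes "(x, y) \<in> conn L" "L \<subseteq> Q" "\<And>x. (x, x) \<in> Q" "\<And>x y. (x, y) \<in> Q \<Longrightarrow> (y, x) \<in> Q"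
    "\<And>x y z. (x, y) \<in> Q \<Longrightarrow> (y, z) \<in> Q \<Longrightarrow> (x, z) \<in> Q"
  shows "(x, y) \<in> Q"
  using assms(1)
proof (induction rule: conn_induct)
  case refl then show ?case using assms(3) by blast
next
  case (link y z) then show ?case using assms(2,5) by blast
next
  case (link_rev y z) then show ?case using assms(2,4,5) by blast
qed

lemma conn_mono_conn: "L \<subseteq> conn L' \<Longrightarrow> conn L \<subseteq> conn L'"
proof (rule subrelI)
  fix x y assume "L \<subseteq> conn L'" "(x, y) \<in> conn L"
  from conn_least[OF this(2,1) conn_refl conn_sym conn_trans] show "(x, y) \<in> conn L'" .
qed

lemma conn_mono: "L \<subseteq> L' \<Longrightarrow> conn L \<subseteq> conn L'"
  by (rule conn_mono_conn) (rule order_trans[OF _ links_subset_conn])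

lemma conn_eqI: "L \<subseteq> conn L' \<Longrightarrow> L' \<subseteq> conn L \<Longrightarrow> conn L = conn L'"
  using conn_mono_conn by blast

lemma class_eq_iff: "conn L `` {x} = conn L `` {y} \<longleftrightarrow> (x, y) \<in> conn L"
proof
  assume "conn L `` {x} = conn L `` {y}"
  then have "y \<in> conn L `` {x}" by simp
  then show "(x, y) \<in> conn L" by simp
next
  assume xy: "(x, y) \<in> conn L"
  show "conn L `` {x} = conn L `` {y}"
    using conn_trans[OF xy] conn_trans[OF conn_sym[OF xy]] by blast
qed

lemma conn_insert_iff:
  "(x, y) \<in> conn (insert (p, q) L) \<longleftrightarrow> (x, y) \<in> conn L \<or>
     (((x, p) \<in> conn L \<or> (x, q) \<in> conn L) \<and> ((y, p) \<in> conn L \<or> (y, q) \<in> conn L))"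
    (is "_ \<longleftrightarrow> ?Q x y")
proof
  assume "(x, y) \<in> conn (insert (p, q) L)"
  then have "(x, y) \<in> {(x, y). ?Q x y}"
  proof (rule conn_least)
    show "insert (p, q) L \<subseteq> {(x, y). ?Q x y}" using conn_link by fastforce
  qed (use conn_sym conn_trans in \<open>fast+\<close>)
  then show "?Q x y" by simp
next
  have mono: "(x, y) \<in> conn (insert (p, q) L)" if "(x, y) \<in> conn L" for x y
    using that conn_mono[of L "insert (p, q) L"] by blast
  have pq: "(p, q) \<in> conn (insert (p, q) L)" by (rule conn_link) simp
  have toq: "(z, q) \<in> conn (insert (p, q) L)" if "(z, p) \<in> conn L \<or> (z, q) \<in> conn L" for z
    using that mono conn_trans[OF _ pq] by blast
  assume "?Q x y"
  then show "(x, y) \<in> conn (insert (p, q) L)"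
    using mono conn_trans[OF toq conn_sym[OF toq]] by blast
qed

lemma conn_insert_redundant:
  "(p, q) \<in> conn L \<Longrightarrow> conn (insert (p, q) L) = conn L"
  using links_subset_conn[of L] links_subset_conn[of "insert (p, q) L"]
  by (intro conn_eqI) auto

lemma conn_commute: "(x, y) \<in> conn L \<longleftrightarrow> (y, x) \<in> conn L"
  by (rule iffI) (erule conn_sym)+

lemma conn_cong: "(x, y) \<in> conn L \<Longrightarrow> (x, z) \<in> conn L \<longleftrightarrow> (y, z) \<in> conn L"
  unfolding class_eq_iff[symmetric] by blast

lemma class_insert:
  assumes "(x, p) \<in> conn L \<or> (x, q) \<in> conn L"
  shows "conn (insert (p, q) L) `` {x} = conn L `` {p} \<union> conn L `` {q}"
proof (rule set_eqI)
  fix y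
  have "(x, y) \<in> conn L \<Longrightarrow> (p, y) \<in> conn L \<or> (q, y) \<in> conn L"
    using assms conn_cong[of x p L y] conn_cong[of x q L y] by blast
  then show "y \<in> conn (insert (p, q) L) `` {x} \<longleftrightarrow> y \<in> conn L `` {p} \<union> conn L `` {q}"
    using assms conn_commute[of y p] conn_commute[of y q]
    by (simp add: conn_insert_iff) blast
qed

text \<open>A link between two different classes replaces them by their union.\<close>

lemma card_classes_insert:
  assumes "finite D" "p \<in> D" "q \<in> D" "(p, q) \<notin> conn L"
  shows "card (D // conn L) = card (D // conn (insert (p, q) L)) + 1"
proof -
  let ?c = "\<lambda>x. conn L `` {x}" and ?d = "\<lambda>x. conn (insert (p, q) L) `` {x}"
  note d1 = class_insert[of _ p L q]
  have d2: "?d x = ?c x" if "\<not> ((x, p) \<in> conn L \<or> (x, q) \<in> conn L)" for x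
    using that conn_insert_iff[of _ _ p q L] by auto
  have "D // conn (insert (p, q) L) = insert (?c p \<union> ?c q) (D // conn L - {?c p, ?c q})"
  proof (intro equalityI subsetI)
    fix X assume "X \<in> D // conn (insert (p, q) L)"
    then obtain x where x: "x \<in> D" "X = ?d x" by (auto simp: quotient_def)
    show "X \<in> insert (?c p \<union> ?c q) (D // conn L - {?c p, ?c q})"
    proof (cases "(x, p) \<in> conn L \<or> (x, q) \<in> conn L")
      case True then show ?thesis using d1 x by simp
    next
      case False
      then have "?c x \<noteq> ?c p" "?c x \<noteq> ?c q" by (simp_all add: class_eq_iff)
      then show ?thesis using d2[OF False] x by (auto simp: quotient_def)
    qed
  next
    fix X assume "X \<in> insert (?c p \<union> ?c q) (D // conn L - {?c p, ?c q})"
    then consider "X = ?c p \<union> ?c q" | x where "x \<in> D" "X = ?c x" "?c x \<noteq> ?c p" "?c x \<noteq> ?c q"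
      by (auto simp: quotient_def)
    then show "X \<in> D // conn (insert (p, q) L)"
    proof cases
      case 1 then have "X = ?d p" using d1[of p] by simp
      then show ?thesis using assms(2) by (auto simp: quotient_def)
    next
      case 2
      then have "X = ?d x" using d2[of x] by (simp add: class_eq_iff)
      then show ?thesis using 2 by (auto simp: quotient_def)
    qed
  qed
  moreover have "?c p \<union> ?c q \<notin> D // conn L - {?c p, ?c q}"
  proof
    assume "?c p \<union> ?c q \<in> D // conn L - {?c p, ?c q}"
    then obtain x where "?c p \<union> ?c q = ?c x" "?c x \<noteq> ?c p" by (auto simp: quotient_def)
    then have "p \<in> ?c x" by blast
    then show False using \<open>?c x \<noteq> ?c p\<close> by (simp add: class_eq_iff)
  qed
  moreover have "?c p \<in> D // conn L" "?c q \<in> D // conn L" "?c p \<noteq> ?c q"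
    using assms by (auto simp: quotient_def class_eq_iff)
  moreover have fin: "finite (D // conn L)" using assms(1) by (simp add: quotient_def)
  moreover have "card (D // conn L) \<ge> card {?c p, ?c q}"
    using calculation by (intro card_mono) auto
  ultimately show ?thesis by (simp add: card_Diff_subset)
qed

definition links :: "'a set \<Rightarrow> ('a \<Rightarrow> 'a) \<Rightarrow> ('a \<times> 'a) set" where
  "links S f = (\<lambda>x. (x, f x)) ` S"

definition fpf_involution :: "'a set \<Rightarrow> ('a \<Rightarrow> 'a) \<Rightarrow> bool" where
  "fpf_involution D f \<longleftrightarrow> (\<forall>x\<in>D. f x \<in> D \<and> f x \<noteq> x \<and> f (f x) = x)"

text \<open>Initially every class is a pair \<open>{x, \<iota> x}\<close>, whose two elements
  are both free. Joining two free elements \<open>p\<close> and \<open>q\<close> removes both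
  from the set of free elements. If they belong to one class, this class becomes closed; if not,
  the other free elements of their two classes are the free elements of the union.
  Geometrically, the classes are closed loops and arcs with two ends.\<close>

lemma free_ends:
  assumes "finite D" "fpf_involution D \<iota>" "fpf_involution D \<tau>"
    and "S \<subseteq> D" "\<tau> ` S \<subseteq> S" "x \<in> D"
  shows "card (conn (links D \<iota> \<union> links S \<tau>) `` {x} \<inter> (D - S)) \<in> {0, 2}"
proof -
  have "finite S" using assms finite_subset by blast
  then show ?thesis using assms(4-6)
  proof (induction S arbitrary: x rule: finite_psubset_induct)
    case (psubset S)
    show ?case
    proof (cases "S = {}")
      case True
      have inv: "\<iota> (\<iota> y) = y" if "y \<in> D" for y
        using that assms(2) by (simp add: fpf_involution_def)
      have "(x, y) \<in> conn (links D \<iota>) \<Longrightarrow> y \<in> {x, \<iota> x}" for y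
      proof (induction rule: conn_induct)
        case (link y z)
        then show ?case using inv[OF psubset.prems(3)] by (auto simp: links_def)
      next
        case (link_rev y z)
        then have "z = \<iota> y" using inv[of z] by (auto simp: links_def)
        then show ?case using link_rev inv[OF psubset.prems(3)] by auto
      qed simp
      moreover have "(x, \<iota> x) \<in> conn (links D \<iota>)"
        using psubset.prems by (intro conn_link) (auto simp: links_def)
      ultimately have "conn (links D \<iota>) `` {x} = {x, \<iota> x}" by auto
      moreover have "x \<in> D" "\<iota> x \<in> D" "\<iota> x \<noteq> x"
        using psubset.prems assms(2) by (auto simp: fpf_involution_def)
      ultimately have "conn (links D \<iota> \<union> links S \<tau>) `` {x} \<inter> (D - S) = {x, \<iota> x}"
        using True by (auto simp: links_def)
      then show ?thesis using \<open>\<iota> x \<noteq> x\<close> by simp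
    next
      case False
      then obtain p where p: "p \<in> S" by blast
      define q where "q = \<tau> p"
      have q: "q \<in> S" "q \<noteq> p" "\<tau> q = p"
        using p psubset.prems assms(3) by (auto simp: q_def fpf_involution_def)
      define S' where "S' = S - {p, q}"
      have S': "S' \<subset> S" "S' \<subseteq> D" using p psubset.prems by (auto simp: S'_def)
      have cl: "\<tau> ` S' \<subseteq> S'"
      proof (rule image_subsetI)
        fix y assume y: "y \<in> S'"
        then have "\<tau> y \<in> S" "\<tau> (\<tau> y) = y"
          using psubset.prems assms(3) by (auto simp: S'_def fpf_involution_def)
        then show "\<tau> y \<in> S'" using y q q_def by (auto simp: S'_def)
      qed
      let ?L = "links D \<iota> \<union> links S' \<tau>"
      let ?T = "\<lambda>x. conn ?L `` {x} \<inter> (D - S')"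
      have IH: "card (?T y) \<in> {0, 2}" if "y \<in> D" for y
        by (rule psubset.IH[OF S'(1,2) cl that])
      have S: "S = insert p (insert q S')" using p q by (auto simp: S'_def)
      have "conn (links D \<iota> \<union> links S \<tau>) = conn (insert (p, q) ?L)"
      proof (rule conn_eqI)
        have "(p, q) \<in> conn (insert (p, q) ?L)" by (rule conn_link) simp
        then have "(q, p) \<in> conn (insert (p, q) ?L)" by (rule conn_sym)
        then show "links D \<iota> \<union> links S \<tau> \<subseteq> conn (insert (p, q) ?L)"
          using conn_link[of _ _ "insert (p, q) ?L"] S q q_def unfolding links_def by auto
        show "insert (p, q) ?L \<subseteq> conn (links D \<iota> \<union> links S \<tau>)"
          using S q_def conn_link[of _ _ "links D \<iota> \<union> links S \<tau>"] unfolding links_def by auto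
      qed
      note eq = this
      have DS: "D - S = D - S' - {p, q}" using S by auto
      have pq: "p \<in> D" "q \<in> D" "p \<notin> S'" "q \<notin> S'"
        using p q psubset.prems by (auto simp: S'_def)
      have fin: "finite (?T y)" for y using assms(1) by blast
      show ?thesis
      proof (cases "(p, q) \<in> conn ?L")
        case True
        have e: "conn (links D \<iota> \<union> links S \<tau>) `` {x} \<inter> (D - S) = ?T x - {p, q}"
          unfolding eq conn_insert_redundant[OF True] DS by blast
        show ?thesis
        proof (cases "(x, p) \<in> conn ?L")
          case xp: True
          then have "(x, q) \<in> conn ?L" using True by (rule conn_trans)
          then have sub: "{p, q} \<subseteq> ?T x" using xp pq by blast
          then have "card (?T x) = 2" using IH[OF psubset.prems(3)] fin by fastforce
          then have "card (?T x - {p, q}) = 0"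
            using sub q(2) by (simp add: card_Diff_subset)
          then show ?thesis using e by simp
        next
          case xp: False
          then have "(x, q) \<notin> conn ?L"
            using conn_cong[OF True, of x] conn_commute[of x p] conn_commute[of x q] by blast
          then have "?T x - {p, q} = ?T x" using xp by blast
          then show ?thesis using e IH[OF psubset.prems(3)] by simp
        qed
      next
        case False
        show ?thesis
        proof (cases "(x, p) \<in> conn ?L \<or> (x, q) \<in> conn ?L")
          case True
          have "conn (links D \<iota> \<union> links S \<tau>) `` {x} = conn ?L `` {p} \<union> conn ?L `` {q}"
            unfolding eq by (rule class_insert[OF True])
          then have e: "conn (links D \<iota> \<union> links S \<tau>) `` {x} \<inter> (D - S) = (?T p - {p}) \<union> (?T q - {q})"
            unfolding DS using False conn_commute[of q p ?L] by auto
          have "p \<in> ?T p" "q \<in> ?T q" using pq by auto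
          then have "card (?T p) = 2" "card (?T q) = 2"
            using IH[OF pq(1)] IH[OF pq(2)] fin by (auto simp: card_eq_0_iff)
          then have c: "card (?T p - {p}) = 1" "card (?T q - {q}) = 1"
            using \<open>p \<in> ?T p\<close> \<open>q \<in> ?T q\<close> by simp_all
          have "conn ?L `` {p} \<inter> conn ?L `` {q} = {}"
            using False conn_trans[of p _ ?L q] conn_commute[of q _ ?L] by blast
          then have "(?T p - {p}) \<inter> (?T q - {q}) = {}" by blast
          then have "card ((?T p - {p}) \<union> (?T q - {q})) = 2"
            using c fin by (subst card_Un_disjoint) auto
          then show ?thesis using e by simp
        next
          case xp: False
          have "conn (links D \<iota> \<union> links S \<tau>) `` {x} = conn ?L `` {x}"
            unfolding eq using xp conn_insert_iff[of _ _ p q ?L] by auto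
          then have "conn (links D \<iota> \<union> links S \<tau>) `` {x} \<inter> (D - S) = ?T x"
            unfolding DS using xp by auto
          then show ?thesis using IH[OF psubset.prems(3)] by simp
        qed
      qed
    qed
  qed
qed

lemma card_classes_insert2:
  assumes "finite D" "{p, q, r, s} \<subseteq> D"
  shows "(p, q) \<in> conn L \<Longrightarrow> (r, s) \<in> conn L \<Longrightarrow>
      card (D // conn (insert (p, q) (insert (r, s) L))) = card (D // conn L)"
    and "(p, r) \<in> conn L \<and> (q, s) \<in> conn L \<or> (p, s) \<in> conn L \<and> (q, r) \<in> conn L \<Longrightarrow>
      (p, q) \<notin> conn L \<Longrightarrow>
      card (D // conn L) = card (D // conn (insert (p, q) (insert (r, s) L))) + 1"
proof -
  show "card (D // conn (insert (p, q) (insert (r, s) L))) = card (D // conn L)"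
    if "(p, q) \<in> conn L" "(r, s) \<in> conn L"
    using that by (metis conn_insert_redundant)
  assume h: "(p, r) \<in> conn L \<and> (q, s) \<in> conn L \<or> (p, s) \<in> conn L \<and> (q, r) \<in> conn L"
    "(p, q) \<notin> conn L"
  have rs: "(r, s) \<notin> conn L"
  proof
    assume "(r, s) \<in> conn L"
    then have "(p, r) \<in> conn L \<longleftrightarrow> (p, s) \<in> conn L" "(q, r) \<in> conn L \<longleftrightarrow> (q, s) \<in> conn L"
      using conn_cong[of r s L] conn_commute[of _ r L] conn_commute[of _ s L] by blast+
    then show False using h conn_cong[of p r L q] conn_commute[of q r L] by blast
  qed
  have "(p, q) \<in> conn (insert (r, s) L)"
    unfolding conn_insert_iff using h by blast
  then have "conn (insert (p, q) (insert (r, s) L)) = conn (insert (r, s) L)"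
    by (rule conn_insert_redundant)
  then show "card (D // conn L) = card (D // conn (insert (p, q) (insert (r, s) L))) + 1"
    using card_classes_insert[OF assms(1) _ _ rs] assms(2) by simp
qed

text \<open>Four free ends left over from a configuration of loops and arcs are the end points
  of two arcs, so they are paired in one of three ways.\<close>

lemma four_ends_paired:
  assumes "finite D" "fpf_involution D \<iota>" "fpf_involution D \<tau>"
    and "{p, q, r, s} \<subseteq> D" "distinct [p, q, r, s]" "\<tau> ` (D - {p, q, r, s}) \<subseteq> D - {p, q, r, s}"
  defines "R \<equiv> conn (links D \<iota> \<union> links (D - {p, q, r, s}) \<tau>)"
  shows "((p, q) \<in> R \<and> (r, s) \<in> R \<and> (p, r) \<notin> R \<and> (p, s) \<notin> R) \<or>
    ((p, r) \<in> R \<and> (q, s) \<in> R \<and> (p, q) \<notin> R \<and> (p, s) \<notin> R) \<or>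
    ((p, s) \<in> R \<and> (q, r) \<in> R \<and> (p, q) \<notin> R \<and> (p, r) \<notin> R)"
proof -
  have two: "card (R `` {x} \<inter> {p, q, r, s}) = 2" if "x \<in> {p, q, r, s}" for x
  proof -
    have "D - (D - {p, q, r, s}) = {p, q, r, s}" using assms(4) by blast
    then have "card (R `` {x} \<inter> {p, q, r, s}) \<in> {0, 2}"
      using free_ends[OF assms(1-3) _ assms(6), of x] that assms(4) unfolding R_def by auto
    moreover have "x \<in> R `` {x} \<inter> {p, q, r, s}" using that unfolding R_def by blast
    then have "card (R `` {x} \<inter> {p, q, r, s}) \<noteq> 0" by (auto simp: card_eq_0_iff)
    ultimately show ?thesis by blast
  qed
  have partner: "\<exists>y. y \<noteq> x \<and> (x, y) \<in> R \<and> y \<in> {p, q, r, s} \<and>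
      (\<forall>z\<in>{p, q, r, s}. (x, z) \<in> R \<longrightarrow> z = x \<or> z = y)" if x: "x \<in> {p, q, r, s}" for x
  proof -
    obtain u v where uv: "R `` {x} \<inter> {p, q, r, s} = {u, v}" "u \<noteq> v"
      using two[OF x] by (auto simp: card_2_iff)
    have "x \<in> {u, v}" unfolding uv(1)[symmetric] using x unfolding R_def by blast
    then obtain y where y: "{u, v} = {x, y}" "y \<noteq> x" using uv(2) by blast
    show ?thesis using uv(1) y unfolding y(1) by blast
  qed
  have sym: "(x, y) \<in> R \<Longrightarrow> (y, x) \<in> R" for x y unfolding R_def by (rule conn_sym)
  from partner[of p] obtain y where y: "y \<noteq> p" "(p, y) \<in> R" "y \<in> {p, q, r, s}"
    "\<forall>z\<in>{p, q, r, s}. (p, z) \<in> R \<longrightarrow> z = p \<or> z = y" by blast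
  show ?thesis
    using y partner[of q] partner[of r] partner[of s] sym assms(5) by simp metis
qed

text \<open>There are three ways to glue four ends in pairs. The one that agrees with the
  pairing of the ends by arcs closes two loops, and the other two ways close a single loop
  through both arcs. Here \<open>pq, rs\<close> is the gluing without a mark, \<open>ps,
  rq\<close> the gluing by a cross and \<open>pr, qs\<close> the gluing by a bar.\<close>

lemma resolve_crossing:
  assumes "finite D" "fpf_involution D \<iota>" "fpf_involution D \<tau>"
    and "{p, q, r, s} \<subseteq> D" "distinct [p, q, r, s]" "\<tau> ` (D - {p, q, r, s}) \<subseteq> D - {p, q, r, s}"
  defines "L \<equiv> links D \<iota> \<union> links (D - {p, q, r, s}) \<tau>"
  defines "n0 \<equiv> card (D // conn (insert (p, q) (insert (r, s) L)))"
  defines "n1 \<equiv> card (D // conn (insert (p, s) (insert (r, q) L)))"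
  defines "n2 \<equiv> card (D // conn (insert (p, r) (insert (q, s) L)))"
  shows "(p, r) \<notin> conn (insert (p, q) (insert (r, s) L)) \<Longrightarrow> n0 = n1 + 1 \<and> n0 = n2 + 1"
    and "(p, r) \<in> conn (insert (p, q) (insert (r, s) L)) \<Longrightarrow>
      (n1 = n0 + 1 \<and> n2 = n0) \<or> (n1 = n0 \<and> n2 = n0 + 1)"
proof -
  note ends = four_ends_paired[OF assms(1-6), folded L_def]
  note c = card_classes_insert2[OF assms(1), of _ _ _ _ L]
  have D: "p \<in> D" "q \<in> D" "r \<in> D" "s \<in> D" using assms(4) by auto
  have joined: "(p, r) \<in> conn (insert (p, q) (insert (r, s) L))" if "(p, q) \<notin> conn L"
  proof -
    have "(p, r) \<in> conn L \<or> (p, s) \<in> conn L" using ends that by blast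
    then have "(p, r) \<in> conn (insert (r, s) L)" by (auto simp: conn_insert_iff)
    then show ?thesis by (subst conn_insert_iff) blast
  qed
  have sep: "(p, r) \<notin> conn (insert (p, q) (insert (r, s) L))" if "(p, q) \<in> conn L"
  proof -
    have h: "(r, s) \<in> conn L" "(p, r) \<notin> conn L" using ends that by blast+
    have "conn (insert (p, q) (insert (r, s) L)) = conn L"
      using that h by (metis conn_insert_redundant)
    then show ?thesis using h by simp
  qed
  {
    assume "(p, r) \<notin> conn (insert (p, q) (insert (r, s) L))"
    then have *: "(p, q) \<in> conn L" "(r, s) \<in> conn L" "(p, r) \<notin> conn L" "(p, s) \<notin> conn L"
      using joined ends by blast+
    have sr: "(s, r) \<in> conn L" using *(2) by (rule conn_sym)
    have "n0 = card (D // conn L)" unfolding n0_def by (rule c(1)) (use * D in auto)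
    moreover have "card (D // conn L) = n1 + 1"
      unfolding n1_def by (rule c(2)) (use * sr D in auto)
    moreover have "card (D // conn L) = n2 + 1"
      unfolding n2_def by (rule c(2)) (use * D in auto)
    ultimately show "n0 = n1 + 1 \<and> n0 = n2 + 1" by simp
  }
  {
    assume "(p, r) \<in> conn (insert (p, q) (insert (r, s) L))"
    then have "(p, q) \<notin> conn L" using sep by blast
    then consider "(p, r) \<in> conn L" "(q, s) \<in> conn L" "(p, q) \<notin> conn L" "(p, s) \<notin> conn L"
      | "(p, s) \<in> conn L" "(q, r) \<in> conn L" "(p, q) \<notin> conn L" "(p, r) \<notin> conn L"
      using ends by blast
    then show "(n1 = n0 + 1 \<and> n2 = n0) \<or> (n1 = n0 \<and> n2 = n0 + 1)"
    proof cases
      case 1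
      have sq: "(s, q) \<in> conn L" using 1(2) by (rule conn_sym)
      have "card (D // conn L) = n0 + 1"
        unfolding n0_def by (rule c(2)) (use 1 D in auto)
      moreover have "card (D // conn L) = n1 + 1"
        unfolding n1_def by (rule c(2)) (use 1 sq D in auto)
      moreover have "n2 = card (D // conn L)"
        unfolding n2_def by (rule c(1)) (use 1 D in auto)
      ultimately show ?thesis by simp
    next
      case 2
      have rq: "(r, q) \<in> conn L" using 2(2) by (rule conn_sym)
      have "card (D // conn L) = n0 + 1"
        unfolding n0_def by (rule c(2)) (use 2 D in auto)
      moreover have "card (D // conn L) = n2 + 1"
        unfolding n2_def by (rule c(2)) (use 2 rq D in auto)
      moreover have "n1 = card (D // conn L)"
        unfolding n1_def by (rule c(1)) (use 2 rq D in auto)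
      ultimately show ?thesis by simp
    qed
  }
qed

text \<open>A class that avoids \<open>B\<close> is not affected by a change of links inside
  \<open>B\<close>. The remaining classes each contain an element of \<open>J\<close>.\<close>

lemma card_classes_local_change:
  assumes "finite D" "L1 \<subseteq> D \<times> D" "L1 - B \<times> B = L2 - B \<times> B"
    and "finite J" "\<And>x. x \<in> B \<Longrightarrow> \<exists>j\<in>J. (j, x) \<in> conn L1"
  shows "card (D // conn L1) \<le> card (D // conn L2) + card J"
proof -
  have "D // conn L1 \<subseteq> D // conn L2 \<union> (\<lambda>j. conn L1 `` {j}) ` J"
  proof
    fix X assume "X \<in> D // conn L1"
    then obtain x where x: "x \<in> D" "X = conn L1 `` {x}" by (auto simp: quotient_def)
    show "X \<in> D // conn L2 \<union> (\<lambda>j. conn L1 `` {j}) ` J"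
    proof (cases "X \<inter> B = {}")
      case False
      then obtain y j where "(x, y) \<in> conn L1" "j \<in> J" "(j, y) \<in> conn L1"
        using assms(5) x by blast
      then have "conn L1 `` {x} = conn L1 `` {j}"
        unfolding class_eq_iff by (metis conn_sym conn_trans)
      then show ?thesis using x \<open>j \<in> J\<close> by blast
    next
      case True
      then have notB: "y \<notin> B" if "(x, y) \<in> conn L1" for y using that x by blast
      have "(x, y) \<in> conn L2" if "(x, y) \<in> conn L1" for y
        using that
      proof (induction rule: conn_induct)
        case (link y z)
        then have "(y, z) \<in> L2" using notB[of y] assms(3) by blast
        then show ?case using link conn_link conn_trans by metis
      next
        case (link_rev y z)
        then have "(z, y) \<in> L2" using notB[of y] assms(3) by blast
        then show ?case using link_rev conn_link conn_trans conn_sym by metis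
      qed simp
      moreover have "(x, y) \<in> conn L1" if "(x, y) \<in> conn L2" for y
        using that
      proof (induction rule: conn_induct)
        case (link y z)
        then have "(y, z) \<in> L1" using notB[of y] assms(3) by blast
        then show ?case using link conn_link conn_trans by metis
      next
        case (link_rev y z)
        then have "(z, y) \<in> L1" using notB[of y] assms(3) by blast
        then show ?case using link_rev conn_link conn_trans conn_sym by metis
      qed simp
      ultimately have "X = conn L2 `` {x}" using x by auto
      then show ?thesis using x by (auto simp: quotient_def)
    qed
  qed
  moreover have "finite (D // conn L2)" using assms(1) by (simp add: quotient_def)
  ultimately have "card (D // conn L1) \<le> card (D // conn L2 \<union> (\<lambda>j. conn L1 `` {j}) ` J)"
    using assms(4) by (intro card_mono) auto
  also have "\<dots> \<le> card (D // conn L2) + card ((\<lambda>j. conn L1 `` {j}) ` J)" by (rule card_Un_le)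
  also have "\<dots> \<le> card (D // conn L2) + card J" using card_image_le[OF assms(4)] by simp
  finally show ?thesis .
qed

section \<open>Loops of a configuration on a time grid\<close>

definition hits :: "(int \<Rightarrow> ('v set \<times> mark) option) \<Rightarrow> int \<Rightarrow> 'v \<Rightarrow> bool" where
  "hits a b x \<longleftrightarrow> (\<exists>e m. a b = Some (e, m) \<and> x \<in> e)"

text \<open>Position \<open>b\<close> stands for the time \<open>b / K\<close>; each of the
  \<open>K\<close> positions carries at most one mark. Empty positions are useful for adding a
  mark without moving the others.\<close>

definition grid_config :: "int \<Rightarrow> (int \<Rightarrow> ('v set \<times> mark) option) \<Rightarrow> 'v config" where
  "grid_config K a e = {(of_int b / of_int K, m) | b m. 0 \<le> b \<and> b < K \<and> a b = Some (e, m)}"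

text \<open>The positions cut the circle above each vertex into \<open>K\<close> gaps.
  \<open>(x, b, d)\<close> is the end at position \<open>b\<close> of the gap above
  \<open>x\<close> that a particle leaves at \<open>b\<close> when it moves in direction
  \<open>d\<close>; it also encodes this gap together with the direction in which it is
  traversed. \<open>other_end\<close> goes to the second end of the same gap, and
  \<open>glue\<close> to the end onto which the particle continues.\<close>

definition half_edges :: "'v set \<Rightarrow> int \<Rightarrow> ('v \<times> int \<times> int) set" where
  "half_edges V K = V \<times> {0..<K} \<times> {1, -1}"

fun other_end :: "int \<Rightarrow> 'v \<times> int \<times> int \<Rightarrow> 'v \<times> int \<times> int" where
  "other_end K (x, b, d) = (x, (b - d) mod K, - d)"

definition neighbour :: "'v set \<Rightarrow> 'v \<Rightarrow> 'v" where
  "neighbour e x = (THE y. y \<in> e \<and> y \<noteq> x)"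

fun glue :: "(int \<Rightarrow> ('v set \<times> mark) option) \<Rightarrow> 'v \<times> int \<times> int \<Rightarrow> 'v \<times> int \<times> int" where
  "glue a (x, b, d) = (case a b of None \<Rightarrow> (x, b, - d)
     | Some (e, m) \<Rightarrow> if x \<in> e
         then (neighbour e x, b, case m of Cross \<Rightarrow> - d | Bar \<Rightarrow> d)
         else (x, b, - d))"

text \<open>The particle leaves its gap at the end \<open>h\<close>, enters the next gap at
  \<open>glue a h\<close> and will leave that one at its other end.\<close>

definition advance :: "int \<Rightarrow> (int \<Rightarrow> ('v set \<times> mark) option) \<Rightarrow> 'v \<times> int \<times> int \<Rightarrow> 'v \<times> int \<times> int" where
  "advance K a h = other_end K (glue a h)"

text \<open>The closed gap, as a set of points of the circle above \<open>x\<close>; the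
  parameter \<open>r\<close> is the scaled distance to the end \<open>b\<close>.\<close>

definition gap :: "int \<Rightarrow> 'v \<times> int \<times> int \<Rightarrow> ('v \<times> real) set" where
  "gap K h = (case h of (x, b, d) \<Rightarrow>
     {(x, frac ((of_int b - of_int d * r) / of_int K)) | r. 0 \<le> r \<and> r \<le> 1})"

text \<open>Forgetting the direction of motion, a loop is a class of half-edges linked by the
  gaps and by the gluing at the positions.\<close>

definition loop_conn :: "'v set \<Rightarrow> int \<Rightarrow> (int \<Rightarrow> ('v set \<times> mark) option) \<Rightarrow>
    (('v \<times> int \<times> int) \<times> ('v \<times> int \<times> int)) set" where
  "loop_conn V K a = conn (links (half_edges V K) (other_end K) \<union> links (half_edges V K) (glue a))"

lemma no_int_between: "\<not> (0 < real_of_int n \<and> real_of_int n < 1)"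
  by simp

lemma int_eq_0I: "0 \<le> real_of_int n \<Longrightarrow> real_of_int n < 1 \<Longrightarrow> n = 0"
  by linarith

lemma int_abs_lt_1I: "- 1 < real_of_int n \<Longrightarrow> real_of_int n < 1 \<Longrightarrow> n = 0"
  by linarith

lemma int_eq_1I: "0 < real_of_int n \<Longrightarrow> real_of_int n < 2 \<Longrightarrow> n = 1"
  by linarith

lemma gapI:
  "0 \<le> r \<Longrightarrow> r \<le> 1 \<Longrightarrow> p = (x, frac ((of_int b - of_int d * r) / of_int K)) \<Longrightarrow>
    p \<in> gap K (x, b, d)"
  by (auto simp: gap_def)

lemma frac_add_of_int [simp]: "frac (x + of_int n) = frac (x::real)"
  by (simp add: frac_def)

lemma frac_frac_add: "frac (frac x + y) = frac (x + y :: real)"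
proof -
  have "x + y = (frac x + y) + of_int \<lfloor>x\<rfloor>" by (simp add: frac_def)
  then show ?thesis by (metis frac_add_of_int)
qed

lemma frac_eqD: "frac x = frac y \<Longrightarrow> \<exists>n::int. x = y + of_int n" for x y :: real
  by (rule exI[of _ "\<lfloor>x\<rfloor> - \<lfloor>y\<rfloor>"]) (simp add: frac_def)

lemma neighbour_eq: "e = {x, y} \<Longrightarrow> x \<noteq> y \<Longrightarrow> neighbour e x = y"
  unfolding neighbour_def by (rule the_equality) auto

lemma simple_edgeE:
  assumes "e \<in> simple_edges V" "x \<in> e"
  obtains y where "e = {x, y}" "x \<noteq> y" "x \<in> V" "y \<in> V" "neighbour e x = y" "neighbour e y = x"
proof -
  obtain u v where uv: "e = {u, v}" "u \<noteq> v" "e \<subseteq> V"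
    using assms(1) by (auto simp: simple_edges_def card_2_iff)
  then have "\<exists>y. e = {x, y} \<and> x \<noteq> y" using assms(2) by auto
  then obtain y where y: "e = {x, y}" "x \<noteq> y" by blast
  show ?thesis
  proof (rule that[OF y])
    show "neighbour e x = y" by (rule neighbour_eq[OF y])
    show "neighbour e y = x" by (rule neighbour_eq) (use y in auto)
  qed (use y uv in auto)
qed

locale loop_grid =
  fixes V :: "'v set" and K :: int and a :: "int \<Rightarrow> ('v set \<times> mark) option"
  assumes finite_V: "finite V" and K_pos: "K > 0"
    and letters: "\<And>b e m. a b = Some (e, m) \<Longrightarrow> e \<in> simple_edges V"
begin

abbreviation "D \<equiv> half_edges V K"
abbreviation "\<omega> \<equiv> grid_config K a"

lemma finite_D: "finite D"
  using finite_V by (simp add: half_edges_def)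

lemma other_end_involution: "fpf_involution D (other_end K)"
  unfolding fpf_involution_def half_edges_def
  using K_pos by (auto simp: mod_simps)

lemma glue_involution: "fpf_involution D (glue a)"
  unfolding fpf_involution_def
proof
  fix h assume "h \<in> D"
  then obtain x b d where h: "h = (x, b, d)" "x \<in> V" "b \<in> {0..<K}" "d \<in> {1, -1}"
    by (auto simp: half_edges_def)
  show "glue a h \<in> D \<and> glue a h \<noteq> h \<and> glue a (glue a h) = h"
  proof (cases "hits a b x")
    case False
    then have "glue a (x, b, d') = (x, b, - d')" for d'
      by (auto simp: hits_def split: option.split)
    then show ?thesis using h by (auto simp: half_edges_def)
  next
    case True
    then obtain e m where e: "a b = Some (e, m)" "x \<in> e" by (auto simp: hits_def)
    obtain y where y: "e = {x, y}" "x \<noteq> y" "y \<in> V" "neighbour e x = y" "neighbour e y = x"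
      using simple_edgeE[OF letters[OF e(1)] e(2)] by metis
    show ?thesis using h e y by (cases m) (auto simp: half_edges_def)
  qed
qed

lemma advance_in_D: "h \<in> D \<Longrightarrow> advance K a h \<in> D"
  using other_end_involution glue_involution by (simp add: advance_def fpf_involution_def)

lemma advance_pow_in_D: "h \<in> D \<Longrightarrow> (advance K a ^^ i) h \<in> D"
  by (induction i) (auto simp: advance_in_D)

lemma advance_inverse: "h \<in> D \<Longrightarrow> glue a (other_end K (advance K a h)) = h"
  using other_end_involution glue_involution by (simp add: advance_def fpf_involution_def)

text \<open>A motion in a finite set that can be undone is periodic.\<close>

lemma advance_periodic:
  assumes "h \<in> D"
  obtains p where "p > 0" "(advance K a ^^ p) h = h"
proof -
  have "\<not> inj (\<lambda>i. (advance K a ^^ i) h)"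
  proof
    assume "inj (\<lambda>i. (advance K a ^^ i) h)"
    moreover have "range (\<lambda>i. (advance K a ^^ i) h) \<subseteq> D" using advance_pow_in_D[OF assms] by blast
    ultimately have "finite (UNIV :: nat set)"
      using finite_D finite_imageD finite_subset by metis
    then show False by simp
  qed
  then obtain i j where "i \<noteq> j" "(advance K a ^^ i) h = (advance K a ^^ j) h" by (auto simp: inj_def)
  then have "\<exists>i j. i < j \<and> (advance K a ^^ i) h = (advance K a ^^ j) h"
    by (metis linorder_neqE_nat)
  then obtain i j where ij: "i < j" "(advance K a ^^ i) h = (advance K a ^^ j) h" by blast
  have "(advance K a ^^ n) h = (advance K a ^^ (n + k)) h \<Longrightarrow> h = (advance K a ^^ k) h" for n k
  proof (induction n)
    case (Suc n)
    then have "glue a (other_end K (advance K a ((advance K a ^^ n) h))) =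
        glue a (other_end K (advance K a ((advance K a ^^ (n + k)) h)))" by simp
    then have "(advance K a ^^ n) h = (advance K a ^^ (n + k)) h"
      unfolding advance_inverse[OF advance_pow_in_D[OF assms]] .
    then show ?case by (rule Suc.IH)
  qed simp
  from this[of i "j - i"] ij show ?thesis by (intro that[of "j - i"]) auto
qed

text \<open>By periodicity the orbit of \<open>advance\<close>, together with its reversal under
  \<open>other_end\<close>, is invariant under both kinds of links. So the directed motion
  visits the whole undirected class.\<close>

lemma class_orbit:
  assumes "h \<in> D"
  shows "loop_conn V K a `` {h} =
    range (\<lambda>i. (advance K a ^^ i) h) \<union> other_end K ` range (\<lambda>i. (advance K a ^^ i) h)"
    (is "?C = ?O \<union> ?O'")
proof
  have inv: "g \<in> D \<Longrightarrow> other_end K (other_end K g) = g" "g \<in> D \<Longrightarrow> glue a (glue a g) = g" for g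
    using other_end_involution glue_involution by (auto simp: fpf_involution_def)
  have O_D: "?O \<subseteq> D" "?O' \<subseteq> D"
    using advance_pow_in_D[OF assms] other_end_involution by (auto simp: fpf_involution_def)
  have cl1: "other_end K g \<in> ?O \<union> ?O'" if "g \<in> ?O \<union> ?O'" for g
    using that
  proof
    assume "g \<in> ?O'"
    then obtain g' where "g' \<in> ?O" "g = other_end K g'" by blast
    then show ?thesis using inv(1)[of g'] O_D(1) by auto
  qed blast
  have cl2: "glue a g \<in> ?O \<union> ?O'" if "g \<in> ?O \<union> ?O'" for g
    using that
  proof
    assume "g \<in> ?O"
    then obtain i where g: "g = (advance K a ^^ i) h" by blast
    have "glue a g \<in> D"
      using g advance_pow_in_D[OF assms] glue_involution by (auto simp: fpf_involution_def)
    then have "glue a g = other_end K (advance K a g)" using inv(1) by (simp add: advance_def)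
    also have "advance K a g = (advance K a ^^ Suc i) h" using g by simp
    finally show ?thesis by blast
  next
    assume "g \<in> ?O'"
    then obtain i where g: "g = other_end K ((advance K a ^^ i) h)" by blast
    obtain p where p: "p > 0" "(advance K a ^^ p) h = h" by (rule advance_periodic[OF assms])
    obtain p' where p': "p = Suc p'" using p by (cases p) auto
    have "(advance K a ^^ i) h = (advance K a ^^ (i + p)) h"
      unfolding funpow_add using p by simp
    then have "g = other_end K (advance K a ((advance K a ^^ (i + p')) h))" using g p' by simp
    then have "glue a g = (advance K a ^^ (i + p')) h"
      using advance_inverse advance_pow_in_D[OF assms] by simp
    then show ?thesis by blast
  qed
  show "?C \<subseteq> ?O \<union> ?O'"
  proof
    fix g assume "g \<in> ?C"
    then have "(h, g) \<in> conn (links D (other_end K) \<union> links D (glue a))"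
      by (simp add: loop_conn_def)
    then show "g \<in> ?O \<union> ?O'"
    proof (induction rule: conn_induct)
      case refl
      have "h = (advance K a ^^ 0) h" by simp
      then show ?case by blast
    next
      case (link y z)
      have "z = other_end K y \<or> z = glue a y" using link.hyps(2) unfolding links_def by blast
      then show ?case using cl1[OF link.IH] cl2[OF link.IH] by metis
    next
      case (link_rev y z)
      have "z \<in> D \<and> (y = other_end K z \<or> y = glue a z)" using link_rev.hyps(2) unfolding links_def by blast
      then have "z = other_end K y \<or> z = glue a y" using inv[of z] by metis
      then show ?case using cl1[OF link_rev.IH] cl2[OF link_rev.IH] by metis
    qed
  qed
  have l: "(g, other_end K g) \<in> loop_conn V K a" "(g, glue a g) \<in> loop_conn V K a" if "g \<in> D" for g
    using that unfolding loop_conn_def by (auto intro!: conn_link simp: links_def)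
  have o: "(h, (advance K a ^^ i) h) \<in> loop_conn V K a" for i
  proof (induction i)
    case 0 show ?case by (simp add: loop_conn_def)
  next
    case (Suc i)
    let ?g = "(advance K a ^^ i) h"
    have "?g \<in> D" "glue a ?g \<in> D"
      using advance_pow_in_D[OF assms] glue_involution by (auto simp: fpf_involution_def)
    from l(2)[OF this(1)] l(1)[OF this(2)] have "(?g, advance K a ?g) \<in> loop_conn V K a"
      unfolding advance_def loop_conn_def by (rule conn_trans)
    with Suc show ?case by (simp add: loop_conn_def) (erule (1) conn_trans)
  qed
  show "?O \<union> ?O' \<subseteq> ?C"
  proof
    fix g assume "g \<in> ?O \<union> ?O'"
    then show "g \<in> ?C"
    proof
      assume "g \<in> ?O"
      then show ?thesis using o by auto
    next
      assume "g \<in> ?O'"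
      then obtain i where g: "g = other_end K ((advance K a ^^ i) h)" by blast
      have "(h, g) \<in> loop_conn V K a"
        using o[of i] l(1)[OF advance_pow_in_D[OF assms, of i]]
        unfolding loop_conn_def g by (rule conn_trans)
      then show ?thesis by simp
    qed
  qed
qed

lemma class_subset_D: "h \<in> D \<Longrightarrow> loop_conn V K a `` {h} \<subseteq> D"
  using advance_pow_in_D[of h] other_end_involution
  unfolding class_orbit by (auto simp: fpf_involution_def)

lemma gap_other_end: "h \<in> D \<Longrightarrow> gap K (other_end K h) = gap K h"
proof -
  assume "h \<in> D"
  then obtain x b d where h: "h = (x, b, d)" by (cases h) auto
  have K: "real_of_int K \<noteq> 0" using K_pos by simp
  have *: "frac ((of_int ((b - d) mod K) - of_int (- d) * r) / of_int K)
      = frac ((of_int b - of_int d * (1 - r)) / of_int K)" for r :: real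
  proof -
    have "real_of_int (b - d) = of_int ((b - d) mod K) + of_int K * of_int ((b - d) div K)"
      by (metis mod_mult_div_eq of_int_add of_int_mult)
    then have "(of_int b - of_int d * (1 - r)) / of_int K
        = (of_int ((b - d) mod K) - of_int (- d) * r) / of_int K + of_int ((b - d) div K)"
      using K by (simp add: field_simps)
    then show ?thesis by simp
  qed
  show ?thesis
  proof (intro equalityI subsetI)
    fix p assume "p \<in> gap K (other_end K h)"
    then obtain r where r: "0 \<le> r" "r \<le> 1"
      "p = (x, frac ((of_int ((b - d) mod K) - of_int (- d) * r) / of_int K))"
      by (auto simp: gap_def h)
    then have "p = (x, frac ((of_int b - of_int d * (1 - r)) / of_int K))" unfolding * by simp
    then show "p \<in> gap K h" using r unfolding gap_def h by (auto intro!: exI[of _ "1 - r"])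
  next
    fix p assume "p \<in> gap K h"
    then obtain r where r: "0 \<le> r" "r \<le> 1"
      "p = (x, frac ((of_int b - of_int d * r) / of_int K))"
      by (auto simp: gap_def h)
    then have "p = (x, frac ((of_int ((b - d) mod K) - of_int (- d) * (1 - r)) / of_int K))"
      unfolding * by simp
    then show "p \<in> gap K (other_end K h)"
      unfolding h other_end.simps using r by (intro gapI[of "1 - r"]) simp_all
  qed
qed

lemma frac_of_int_div: "frac (of_int b / of_int K :: real) = of_int (b mod K) / of_int K"
proof -
  have "real_of_int b = of_int (b mod K) + of_int K * of_int (b div K)"
    by (metis mod_mult_div_eq of_int_add of_int_mult)
  then have "of_int b / of_int K = of_int (b mod K) / of_int K + real_of_int (b div K)"
    using K_pos by (simp add: field_simps)
  then have "frac (of_int b / of_int K :: real) = frac (of_int (b mod K) / of_int K)" by simp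
  also have "\<dots> = of_int (b mod K) / of_int K"
    using K_pos by (simp add: frac_eq)
  finally show ?thesis .
qed

lemma mark_on_grid:
  "(frac (q / of_int K), m) \<in> \<omega> e \<longleftrightarrow> (\<exists>c. q = of_int c \<and> a (c mod K) = Some (e, m))"
proof
  assume "(frac (q / of_int K), m) \<in> \<omega> e"
  then obtain b where b: "frac (q / of_int K) = of_int b / of_int K" "0 \<le> b" "b < K" "a b = Some (e, m)"
    by (auto simp: grid_config_def)
  then have "frac (q / of_int K) = frac (of_int b / of_int K)" by (simp add: frac_of_int_div)
  then obtain n where "q / of_int K = of_int b / of_int K + of_int n" using frac_eqD by blast
  then have "q = of_int (b + n * K)" using K_pos by (simp add: field_simps)
  then show "\<exists>c. q = of_int c \<and> a (c mod K) = Some (e, m)"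
    using b by (intro exI[of _ "b + n * K"]) simp
next
  assume "\<exists>c. q = of_int c \<and> a (c mod K) = Some (e, m)"
  then obtain c where c: "q = of_int c" "a (c mod K) = Some (e, m)" by blast
  then show "(frac (q / of_int K), m) \<in> \<omega> e"
    using K_pos unfolding grid_config_def c(1) frac_of_int_div by force
qed

lemma marked_on_grid:
  "marked \<omega> x (frac (q / of_int K)) \<longleftrightarrow> (\<exists>c. q = of_int c \<and> hits a (c mod K) x)"
  unfolding marked_def mark_on_grid hits_def by blast

lemma advance_straight:
  assumes "\<not> hits a (b mod K) x"
  shows "advance K a (x, b mod K, d) = (x, (b + d) mod K, d)"
proof -
  have "glue a (x, b mod K, d) = (x, b mod K, - d)"
    using assms by (auto simp: hits_def split: option.split)
  then show ?thesis by (simp add: advance_def mod_simps)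
qed

lemma advance_straight_pow:
  assumes "\<And>j. j < i \<Longrightarrow> \<not> hits a ((b + d * int j) mod K) x"
  shows "(advance K a ^^ i) (x, b mod K, d) = (x, (b + d * int i) mod K, d)"
  using assms
proof (induction i)
  case (Suc i)
  have "(advance K a ^^ i) (x, b mod K, d) = (x, (b + d * int i) mod K, d)"
    by (rule Suc.IH) (rule Suc.prems, simp)
  then show ?case using advance_straight[of "b + d * int i" x d] Suc.prems[of i]
    by (simp add: algebra_simps)
qed simp

lemma advance_jump:
  fixes b d :: int
  assumes "a (b mod K) = Some ({x, y}, m)" "x \<noteq> y"
  defines "c \<equiv> case m of Cross \<Rightarrow> d | Bar \<Rightarrow> - d"
  shows "advance K a (x, b mod K, d) = (y, (b + c) mod K, c)"
  using assms neighbour_eq[OF refl assms(2)]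
  by (cases m) (auto simp: advance_def mod_simps)

lemma unobstructed_grid:
  "unobstructed \<omega> x (frac (\<sigma> / of_int K)) d (r / of_int K) \<longleftrightarrow>
    (\<forall>q c. 0 < q \<and> q < r \<and> \<sigma> + d * q = of_int c \<longrightarrow> \<not> hits a (c mod K) x)"
proof -
  have K: "real_of_int K > 0" using K_pos by simp
  have *: "frac (frac (\<sigma> / of_int K) + d * q) = frac ((\<sigma> + d * (q * of_int K)) / of_int K)" for q
    unfolding frac_frac_add using K by (simp add: field_simps)
  show ?thesis
  proof
    assume L: "unobstructed \<omega> x (frac (\<sigma> / of_int K)) d (r / of_int K)"
    show "\<forall>q c. 0 < q \<and> q < r \<and> \<sigma> + d * q = of_int c \<longrightarrow> \<not> hits a (c mod K) x"
    proof (intro allI impI)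
      fix q c assume h: "0 < q \<and> q < r \<and> \<sigma> + d * q = of_int c"
      then have "q / of_int K \<in> {0<..<r / of_int K}" using K by (simp add: divide_strict_right_mono)
      then have "\<not> marked \<omega> x (frac ((\<sigma> + d * (q / of_int K * of_int K)) / of_int K))"
        using L unfolding unobstructed_def * by blast
      then have "\<not> marked \<omega> x (frac ((\<sigma> + d * q) / of_int K))" using K by simp
      then show "\<not> hits a (c mod K) x" using h unfolding marked_on_grid by blast
    qed
  next
    assume R: "\<forall>q c. 0 < q \<and> q < r \<and> \<sigma> + d * q = of_int c \<longrightarrow> \<not> hits a (c mod K) x"
    show "unobstructed \<omega> x (frac (\<sigma> / of_int K)) d (r / of_int K)"
      unfolding unobstructed_def *
    proof
      fix q assume "q \<in> {0<..<r / of_int K}"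
      then have "0 < q * of_int K" "q * of_int K < r" using K by (simp_all add: pos_less_divide_eq)
      then show "\<not> marked \<omega> x (frac ((\<sigma> + d * (q * of_int K)) / of_int K))"
        using R unfolding marked_on_grid by blast
    qed
  qed
qed

text \<open>A particle that meets no mark on a vertical segment of scaled length
  \<open>r\<close> passes through consecutive gaps above \<open>x\<close>. Its first gap ends at
  the position \<open>b\<close>, at distance \<open>d * (b - \<sigma>)\<close> in \<open>(0,
  1]\<close>, and \<open>i\<close> is the number of positions passed. Times are scaled by
  \<open>K\<close> from here on, and \<open>\<sigma>\<close> is a lift to the line, so that
  positions are the integers.\<close>

lemma path_in_orbit:
  fixes \<sigma> r :: real and b d :: int
  assumes "d \<in> {1, -1}" "0 < of_int d * (of_int b - \<sigma>)" "of_int d * (of_int b - \<sigma>) \<le> 1" "0 \<le> r"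
    and "unobstructed \<omega> x (frac (\<sigma> / of_int K)) (of_int d) (r / of_int K)"
  obtains i where "(advance K a ^^ i) (x, b mod K, d) = (x, (b + d * int i) mod K, d)"
    and "r \<le> of_int d * (of_int b - \<sigma>) + real i" "of_int d * (of_int b - \<sigma>) + real i \<le> r + 1"
      "i = 0 \<or> of_int d * (of_int b - \<sigma>) + real i - 1 < r"
proof -
  define \<rho> where "\<rho> = of_int d * (of_int b - \<sigma>)"
  have dd: "of_int d * of_int d = (1::real)" using assms(1) by auto
  have \<sigma>: "\<sigma> = of_int b - of_int d * \<rho>"
    unfolding \<rho>_def using dd by (simp add: algebra_simps flip: mult.assoc)
  \<comment> \<open>The least number of further positions such that the segment stops before
    leaving the last gap.\<close>
  define i where "i = nat \<lceil>r - \<rho>\<rceil>"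
  have i: "r \<le> \<rho> + real i" "i = 0 \<or> \<rho> + real i - 1 < r"
    unfolding i_def by linarith+
  have "(advance K a ^^ i) (x, b mod K, d) = (x, (b + d * int i) mod K, d)"
  proof (rule advance_straight_pow)
    fix j assume "j < i"
    then have "\<rho> + real j < r" "0 < \<rho> + real j" using i assms(2) \<rho>_def by linarith+
    moreover have "\<sigma> + of_int d * (\<rho> + real j) = of_int (b + d * int j)"
      unfolding \<sigma> by (simp add: algebra_simps)
    ultimately show "\<not> hits a ((b + d * int j) mod K) x"
      using assms(5) unfolding unobstructed_grid by blast
  qed
  moreover have "\<rho> + real i \<le> r + 1" using i(2) assms(3,4) \<rho>_def by linarith
  ultimately show ?thesis using that[of i] i \<rho>_def by simp
qed

lemma gap_mod:
  "gap K (x, b mod K, d) = {(x, frac ((of_int b - of_int d * r) / of_int K)) | r. 0 \<le> r \<and> r \<le> 1}"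
proof -
  have "frac ((of_int (b mod K) - of_int d * r) / of_int K) = frac ((of_int b - of_int d * r) / of_int K)"
    for r :: real
  proof -
    have "real_of_int b = of_int (b mod K) + of_int K * of_int (b div K)"
      by (metis mod_mult_div_eq of_int_add of_int_mult)
    then have "(of_int b - of_int d * r) / of_int K
        = (of_int (b mod K) - of_int d * r) / of_int K + of_int (b div K)"
      using K_pos by (simp add: field_simps)
    then show ?thesis by simp
  qed
  then show ?thesis by (simp add: gap_def)
qed

lemma scale_time: "frac (frac (\<sigma> / of_int K) + d * (R / of_int K)) = frac ((\<sigma> + d * R) / of_int K)"
  unfolding frac_frac_add by (simp add: add_divide_distrib)

text \<open>The particle in the state \<open>p\<close> is inside the gap that ends at
  \<open>h\<close>, or just enters it; \<open>\<sigma>\<close> and \<open>b\<close> are lifts to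
  the line of its scaled time and of the position of \<open>h\<close>.\<close>

definition at_state :: "'v \<times> int \<times> int \<Rightarrow> 'v \<times> real \<times> real \<Rightarrow> real \<Rightarrow> int \<Rightarrow> bool" where
  "at_state h p \<sigma> b \<longleftrightarrow> (\<exists>x d. h = (x, b mod K, d) \<and> p = (x, frac (\<sigma> / of_int K), of_int d) \<and> d \<in> {1, -1} \<and>
     0 < of_int d * (of_int b - \<sigma>) \<and> of_int d * (of_int b - \<sigma>) \<le> 1)"

lemma moves_in_orbit:
  assumes "(move \<omega>)\<^sup>*\<^sup>* p0 p" "at_state h0 p0 \<sigma>0 b0"
  shows "\<exists>i \<sigma> b. at_state ((advance K a ^^ i) h0) p \<sigma> b"
  using assms(1)
proof (induction rule: rtranclp_induct)
  case base
  have "at_state ((advance K a ^^ 0) h0) p0 \<sigma>0 b0" using assms(2) by simp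
  then show ?case by blast
next
  case (step p p')
  then obtain i \<sigma> b where "at_state ((advance K a ^^ i) h0) p \<sigma> b" by blast
  then obtain x d where h: "(advance K a ^^ i) h0 = (x, b mod K, d)"
    "p = (x, frac (\<sigma> / of_int K), of_int d)" "d \<in> {1, -1}"
    "0 < of_int d * (of_int b - \<sigma>)" "of_int d * (of_int b - \<sigma>) \<le> 1"
    unfolding at_state_def by blast
  from step(2) show ?case unfolding h(2)
  proof cases
    case (1 r s' m y d')
    have K: "real_of_int K > 0" using K_pos by simp
    define R where "R = r * of_int K"
    have r: "r = R / of_int K" "0 < R" using K 1 by (simp_all add: R_def)
    have s': "s' = frac ((\<sigma> + of_int d * R) / of_int K)"
      using 1(4) unfolding r(1) scale_time .
    obtain c where c: "\<sigma> + of_int d * R = of_int c" "a (c mod K) = Some ({x, y}, m)"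
      using 1(5) unfolding s' mark_on_grid by blast
    obtain j where j: "(advance K a ^^ j) (x, b mod K, d) = (x, (b + d * int j) mod K, d)"
      "R \<le> of_int d * (of_int b - \<sigma>) + real j"
      "j = 0 \<or> of_int d * (of_int b - \<sigma>) + real j - 1 < R"
      using path_in_orbit[OF h(3-5), of R x] r 1 by auto
    have dd: "of_int d * of_int d = (1::real)" using h(3) by auto
    have "of_int d * (of_int b - \<sigma>) = of_int d * (of_int b - of_int c) + R"
      using c(1)[symmetric] dd by (simp add: algebra_simps flip: mult.assoc)
    then have *: "of_int d * (of_int b - of_int c) + real j \<ge> 0"
      "j = 0 \<or> of_int d * (of_int b - of_int c) + real j < 1"
      "of_int d * (of_int b - of_int c) < (1 :: real)"
      using j h r by linarith+
    have "d * (b - c) + int j = 0"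
    proof -
      have "real_of_int (d * (b - c) + int j) < 1" using * by auto
      moreover have "real_of_int (d * (b - c) + int j) \<ge> 0" using * by simp
      ultimately show ?thesis by linarith
    qed
    then have cb: "c = b + d * int j" using h(3) by auto
    define e where "e = (case m of Cross \<Rightarrow> d | Bar \<Rightarrow> - d)"
    have e: "e \<in> {1, -1}" "d' = of_int e" using 1 h(3) by (auto simp: e_def split: mark.splits)
    have "(advance K a ^^ (Suc j + i)) h0 = advance K a ((advance K a ^^ j) ((advance K a ^^ i) h0))"
      by (simp add: funpow_add)
    also have "\<dots> = (y, (c + e) mod K, e)"
      using advance_jump[OF c(2), of d] 1 unfolding h(1) j(1) cb[symmetric] e_def by simp
    finally have "at_state ((advance K a ^^ (Suc j + i)) h0) p' (of_int c) (c + e)"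
      unfolding at_state_def using 1(1) e c(1) s' by auto
    then show ?thesis by blast
  qed
qed

lemma trajectory_subset_gaps:
  assumes "at_state h0 p0 \<sigma>0 b0"
  shows "trajectory \<omega> p0 \<subseteq> (\<Union>i. gap K ((advance K a ^^ i) h0))"
proof
  fix z assume "z \<in> trajectory \<omega> p0"
  then obtain y s t r where z: "z = (y, frac (s + t * r))" "(move \<omega>)\<^sup>*\<^sup>* p0 (y, s, t)" "0 \<le> r"
    "unobstructed \<omega> y s t r" unfolding trajectory_def by blast
  obtain i \<sigma> b where "at_state ((advance K a ^^ i) h0) (y, s, t) \<sigma> b"
    using moves_in_orbit[OF z(2) assms] by blast
  then obtain d where h: "(advance K a ^^ i) h0 = (y, b mod K, d)"
    "s = frac (\<sigma> / of_int K)" "t = of_int d" "d \<in> {1, -1}"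
    "0 < of_int d * (of_int b - \<sigma>)" "of_int d * (of_int b - \<sigma>) \<le> 1"
    unfolding at_state_def by blast
  have K: "real_of_int K > 0" using K_pos by simp
  define R where "R = r * of_int K"
  have r: "r = R / of_int K" "0 \<le> R" using K z(3) by (simp_all add: R_def)
  obtain j where j: "(advance K a ^^ j) (y, b mod K, d) = (y, (b + d * int j) mod K, d)"
    "R \<le> of_int d * (of_int b - \<sigma>) + real j" "of_int d * (of_int b - \<sigma>) + real j \<le> R + 1"
    using path_in_orbit[OF h(4-6) r(2), of y] z(4) h r by auto
  have dd: "of_int d * (of_int d * q) = q" for q :: real using h(4) by auto
  define \<rho> where "\<rho> = of_int d * (of_int b - \<sigma>) + real j - R"
  have "\<sigma> + of_int d * R = of_int (b + d * int j) - of_int d * \<rho>"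
    unfolding \<rho>_def right_diff_distrib distrib_left dd by simp
  then have "z = (y, frac ((of_int (b + d * int j) - of_int d * \<rho>) / of_int K))"
    unfolding z(1) h r(1) scale_time by simp
  moreover have "0 \<le> \<rho>" "\<rho> \<le> 1" using j by (simp_all add: \<rho>_def)
  ultimately have "z \<in> gap K (y, (b + d * int j) mod K, d)" unfolding gap_mod by blast
  also have "(y, (b + d * int j) mod K, d) = (advance K a ^^ (j + i)) h0"
    by (simp add: funpow_add h j)
  finally show "z \<in> (\<Union>i. gap K ((advance K a ^^ i) h0))" by blast
qed

text \<open>The state \<open>(y, \<sigma>, c)\<close> is the one after the last jump before the
  gap in question, and \<open>r\<close> is the distance from there to the beginning of that gap.
  It is negative only for the initial gap, in whose interior the particle may start.\<close>

lemma orbit_visited: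
  assumes "at_state h0 p0 \<sigma>0 b0"
  shows "\<exists>y \<sigma> b c r. (advance K a ^^ i) h0 = (y, b mod K, c) \<and> c \<in> {1, -1} \<and>
    (move \<omega>)\<^sup>*\<^sup>* p0 (y, frac (\<sigma> / of_int K), of_int c) \<and> -1 < r \<and> (0 < i \<longrightarrow> 0 \<le> r) \<and>
    of_int (b - c) = \<sigma> + of_int c * r \<and>
    unobstructed \<omega> y (frac (\<sigma> / of_int K)) (of_int c) ((r + 1) / of_int K)"
proof (induction i)
  case 0
  obtain x d where h: "h0 = (x, b0 mod K, d)" "p0 = (x, frac (\<sigma>0 / of_int K), of_int d)"
    "d \<in> {1, -1}" "0 < of_int d * (of_int b0 - \<sigma>0)" "of_int d * (of_int b0 - \<sigma>0) \<le> 1"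
    using assms unfolding at_state_def by blast
  have dd: "of_int d * (of_int d * q) = q" for q :: real using h(3) by auto
  define r where "r = of_int d * (of_int b0 - \<sigma>0) - 1"
  have "of_int (b0 - d) = \<sigma>0 + of_int d * r"
    unfolding r_def right_diff_distrib[of "of_int d" _ 1] dd by simp
  moreover have "unobstructed \<omega> x (frac (\<sigma>0 / of_int K)) (of_int d) ((r + 1) / of_int K)"
    unfolding unobstructed_grid
  proof (intro allI impI)
    fix q c assume q: "0 < q \<and> q < r + 1 \<and> \<sigma>0 + of_int d * q = of_int c"
    have "\<sigma>0 = of_int c - of_int d * q" using q by simp
    then have "of_int d * (of_int b0 - \<sigma>0) = of_int d * (of_int b0 - of_int c) + of_int d * (of_int d * q)"
      by (simp only: right_diff_distrib)
    then have "of_int d * (of_int b0 - of_int c) = r + 1 - q" unfolding dd r_def by simp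
    then have "0 < real_of_int (d * (b0 - c))" "real_of_int (d * (b0 - c)) < 1"
      using q h(5) r_def by auto
    then show "\<not> hits a (c mod K) x" using no_int_between by blast
  qed
  ultimately show ?case using h(1-4) by (intro exI[of _ x] exI[of _ \<sigma>0] exI[of _ b0] exI[of _ d] exI[of _ r])
      (auto simp: r_def)
next
  case (Suc i)
  then obtain y \<sigma> b c r where IH: "(advance K a ^^ i) h0 = (y, b mod K, c)" "c \<in> {1, -1}"
    "(move \<omega>)\<^sup>*\<^sup>* p0 (y, frac (\<sigma> / of_int K), of_int c)" "-1 < r"
    "of_int (b - c) = \<sigma> + of_int c * r"
    "unobstructed \<omega> y (frac (\<sigma> / of_int K)) (of_int c) ((r + 1) / of_int K)" by blast
  have K: "real_of_int K > 0" using K_pos by simp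
  have cc: "of_int c * (of_int c * q) = q" for q :: real using IH(2) by auto
  have b: "of_int b = \<sigma> + of_int c * (r + 1)" using IH(5) by (simp add: algebra_simps)
  show ?case
  proof (cases "hits a (b mod K) y")
    case False
    have "unobstructed \<omega> y (frac (\<sigma> / of_int K)) (of_int c) ((r + 1 + 1) / of_int K)"
      unfolding unobstructed_grid
    proof (intro allI impI)
      fix q k assume q: "0 < q \<and> q < r + 1 + 1 \<and> \<sigma> + of_int c * q = of_int k"
      show "\<not> hits a (k mod K) y"
      proof (cases "q < r + 1")
        case True
        then show ?thesis using IH(6) q unfolding unobstructed_grid by blast
      next
        case ge: False
        have "of_int k - of_int b = of_int c * (q - (r + 1))"
          using q b by (simp add: algebra_simps)
        then have "of_int c * (of_int k - of_int b) = q - (r + 1)" by (simp only: cc)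
        then have "0 \<le> real_of_int (c * (k - b))" "real_of_int (c * (k - b)) < 1" using ge q by auto
        then have "c * (k - b) = 0" by (rule int_eq_0I)
        then have "k = b" using IH(2) by auto
        then show ?thesis using False by simp
      qed
    qed
    moreover have "(advance K a ^^ Suc i) h0 = (y, (b + c) mod K, c)"
      using advance_straight[OF False] IH(1) by simp
    ultimately show ?thesis using IH b
      by (intro exI[of _ y] exI[of _ \<sigma>] exI[of _ "b + c"] exI[of _ c] exI[of _ "r + 1"] conjI)
        (assumption | simp)+
  next
    case True
    then obtain e m where em: "a (b mod K) = Some (e, m)" "y \<in> e" by (auto simp: hits_def)
    obtain z where z: "e = {y, z}" "y \<noteq> z" using simple_edgeE[OF letters[OF em(1)] em(2)] by metis
    define d where "d = (case m of Cross \<Rightarrow> c | Bar \<Rightarrow> - c)"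
    have d: "d \<in> {1, -1}" using IH(2) by (auto simp: d_def split: mark.splits)
    have "move \<omega> (y, frac (\<sigma> / of_int K), of_int c) (z, frac (of_int b / of_int K), of_int d)"
    proof (rule move.intros)
      show "0 < (r + 1) / of_int K" using IH(4) K by simp
      show "frac (of_int b / of_int K) = frac (frac (\<sigma> / of_int K) + of_int c * ((r + 1) / of_int K))"
        unfolding scale_time b ..
      show "(frac (of_int b / of_int K), m) \<in> \<omega> {y, z}"
        using em z unfolding mark_on_grid by blast
    qed (use IH z in \<open>auto simp: d_def split: mark.splits\<close>)
    then have "(move \<omega>)\<^sup>*\<^sup>* p0 (z, frac (of_int b / of_int K), of_int d)"
      using IH(3) by (rule rtranclp.rtrancl_into_rtrancl[rotated])
    moreover have "(advance K a ^^ Suc i) h0 = (z, (b + d) mod K, d)"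
      using advance_jump[of b y z m c] em z IH(1) by (simp add: d_def)
    moreover have "unobstructed \<omega> z (frac (of_int b / of_int K)) (of_int d) ((0 + 1) / of_int K)"
      unfolding unobstructed_grid
    proof (intro allI impI)
      fix q k assume q: "0 < q \<and> q < 0 + 1 \<and> of_int b + of_int d * q = real_of_int k"
      then have "of_int d * (of_int k - of_int b) = q" using d by auto
      then have "0 < real_of_int (d * (k - b))" "real_of_int (d * (k - b)) < 1" using q by auto
      then show "\<not> hits a (k mod K) z" using no_int_between by blast
    qed
    ultimately show ?thesis using d
      by (intro exI[of _ z] exI[of _ "of_int b"] exI[of _ "b + d"] exI[of _ d] exI[of _ 0] conjI)
        (assumption | simp)+
  qed
qed

lemma gap_subset_trajectory:
  assumes "at_state h0 p0 \<sigma>0 b0" "0 < i"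
  shows "gap K ((advance K a ^^ i) h0) \<subseteq> trajectory \<omega> p0"
proof
  fix z assume z: "z \<in> gap K ((advance K a ^^ i) h0)"
  obtain y \<sigma> b c r where v: "(advance K a ^^ i) h0 = (y, b mod K, c)" "c \<in> {1, -1}"
    "(move \<omega>)\<^sup>*\<^sup>* p0 (y, frac (\<sigma> / of_int K), of_int c)" "0 \<le> r"
    "of_int (b - c) = \<sigma> + of_int c * r"
    "unobstructed \<omega> y (frac (\<sigma> / of_int K)) (of_int c) ((r + 1) / of_int K)"
    using orbit_visited[OF assms(1), of i] assms(2) by blast
  have K: "real_of_int K > 0" using K_pos by simp
  obtain q where q: "z = (y, frac ((of_int b - of_int c * q) / of_int K))" "0 \<le> q" "q \<le> 1"
    using z unfolding v(1) gap_mod by blast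
  define t where "t = (r + 1 - q) / of_int K"
  have "of_int b - of_int c * q = \<sigma> + of_int c * (r + 1 - q)"
    using v(5) by (simp add: algebra_simps)
  then have "z = (y, frac (frac (\<sigma> / of_int K) + of_int c * t))"
    unfolding t_def scale_time q(1) by simp
  moreover have "0 \<le> t" using q v(4) K by (simp add: t_def)
  moreover have "t \<le> (r + 1) / of_int K" using q K by (simp add: t_def divide_right_mono)
  then have "unobstructed \<omega> y (frac (\<sigma> / of_int K)) (of_int c) t"
    using v(6) unfolding unobstructed_def by auto
  ultimately show "z \<in> trajectory \<omega> p0" unfolding trajectory_def using v(3) by blast
qed

definition loop_of :: "('v \<times> int \<times> int) set \<Rightarrow> ('v \<times> real) set" where
  "loop_of C = (\<Union>h\<in>C. gap K h)"

text \<open>The initial gap may be covered only partly at the start, but the motion is periodic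
  and returns to traverse it completely.\<close>

lemma trajectory_eq_loop_of:
  assumes "at_state h0 p0 \<sigma>0 b0" "h0 \<in> D"
  shows "trajectory \<omega> p0 = loop_of (loop_conn V K a `` {h0})"
proof -
  have "gap K (other_end K ((advance K a ^^ i) h0)) = gap K ((advance K a ^^ i) h0)" for i
    by (rule gap_other_end[OF advance_pow_in_D[OF assms(2)]])
  then have "loop_of (loop_conn V K a `` {h0}) = (\<Union>i. gap K ((advance K a ^^ i) h0))"
    unfolding loop_of_def class_orbit[OF assms(2)] by auto
  moreover have "gap K ((advance K a ^^ i) h0) \<subseteq> trajectory \<omega> p0" for i
  proof -
    obtain p where p: "p > 0" "(advance K a ^^ p) h0 = h0" by (rule advance_periodic[OF assms(2)])
    have "(advance K a ^^ i) h0 = (advance K a ^^ (i + p)) h0"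
      unfolding funpow_add using p by simp
    then show ?thesis using gap_subset_trajectory[OF assms(1), of "i + p"] p by simp
  qed
  ultimately show ?thesis using trajectory_subset_gaps[OF assms(1)] by blast
qed

lemma loops_grid: "loops V \<omega> = loop_of ` (D // loop_conn V K a)"
proof (intro equalityI subsetI)
  have K: "real_of_int K > 0" using K_pos by simp
  fix \<gamma> assume "\<gamma> \<in> loops V \<omega>"
  then obtain x s t where g: "\<gamma> = trajectory \<omega> (x, s, t)" "x \<in> V" "s \<in> {0..<1}" "t \<in> {1, -1}"
    unfolding loops_def by blast
  define \<sigma> where "\<sigma> = s * of_int K"
  define d :: int where "d = (if t = 1 then 1 else -1)"
  define b where "b = (if t = 1 then \<lfloor>\<sigma>\<rfloor> + 1 else \<lceil>\<sigma>\<rceil> - 1)"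
  have "s = frac (\<sigma> / of_int K)" using g(3) K by (simp add: \<sigma>_def frac_on_circle)
  moreover have "0 < of_int d * (of_int b - \<sigma>) \<and> of_int d * (of_int b - \<sigma>) \<le> 1"
    unfolding d_def b_def by (simp split: if_splits) linarith
  ultimately have "at_state (x, b mod K, d) (x, s, t) \<sigma> b"
    unfolding at_state_def using g(4) by (auto simp: d_def)
  moreover have "(x, b mod K, d) \<in> D" using g K_pos by (auto simp: half_edges_def d_def)
  ultimately show "\<gamma> \<in> loop_of ` (D // loop_conn V K a)"
    unfolding g(1) using trajectory_eq_loop_of by (auto simp: quotient_def)
next
  have K: "real_of_int K > 0" using K_pos by simp
  fix \<gamma> assume "\<gamma> \<in> loop_of ` (D // loop_conn V K a)"
  then obtain h where h: "h \<in> D" "\<gamma> = loop_of (loop_conn V K a `` {h})" by (auto simp: quotient_def)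
  obtain x b d where x: "h = (x, b, d)" "x \<in> V" "b mod K = b" "d \<in> {1, -1}"
    using h(1) by (auto simp: half_edges_def)
  \<comment> \<open>Start in the middle of the gap that ends at \<open>h\<close>.\<close>
  let ?\<sigma> = "of_int b - of_int d / 2"
  have "at_state h (x, frac (?\<sigma> / of_int K), of_int d) ?\<sigma> b"
    unfolding at_state_def using x by auto
  from trajectory_eq_loop_of[OF this h(1)]
  have "\<gamma> = trajectory \<omega> (x, frac (?\<sigma> / of_int K), of_int d)" using h by simp
  then show "\<gamma> \<in> loops V \<omega>"
    unfolding loops_def using x frac_circle by fastforce
qed

text \<open>Trajectories may touch at marks, so they are distinguished by the midpoints of their
  gaps: a midpoint lies in one gap only, and this gap is encoded by its two ends.\<close>

lemma gap_midpoint: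
  assumes "(x, b, d) \<in> D" "h \<in> D" "(x, frac ((of_int b - of_int d / 2) / of_int K)) \<in> gap K h"
  shows "h = (x, b, d) \<or> h = other_end K (x, b, d)"
proof -
  have K: "real_of_int K > 0" using K_pos by simp
  obtain y b' d' where h: "h = (y, b', d')" by (cases h) auto
  obtain r :: real where r: "y = x" "0 \<le> r" "r \<le> 1"
    "frac ((of_int b - of_int d / 2) / of_int K) = frac ((of_int b' - of_int d' * r) / of_int K)"
    using assms(3) by (auto simp: gap_def h)
  then obtain n where "(of_int b - of_int d / 2) / of_int K = (of_int b' - of_int d' * r) / of_int K + of_int n"
    using frac_eqD by blast
  moreover have "X = Y + N * k" if "X / k = Y / k + N" "k > 0" for X Y N k :: real
    using that by (simp add: field_simps)
  ultimately have n: "of_int b - of_int d / 2 = of_int b' - of_int d' * r + of_int n * of_int K"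
    using K by blast
  have d: "d \<in> {1, -1}" "d' \<in> {1, -1}" and b: "b mod K = b" "b' mod K = b'"
    using assms(1,2) by (auto simp: half_edges_def h)
  show ?thesis
  proof (cases "d' = d")
    case True
    then have "of_int (d * (b' + n * K - b)) = r - 1 / 2" using n d by auto
    then have "- 1 < real_of_int (d * (b' + n * K - b))" "real_of_int (d * (b' + n * K - b)) < 1"
      using r by linarith+
    then have "d * (b' + n * K - b) = 0" by (intro int_abs_lt_1I)
    then have "b = b' + n * K" using d by auto
    then have "b = b'" using b by (metis mod_mult_self1)
    then show ?thesis using h True r by simp
  next
    case False
    then have dd: "d' = - d" using d by auto
    then have "of_int (d * (b - b' - n * K)) = r + 1 / 2" using n d by auto
    then have "0 < real_of_int (d * (b - b' - n * K))" "real_of_int (d * (b - b' - n * K)) < 2"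
      using r by linarith+
    then have "d * (b - b' - n * K) = 1" by (rule int_eq_1I)
    then have "b - d = b' + n * K" using d by auto
    then have "(b - d) mod K = b'" using b by simp
    then show ?thesis using h dd r by simp
  qed
qed

lemma loop_of_inj: "inj_on loop_of (D // loop_conn V K a)"
proof (rule inj_onI)
  fix X Y assume XY: "X \<in> D // loop_conn V K a" "Y \<in> D // loop_conn V K a" "loop_of X = loop_of Y"
  obtain h g where h: "h \<in> D" "X = loop_conn V K a `` {h}" and g: "g \<in> D" "Y = loop_conn V K a `` {g}"
    using XY by (auto simp: quotient_def)
  obtain x b d where x: "h = (x, b, d)" by (cases h) auto
  have "(x, frac ((of_int b - of_int d / 2) / of_int K)) \<in> gap K h"
    unfolding gap_def x by (auto intro!: exI[of _ "1/2"])
  moreover have "h \<in> X" unfolding h loop_conn_def by blast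
  ultimately have "(x, frac ((of_int b - of_int d / 2) / of_int K)) \<in> loop_of X"
    unfolding loop_of_def by (rule UN_I[rotated])
  then have "(x, frac ((of_int b - of_int d / 2) / of_int K)) \<in> loop_of Y"
    unfolding XY(3) .
  then obtain k where k: "k \<in> Y" "(x, frac ((of_int b - of_int d / 2) / of_int K)) \<in> gap K k"
    unfolding loop_of_def by (rule UN_E)
  have kD: "k \<in> D" using k(1) class_subset_D[OF g(1)] unfolding g(2) by blast
  have "(h, other_end K h) \<in> loop_conn V K a"
    unfolding loop_conn_def using h(1) by (intro conn_link) (auto simp: links_def)
  then have "(h, k) \<in> loop_conn V K a"
    using gap_midpoint[of x b d k] h(1) kD k(2) unfolding x loop_conn_def by auto
  moreover have "(g, k) \<in> loop_conn V K a" using k(1) g(2) by simp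
  ultimately show "X = Y" unfolding h g loop_conn_def class_eq_iff
    by (metis conn_sym conn_trans)
qed

lemma num_loops_grid: "num_loops V \<omega> = card (D // loop_conn V K a)"
  unfolding num_loops_def loops_grid by (rule card_image[OF loop_of_inj])

lemma loop_support_loop_of: "loop_support (loop_of C) = fst ` C"
proof -
  have "\<exists>s. (x, s) \<in> gap K (x, b, d)" for x :: 'v and b d
    unfolding gap_def by (auto intro: exI[of _ 0])
  moreover have "(x, s) \<in> gap K h \<Longrightarrow> fst h = x" for x :: 'v and s h
    unfolding gap_def by (auto split: prod.splits)
  ultimately show ?thesis unfolding loop_support_def loop_of_def by force
qed

lemma large_loop_grid:
  "large_loop V \<eta> \<omega> \<longleftrightarrow> (\<exists>h\<in>D. real (card (fst ` (loop_conn V K a `` {h}))) > \<eta> * real (card V))"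
  unfolding large_loop_def loops_grid by (auto simp: loop_support_loop_of quotient_def)

end

section \<open>Words of marks\<close>

type_synonym 'v word = "('v set \<times> mark) list"

text \<open>The word lists the marks in the order of their times. The base point
  \<open>0\<close> of the circle, where the word starts, carries no mark.\<close>

definition represents :: "'v config \<Rightarrow> 'v word \<Rightarrow> bool" where
  "represents \<omega> w \<longleftrightarrow> (\<exists>ts. length ts = length w \<and> sorted_wrt (<) ts \<and> set ts \<subseteq> {0<..<1} \<and>
     \<omega> = (\<lambda>e. {(ts ! j, m) | j m. j < length w \<and> w ! j = (e, m)}))"

lemma represents_time_change:
  assumes "represents \<omega> w" "represents \<omega>' w"
  shows "circle_config \<omega> \<and> (\<exists>\<phi>. time_change \<phi> \<and> \<omega>' = transport \<phi> \<omega>)"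
proof -
  obtain ts where ts: "length ts = length w" "sorted_wrt (<) ts" "set ts \<subseteq> {0<..<1}"
    "\<omega> = (\<lambda>e. {(ts ! j, m) | j m. j < length w \<and> w ! j = (e, m)})"
    using assms(1) unfolding represents_def by blast
  obtain ss where ss: "length ss = length w" "sorted_wrt (<) ss" "set ss \<subseteq> {0<..<1}"
    "\<omega>' = (\<lambda>e. {(ss ! j, m) | j m. j < length w \<and> w ! j = (e, m)})"
    using assms(2) unfolding represents_def by blast
  have ts_iff: "ts ! i < ts ! j \<longleftrightarrow> i < j" if "i < length w" "j < length w" for i j
    using that ts(1,2) by (metis linorder_less_linear order_less_asym sorted_wrt_nth_less)
  have ss_iff: "ss ! i < ss ! j \<longleftrightarrow> i < j" if "i < length w" "j < length w" for i j
    using that ss(1,2) by (metis linorder_less_linear order_less_asym sorted_wrt_nth_less)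
  have tsj: "ts ! j \<in> {0<..<1}" "ss ! j \<in> {0<..<1}" if "j < length w" for j
    using that ts ss nth_mem by (metis subsetD)+
  have inj: "inj_on ((!) ts) {..<length w}"
    by (rule inj_onI) (metis lessThan_iff linorder_less_linear order_less_irrefl ts_iff)
  define g where "g = inv_into {..<length w} ((!) ts)"
  have g: "g (ts ! j) = j" if "j < length w" for j
    unfolding g_def using inj that by (simp add: inv_into_f_f)
  \<comment> \<open>The map that sends the \<open>j\<close>-th time of one configuration to the
    \<open>j\<close>-th time of the other.\<close>
  define f where "f x = ss ! g x" for x
  have f: "f (ts ! j) = ss ! j" if "j < length w" for j using g that by (simp add: f_def)
  have st: "x \<in> set ts \<Longrightarrow> \<exists>j<length w. x = ts ! j" for x by (metis in_set_conv_nth ts(1))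
  have "\<exists>\<phi>. time_change \<phi> \<and> (\<forall>a\<in>set ts. \<phi> a = f a)"
  proof (rule time_change_exists)
    show "strict_mono_on (set ts) f"
    proof (rule strict_mono_onI)
      fix x y assume "x \<in> set ts" "y \<in> set ts" "x < y"
      then obtain i j where "i < length w" "j < length w" "x = ts ! i" "y = ts ! j" using st by metis
      then show "f x < f y" using f ts_iff ss_iff \<open>x < y\<close> by simp
    qed
    show "f ` set ts \<subseteq> {0..<1}"
    proof (rule image_subsetI)
      fix x assume "x \<in> set ts"
      then obtain i where "i < length w" "x = ts ! i" using st by metis
      then show "f x \<in> {0..<1}" using f tsj(2)[of i] by simp
    qed
    show "x = 0 \<longleftrightarrow> f x = 0" if "x \<in> set ts" for x
    proof -
      obtain i where "i < length w" "x = ts ! i" using st \<open>x \<in> set ts\<close> by metis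
      then show ?thesis using f tsj[of i] by simp
    qed
  qed (use ts in auto)
  then obtain \<phi> where \<phi>: "time_change \<phi>" "\<forall>a\<in>set ts. \<phi> a = f a" by blast
  have \<phi>j: "\<phi> (ts ! j) = ss ! j" if "j < length w" for j
    using \<phi>(2) f that ts(1) nth_mem by metis
  have "\<omega>' = transport \<phi> \<omega>"
  proof
    fix e
    have "transport \<phi> \<omega> e = {(\<phi> (ts ! j), m) | j m. j < length w \<and> w ! j = (e, m)}"
      unfolding transport_def ts(4) by (auto simp: image_iff) blast
    also have "\<dots> = {(ss ! j, m) | j m. j < length w \<and> w ! j = (e, m)}"
      using \<phi>j by metis
    finally show "\<omega>' e = transport \<phi> \<omega> e" unfolding ss(4) by simp
  qed
  moreover have "circle_config \<omega>"
    unfolding circle_config_def ts(4) using tsj(1) by fastforce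
  ultimately show ?thesis using \<phi>(1) by blast
qed

lemma represents_num_loops:
  "represents \<omega> w \<Longrightarrow> represents \<omega>' w \<Longrightarrow> num_loops V \<omega> = num_loops V \<omega>'"
  using represents_time_change num_loops_transport by metis

lemma represents_large_loop:
  "represents \<omega> w \<Longrightarrow> represents \<omega>' w \<Longrightarrow> large_loop V \<eta> \<omega> \<longleftrightarrow> large_loop V \<eta> \<omega>'"
  using represents_time_change large_loop_transport by metis

definition letter_at :: "('v set \<times> mark) option list \<Rightarrow> int \<Rightarrow> ('v set \<times> mark) option" where
  "letter_at ls b = (if 0 \<le> b \<and> b < int (length ls) then ls ! nat b else None)"

text \<open>Position \<open>0\<close> is left empty so that all marks have positive times and
  that the circle has at least one position for the empty word; \<open>l\<close> further
  positions are left empty behind the word.\<close>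

definition padded :: "'v word \<Rightarrow> nat \<Rightarrow> ('v set \<times> mark) option list" where
  "padded w l = None # map Some w @ replicate l None"

definition list_config :: "('v set \<times> mark) option list \<Rightarrow> 'v config" where
  "list_config ls = grid_config (int (length ls)) (letter_at ls)"

definition word_config :: "'v word \<Rightarrow> 'v config" where
  "word_config w = list_config (padded w 0)"

lemma length_padded [simp]: "length (padded w l) = Suc (length w + l)"
  by (simp add: padded_def)

lemma padded_nth: "padded w l ! Suc j = Some x \<longleftrightarrow> j < length w \<and> w ! j = x"
  if "j < length w + l"
  using that by (auto simp: padded_def nth_append)

lemma letter_at_padded:
  "letter_at (padded w l) b = Some x \<longleftrightarrow> (\<exists>j<length w. b = int (Suc j) \<and> w ! j = x)"
proof
  assume h: "letter_at (padded w l) b = Some x"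
  then have b: "0 \<le> b" "b < int (Suc (length w + l))" "padded w l ! nat b = Some x"
    by (auto simp: letter_at_def split: if_splits)
  then have "nat b \<noteq> 0" by (auto simp: padded_def intro: gr0I)
  then obtain j where j: "nat b = Suc j" by (cases "nat b") auto
  then have "b = int (Suc j)" "j < length w + l" using b by auto
  then show "\<exists>j<length w. b = int (Suc j) \<and> w ! j = x" using b(3) j padded_nth[of j w l x] by auto
next
  assume "\<exists>j<length w. b = int (Suc j) \<and> w ! j = x"
  then obtain j where j: "j < length w" "b = int (Suc j)" "w ! j = x" by blast
  then have "padded w l ! nat b = Some x" using padded_nth[of j w l x] by (simp add: nat_add_distrib)
  then show "letter_at (padded w l) b = Some x" using j by (simp add: letter_at_def)
qed

lemma represents_padded: "represents (list_config (padded w l)) w"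
proof -
  let ?K = "real (Suc (length w + l))"
  define ts where "ts = map (\<lambda>j. real (Suc j) / ?K) [0..<length w]"
  have "sorted_wrt (<) ts"
    unfolding ts_def sorted_wrt_map
    by (rule sorted_wrt_mono_rel[OF _ sorted_wrt_upt]) (simp add: divide_strict_right_mono)
  moreover have "set ts \<subseteq> {0<..<1}" unfolding ts_def by auto
  moreover have "list_config (padded w l) = (\<lambda>e. {(ts ! j, m) | j m. j < length w \<and> w ! j = (e, m)})"
  proof
    fix e
    have "list_config (padded w l) e = {(of_int b / of_int (int (Suc (length w + l))), m) | b m.
        0 \<le> b \<and> b < int (Suc (length w + l)) \<and> (\<exists>j<length w. b = int (Suc j) \<and> w ! j = (e, m))}"
      unfolding list_config_def grid_config_def letter_at_padded length_padded ..
    also have "\<dots> = {(real (Suc j) / ?K, m) | j m. j < length w \<and> w ! j = (e, m)}"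
      (is "?L = ?R")
    proof
      show "?L \<subseteq> ?R" by fastforce
      show "?R \<subseteq> ?L"
      proof
        fix p assume "p \<in> ?R"
        then obtain j m where "p = (real (Suc j) / ?K, m)" "j < length w" "w ! j = (e, m)" by blast
        then show "p \<in> ?L" by (intro CollectI exI[of _ "int (Suc j)"] exI[of _ m]) auto
      qed
    qed
    also have "\<dots> = {(ts ! j, m) | j m. j < length w \<and> w ! j = (e, m)}"
    proof -
      have "ts ! j = real (Suc j) / ?K" if "j < length w" for j using that by (simp add: ts_def)
      then show ?thesis by (intro Collect_cong iff_exI) auto
    qed
    finally show "list_config (padded w l) e = {(ts ! j, m) | j m. j < length w \<and> w ! j = (e, m)}" .
  qed
  moreover have "length ts = length w" by (simp add: ts_def)
  ultimately show ?thesis unfolding represents_def by blast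
qed

definition word_loops :: "'v set \<Rightarrow> 'v word \<Rightarrow> nat" where
  "word_loops V w = num_loops V (word_config w)"

text \<open>Whether \<open>x\<close> and \<open>y\<close> lie on one loop at the time of an
  empty position behind the word, which is where a further letter would be inserted.\<close>

definition same_loop :: "'v set \<Rightarrow> 'v word \<Rightarrow> 'v \<Rightarrow> 'v \<Rightarrow> bool" where
  "same_loop V w x y \<longleftrightarrow> ((x, int (length w) + 1, 1), (y, int (length w) + 1, 1))
     \<in> loop_conn V (int (length w) + 2) (letter_at (padded w 1))"

lemma conn_links_four:
  assumes "{p, q, r, s} \<subseteq> D" "f p = q" "f q = p" "f r = s" "f s = r"
  shows "conn (X \<union> links D f) = conn (insert (p, q) (insert (r, s) (X \<union> links (D - {p, q, r, s}) f)))"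
    (is "conn ?A = conn ?B")
proof (rule conn_eqI)
  have "links D f = links (D - {p, q, r, s}) f \<union> {(p, q), (q, p), (r, s), (s, r)}"
    using assms unfolding links_def by auto
  moreover have "(q, p) \<in> conn ?B" "(s, r) \<in> conn ?B"
    by (rule conn_sym, rule conn_link, simp)+
  ultimately show "?A \<subseteq> conn ?B" using links_subset_conn[of ?B] by auto
  have "?B \<subseteq> ?A" using assms unfolding links_def by force
  then show "?B \<subseteq> conn ?A" using links_subset_conn[of ?A] by blast
qed

locale loop_graph =
  fixes V :: "'v set" and E :: "'v set set"
  assumes finite_V: "finite V" and edges: "E \<subseteq> simple_edges V"
begin

definition words :: "'v word set" where
  "words = lists (E \<times> UNIV)"

lemma finite_E: "finite E"
proof (rule finite_subset)
  show "E \<subseteq> Pow V" using edges by (auto simp: simple_edges_def)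
qed (use finite_V in simp)

lemma loop_grid_padded:
  assumes "w \<in> words"
  shows "loop_grid V (int (Suc (length w + l))) (letter_at (padded w l))"
proof
  fix b e m assume "letter_at (padded w l) b = Some (e, m)"
  then have "(e, m) \<in> set w" unfolding letter_at_padded by (metis nth_mem)
  then show "e \<in> simple_edges V" using assms edges unfolding words_def by auto
qed (use finite_V in auto)

lemma word_loops_eq_card:
  assumes "w \<in> words"
  shows "word_loops V w = card (half_edges V (int (Suc (length w + l))) //
    loop_conn V (int (Suc (length w + l))) (letter_at (padded w l)))"
proof -
  interpret loop_grid V "int (Suc (length w + l))" "letter_at (padded w l)"
    by (rule loop_grid_padded[OF assms])
  have "word_loops V w = num_loops V (list_config (padded w l))"
    unfolding word_loops_def word_config_def
    by (rule represents_num_loops[OF represents_padded represents_padded])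
  then show ?thesis unfolding list_config_def length_padded num_loops_grid .
qed

text \<open>The vertices on one loop at a given time all belong to its support.\<close>

lemma large_loop_word:
  assumes "w \<in> words" "\<not> large_loop V \<eta> (word_config w)" "x \<in> V"
  shows "real (card {y \<in> V. same_loop V w x y}) \<le> \<eta> * real (card V)"
proof -
  interpret loop_grid V "int (Suc (length w + 1))" "letter_at (padded w 1)"
    by (rule loop_grid_padded[OF assms(1)])
  have K: "int (length w) + 2 = int (Suc (length w + 1))" by simp
  let ?h = "(x, int (length w) + 1, 1 :: int)"
  have "\<not> large_loop V \<eta> (list_config (padded w 1))"
    using assms(2) unfolding word_config_def
    by (metis represents_large_loop represents_padded)
  then have "\<not> large_loop V \<eta> \<omega>" unfolding list_config_def length_padded .
  moreover have h: "?h \<in> D" using assms(3) by (simp add: half_edges_def)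
  ultimately have "real (card (fst ` (loop_conn V (int (Suc (length w + 1))) (letter_at (padded w 1)) `` {?h})))
      \<le> \<eta> * real (card V)" unfolding large_loop_grid by (meson linorder_not_less)
  moreover have "{y \<in> V. same_loop V w x y} \<subseteq>
      fst ` (loop_conn V (int (Suc (length w + 1))) (letter_at (padded w 1)) `` {?h})"
    unfolding same_loop_def K by force
  moreover have "finite (loop_conn V (int (Suc (length w + 1))) (letter_at (padded w 1)) `` {?h})"
    using class_subset_D[OF h] finite_D finite_subset by blast
  ultimately show ?thesis
    by (meson card_mono finite_imageI of_nat_le_iff order_trans)
qed

lemma same_loop_equiv:
  "same_loop V w x x" "same_loop V w x y \<Longrightarrow> same_loop V w y x"
  "same_loop V w x y \<Longrightarrow> same_loop V w y z \<Longrightarrow> same_loop V w x z"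
  unfolding same_loop_def loop_conn_def by (auto intro: conn_sym conn_trans)

text \<open>The words \<open>w\<close> and \<open>w @ [(e, m)]\<close> are realised on the same
  grid, with an empty last position for \<open>w\<close>. They differ only in how the four
  half-edges of \<open>x\<close> and \<open>y\<close> at that position are glued, so
  \<open>resolve_crossing\<close> applies.\<close>

lemma word_loops_append:
  assumes "w \<in> words" "e \<in> E" "e = {x, y}" "x \<noteq> y"
  shows "\<not> same_loop V w x y \<Longrightarrow> word_loops V w = word_loops V (w @ [(e, Cross)]) + 1 \<and>
      word_loops V w = word_loops V (w @ [(e, Bar)]) + 1"
    and "same_loop V w x y \<Longrightarrow>
      (word_loops V (w @ [(e, Cross)]) = word_loops V w + 1 \<and> word_loops V (w @ [(e, Bar)]) = word_loops V w) \<or>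
      (word_loops V (w @ [(e, Cross)]) = word_loops V w \<and> word_loops V (w @ [(e, Bar)]) = word_loops V w + 1)"
proof -
  define K where "K = int (Suc (length w + 1))"
  define a where "a = letter_at (padded w 1)"
  define c where "c m = letter_at (padded (w @ [(e, m)]) 0)" for m
  interpret loop_grid V K a unfolding K_def a_def by (rule loop_grid_padded[OF assms(1)])
  define b where "b = int (length w) + 1"
  have cb: "c m b = Some (e, m)" for m
    unfolding c_def letter_at_padded b_def by (intro exI[of _ "length w"]) simp
  have ab: "a b = None"
  proof (cases "a b")
    case (Some x)
    then show ?thesis unfolding a_def letter_at_padded b_def by auto
  qed
  have c_other: "c m b' = a b'" if "b' \<noteq> b" for m b'
  proof -
    have "c m b' = Some x \<longleftrightarrow> a b' = Some x" for x
      unfolding c_def a_def letter_at_padded using that unfolding b_def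
      by (auto simp: nth_append less_Suc_eq)
    then show ?thesis by (metis not_Some_eq)
  qed
  have xyV: "x \<in> V" "y \<in> V" using assms edges by (auto simp: simple_edges_def)
  define p q r s where "p = (x, b, 1::int)" and "q = (x, b, -1::int)" and "r = (y, b, 1::int)"
    and "s = (y, b, -1::int)"
  note pqrs = p_def q_def r_def s_def
  have D: "{p, q, r, s} \<subseteq> D" using xyV by (auto simp: pqrs half_edges_def b_def K_def)
  have dist: "distinct [p, q, r, s]" using assms(4) by (simp add: pqrs)
  have ga: "glue a p = q" "glue a q = p" "glue a r = s" "glue a s = r"
    by (simp_all add: pqrs ab)
  have n: "neighbour e x = y" "neighbour e y = x"
    using neighbour_eq[OF assms(3,4)] neighbour_eq[of e y x] assms(3,4) insert_commute[of x y "{}"]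
    by simp_all
  have gX: "glue (c Cross) p = s" "glue (c Cross) s = p" "glue (c Cross) r = q" "glue (c Cross) q = r"
    using n assms(3) by (simp_all add: pqrs cb)
  have gB: "glue (c Bar) p = r" "glue (c Bar) r = p" "glue (c Bar) q = s" "glue (c Bar) s = q"
    using n assms(3) by (simp_all add: pqrs cb)
  have g_other: "glue (c m) h = glue a h" if "h \<in> D - {p, q, r, s}" for h m
  proof -
    obtain z b' d where h: "h = (z, b', d)" by (cases h) auto
    show ?thesis
    proof (cases "b' = b")
      case True
      then have "z \<notin> e" using that assms(3) by (auto simp: h half_edges_def pqrs)
      then show ?thesis by (simp add: h True cb ab)
    qed (simp add: h c_other)
  qed
  have links_other: "links (D - {p, q, r, s}) (glue (c m)) = links (D - {p, q, r, s}) (glue a)" for m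
    unfolding links_def using g_other by (intro image_cong) auto
  have closed: "glue a ` (D - {p, q, r, s}) \<subseteq> D - {p, q, r, s}"
  proof (rule image_subsetI)
    fix h assume h: "h \<in> D - {p, q, r, s}"
    then have "glue a h \<in> D" "glue a (glue a h) = h"
      using glue_involution by (auto simp: fpf_involution_def)
    then show "glue a h \<in> D - {p, q, r, s}" using h ga by auto
  qed
  let ?L = "links D (other_end K) \<union> links (D - {p, q, r, s}) (glue a)"
  have c0: "loop_conn V K a = conn (insert (p, q) (insert (r, s) ?L))"
    unfolding loop_conn_def by (rule conn_links_four) (use D ga in auto)
  have c1: "loop_conn V K (c Cross) = conn (insert (p, s) (insert (r, q) ?L))"
  proof -
    have eq: "{p, s, r, q} = {p, q, r, s}" by auto
    show ?thesis unfolding loop_conn_def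
      using conn_links_four[of p s r q D "glue (c Cross)" "links D (other_end K)"] D gX
      unfolding eq links_other by simp
  qed
  have c2: "loop_conn V K (c Bar) = conn (insert (p, r) (insert (q, s) ?L))"
  proof -
    have eq: "{p, r, q, s} = {p, q, r, s}" by auto
    show ?thesis unfolding loop_conn_def
      using conn_links_four[of p r q s D "glue (c Bar)" "links D (other_end K)"] D gB
      unfolding eq links_other by simp
  qed
  have w': "w @ [(e, m)] \<in> words" for m using assms(1,2) by (simp add: words_def)
  have K': "int (Suc (length (w @ [(e, m)]) + 0)) = K" for m by (simp add: K_def)
  have n0: "word_loops V w = card (D // loop_conn V K a)"
    unfolding K_def a_def by (rule word_loops_eq_card[OF assms(1)])
  have nm: "word_loops V (w @ [(e, m)]) = card (D // loop_conn V K (c m))" for m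
    using word_loops_eq_card[OF w', of m 0] unfolding K' c_def .
  have same: "same_loop V w x y \<longleftrightarrow> (p, r) \<in> loop_conn V K a"
    unfolding same_loop_def pqrs K_def a_def b_def by (simp add: add.commute)
  note res = resolve_crossing[OF finite_D other_end_involution glue_involution D dist closed,
      folded c0 c1 c2, folded n0 nm same]
  show "\<not> same_loop V w x y \<Longrightarrow> word_loops V w = word_loops V (w @ [(e, Cross)]) + 1 \<and>
      word_loops V w = word_loops V (w @ [(e, Bar)]) + 1" by (rule res(1))
  show "same_loop V w x y \<Longrightarrow>
      (word_loops V (w @ [(e, Cross)]) = word_loops V w + 1 \<and> word_loops V (w @ [(e, Bar)]) = word_loops V w) \<or>
      (word_loops V (w @ [(e, Cross)]) = word_loops V w \<and> word_loops V (w @ [(e, Bar)]) = word_loops V w + 1)"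
    by (rule res(2))
qed

text \<open>On a common grid, \<open>w\<close> has empty positions where \<open>w @ w'\<close>
  has the letters of \<open>w'\<close>. A loop of \<open>w\<close> that enters this part of the
  grid runs vertically through all of it, so there are at most \<open>card V\<close> such loops,
  and the others remain loops of \<open>w @ w'\<close>.\<close>

lemma word_loops_concat:
  assumes "w \<in> words" "w' \<in> words"
  shows "word_loops V w \<le> word_loops V (w @ w') + card V"
proof -
  define l where "l = length w'"
  define K where "K = int (Suc (length w + l))"
  define a where "a = letter_at (padded w l)"
  define a' where "a' = letter_at (padded (w @ w') 0)"
  interpret loop_grid V K a unfolding K_def a_def by (rule loop_grid_padded[OF assms(1)])
  have ww: "w @ w' \<in> words" using assms by (simp add: words_def)
  have K': "int (Suc (length (w @ w') + 0)) = K" by (simp add: K_def l_def)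
  have n1: "word_loops V w = card (D // loop_conn V K a)"
    unfolding K_def a_def by (rule word_loops_eq_card[OF assms(1)])
  have n2: "word_loops V (w @ w') = card (D // loop_conn V K a')"
    using word_loops_eq_card[OF ww, of 0] unfolding K' a'_def .
  define B where "B = {(x, b, d) \<in> D. b > int (length w)}"
  have agree: "a' b = a b" if "b \<le> int (length w)" for b
  proof -
    have "a' b = Some x \<longleftrightarrow> a b = Some x" for x
      unfolding a_def a'_def letter_at_padded using that by (auto simp: nth_append)
    then show ?thesis by (metis not_Some_eq)
  qed
  have none: "a b = None" if "b > int (length w)" for b
  proof (cases "a b")
    case (Some x)
    then show ?thesis using that unfolding a_def letter_at_padded by auto
  qed
  interpret a': loop_grid V K a' using loop_grid_padded[OF ww, of 0] unfolding K' a'_def .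
  have pos: "fst (snd (glue f h)) = fst (snd h)" for f and h :: "'v \<times> int \<times> int"
    by (cases h) (auto split: option.split)
  have eqoff: "glue a' h = glue a h" if "h \<in> D - B" for h
    using that agree by (cases h) (auto simp: B_def)
  have inB: "glue a h \<in> B" "glue a' h \<in> B" if "h \<in> B" for h
  proof -
    have "h \<in> D" "fst (snd h) > int (length w)" using that by (auto simp: B_def)
    moreover from this have "glue a h \<in> D" "glue a' h \<in> D"
      using glue_involution a'.glue_involution by (auto simp: fpf_involution_def)
    ultimately show "glue a h \<in> B" "glue a' h \<in> B"
      using pos[of a h] pos[of a' h] unfolding B_def by (simp_all split: prod.splits) auto
  qed
  let ?L1 = "links D (other_end K) \<union> links D (glue a)"
  let ?L2 = "links D (other_end K) \<union> links D (glue a')"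
  have "card (D // conn ?L1) \<le> card (D // conn ?L2) + card ((\<lambda>x. (x, int (length w) + 1, 1::int)) ` V)"
  proof (rule card_classes_local_change[OF finite_D])
    show "?L1 \<subseteq> D \<times> D"
      using other_end_involution glue_involution unfolding links_def fpf_involution_def by auto
    show "?L1 - B \<times> B = ?L2 - B \<times> B"
    proof -
      have "links D (glue a) - B \<times> B = links (D - B) (glue a)"
        "links D (glue a') - B \<times> B = links (D - B) (glue a')"
        using inB unfolding links_def by auto
      moreover have "links (D - B) (glue a) = links (D - B) (glue a')"
        unfolding links_def using eqoff by (intro image_cong) auto
      ultimately show ?thesis by blast
    qed
    show "finite ((\<lambda>x. (x, int (length w) + 1, 1::int)) ` V)" using finite_V by simp
    fix h assume "h \<in> B"
    then obtain x b d where h: "h = (x, b, d)" "x \<in> V" "int (length w) < b" "b < K" "d \<in> {1, -1}"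
      by (auto simp: B_def half_edges_def)
    have DD: "(x, b', d') \<in> D" if "int (length w) < b'" "b' < K" "d' \<in> {1, -1}" for b' d'
      using that h(2) by (auto simp: half_edges_def)
    have up: "((x, b', 1), (x, b', -1)) \<in> conn ?L1" if "int (length w) < b'" "b' < K" for b'
    proof -
      have "((x, b', 1), (x, b', -1)) \<in> links D (glue a)"
        unfolding links_def using DD[OF that, of 1] none[OF that(1)] by force
      then show ?thesis by (intro conn_link) blast
    qed
    have "((x, int (length w) + 1, 1), (x, int (length w) + 1 + int n, 1)) \<in> conn ?L1"
      if "int (length w) + 1 + int n < K" for n
      using that
    proof (induction n)
      case (Suc n)
      let ?b = "int (length w) + 1 + int n"
      have "((x, ?b + 1, 1), (x, ?b, -1)) \<in> links D (other_end K)"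
        unfolding links_def using DD[of "?b + 1" 1] Suc.prems by (force simp: mod_pos_pos_trivial)
      then have s: "((x, ?b, -1), (x, ?b + 1, 1)) \<in> conn ?L1" by (intro conn_sym[OF conn_link]) blast
      have i: "((x, int (length w) + 1, 1), (x, ?b, 1)) \<in> conn ?L1" using Suc by simp
      have u: "((x, ?b, 1), (x, ?b, -1)) \<in> conn ?L1" by (rule up) (use Suc.prems in auto)
      have "((x, int (length w) + 1, 1), (x, ?b + 1, 1)) \<in> conn ?L1"
        by (rule conn_trans[OF conn_trans[OF i u] s])
      moreover have "?b + 1 = int (length w) + 1 + int (Suc n)" by simp
      ultimately show ?case by metis
    qed simp
    from this[of "nat (b - int (length w) - 1)"] h
    have "((x, int (length w) + 1, 1), (x, b, 1)) \<in> conn ?L1" by simp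
    then have "((x, int (length w) + 1, 1), h) \<in> conn ?L1"
      using conn_trans[OF _ up[OF h(3,4)]] h by auto
    then show "\<exists>j\<in>(\<lambda>x. (x, int (length w) + 1, 1)) ` V. (j, h) \<in> conn ?L1" using h(2) by blast
  qed
  also have "card ((\<lambda>x. (x, int (length w) + 1, 1::int)) ` V) \<le> card V"
    using finite_V by (rule card_image_le)
  finally show ?thesis unfolding n1 n2 loop_conn_def by simp
qed

definition internal_edges :: "'v word \<Rightarrow> 'v set set" where
  "internal_edges w = {e \<in> E. \<forall>x\<in>e. \<forall>y\<in>e. same_loop V w x y}"

text \<open>The relation \<^const>\<open>same_loop\<close> partitions \<open>V\<close>; without
  a large loop its classes are small enough for the sparsity hypothesis, and summing over the
  classes gives the bound.\<close>

lemma card_internal_edges: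
  assumes "w \<in> words" "\<not> large_loop V \<eta> (word_config w)"
    and "\<And>S. S \<subseteq> V \<Longrightarrow> real (card S) \<le> \<eta> * real (card V) \<Longrightarrow>
      real (edges_inside E S) \<le> c * real (card S)"
  shows "real (card (internal_edges w)) \<le> c * real (card V)"
proof -
  let ?S = "\<lambda>x. {y \<in> V. same_loop V w x y}"
  let ?P = "?S ` V"
  have fin: "finite ?P" using finite_V by simp
  have "internal_edges w \<subseteq> (\<Union>S\<in>?P. {e \<in> E. e \<subseteq> S})"
  proof
    fix e assume e: "e \<in> internal_edges w"
    then have "e \<in> simple_edges V" using edges by (auto simp: internal_edges_def)
    then obtain x where x: "x \<in> e" "e \<subseteq> V" by (auto simp: simple_edges_def card_2_iff)
    then have "e \<subseteq> ?S x" using e by (auto simp: internal_edges_def)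
    then show "e \<in> (\<Union>S\<in>?P. {e \<in> E. e \<subseteq> S})" using e x by (auto simp: internal_edges_def)
  qed
  then have "card (internal_edges w) \<le> card (\<Union>S\<in>?P. {e \<in> E. e \<subseteq> S})"
    using finite_V finite_E by (intro card_mono finite_UN_I finite_imageI) auto
  also have "\<dots> \<le> (\<Sum>S\<in>?P. edges_inside E S)"
    unfolding edges_inside_def by (rule card_UN_le[OF fin])
  finally have "real (card (internal_edges w)) \<le> (\<Sum>S\<in>?P. real (edges_inside E S))"
    by (metis of_nat_le_iff of_nat_sum)
  also have "\<dots> \<le> (\<Sum>S\<in>?P. c * real (card S))"
  proof (rule sum_mono)
    fix S assume "S \<in> ?P"
    then show "real (edges_inside E S) \<le> c * real (card S)"
      using large_loop_word[OF assms(1,2)] by (intro assms(3)) auto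
  qed
  also have "\<dots> = c * real (\<Sum>S\<in>?P. card S)" by (simp add: sum_distrib_left)
  also have "(\<Sum>S\<in>?P. card S) = card (\<Union>?P)"
  proof (rule card_Union_disjoint[symmetric])
    show "pairwise disjnt ?P"
    proof (rule pairwiseI)
      fix S T assume "S \<in> ?P" "T \<in> ?P" "S \<noteq> T"
      then obtain x y where xy: "S = ?S x" "T = ?S y" by blast
      have "\<not> same_loop V w x y"
      proof
        assume "same_loop V w x y"
        then have "?S x = ?S y" using same_loop_equiv by blast
        then show False using xy \<open>S \<noteq> T\<close> by simp
      qed
      then show "disjnt S T" unfolding xy disjnt_def using same_loop_equiv by blast
    qed
  qed (use finite_V in auto)
  also have "\<Union>?P = V" using same_loop_equiv(1) by blast
  finally show ?thesis .
qed

lemma edgeE: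
  assumes "e \<in> E"
  obtains x y where "e = {x, y}" "x \<noteq> y"
  using assms edges by (auto simp: simple_edges_def card_2_iff)

lemma internal_edges_iff:
  assumes "e \<in> E" "e = {x, y}"
  shows "e \<in> internal_edges w \<longleftrightarrow> same_loop V w x y"
  using assms same_loop_equiv(1)[of w x] same_loop_equiv(1)[of w y] same_loop_equiv(2)[of w x y]
  unfolding internal_edges_def by blast

definition loop_change :: "'v word \<Rightarrow> 'v set \<Rightarrow> mark \<Rightarrow> int" where
  "loop_change w e m = int (word_loops V (w @ [(e, m)])) - int (word_loops V w)"

lemma loop_change_external:
  assumes "w \<in> words" "e \<in> E" "e \<notin> internal_edges w"
  shows "loop_change w e m = - 1"
proof -
  obtain x y where e: "e = {x, y}" "x \<noteq> y" using assms(2) by (rule edgeE)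
  show ?thesis
    using word_loops_append(1)[OF assms(1,2) e] internal_edges_iff[OF assms(2) e(1)] assms(3)
    by (cases m) (simp_all add: loop_change_def)
qed

lemma loop_change_internal:
  assumes "w \<in> words" "e \<in> internal_edges w"
  shows "(loop_change w e Cross = 1 \<and> loop_change w e Bar = 0) \<or>
    (loop_change w e Cross = 0 \<and> loop_change w e Bar = 1)"
proof -
  have eE: "e \<in> E" using assms(2) by (simp add: internal_edges_def)
  obtain x y where e: "e = {x, y}" "x \<noteq> y" using eE by (rule edgeE)
  show ?thesis
    using word_loops_append(2)[OF assms(1) eE e] internal_edges_iff[OF eE e(1)] assms(2)
    by (auto simp: loop_change_def)
qed

lemma loop_change_cases:
  assumes "w \<in> words" "e \<in> E"
  shows "loop_change w e m \<in> {-1, 0, 1}"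
  using loop_change_external[OF assms, of m] loop_change_internal[OF assms(1), of e]
  by (cases "e \<in> internal_edges w"; cases m) auto

end

lemma UNIV_mark: "(UNIV :: mark set) = {Cross, Bar}"
  using mark.exhaust by blast

instance mark :: finite
  by standard (simp add: UNIV_mark)

definition mark_weight :: "real \<Rightarrow> mark \<Rightarrow> real" where
  "mark_weight u m = (case m of Cross \<Rightarrow> u | Bar \<Rightarrow> 1 - u)"

lemma sum_mark: "(\<Sum>m\<in>UNIV. f m) = f Cross + f Bar"
  by (simp add: UNIV_mark)

text \<open>For \<open>k\<close> equal to \<open>1\<close>, \<open>0\<close> or
  \<open>-1\<close> this is \<open>(\<theta>\<^sup>k - 1) / (\<theta> - 1)\<close>, and
  \<open>k\<close> itself when \<open>\<theta> = 1\<close>. The normalisation makes it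
  increasing in \<open>k\<close> on both sides of \<open>\<theta> = 1\<close>, so that all
  values of \<open>\<theta>\<close> can be treated at once.\<close>

definition relative_change :: "real \<Rightarrow> int \<Rightarrow> real" where
  "relative_change \<theta> k = (if k > 0 then 1 else if k = 0 then 0 else - 1 / \<theta>)"

context loop_graph
begin

definition growth_rate :: "real \<Rightarrow> real \<Rightarrow> 'v word \<Rightarrow> real" where
  "growth_rate \<theta> u w =
     (\<Sum>e\<in>E. \<Sum>m\<in>UNIV. mark_weight u m * relative_change \<theta> (loop_change w e m))"

lemma power_word_loops_append:
  assumes "w \<in> words" "e \<in> E" "\<theta> > 0"
  shows "\<theta> ^ word_loops V (w @ [(e, m)]) =
    \<theta> ^ word_loops V w * (1 + (\<theta> - 1) * relative_change \<theta> (loop_change w e m))"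
proof -
  let ?a = "word_loops V w" and ?b = "word_loops V (w @ [(e, m)])"
  consider "?a = ?b + 1" "loop_change w e m = -1" | "?b = ?a" "loop_change w e m = 0"
    | "?b = ?a + 1" "loop_change w e m = 1"
    using loop_change_cases[OF assms(1,2), of m] unfolding loop_change_def by force
  then show ?thesis
  proof cases
    case 1
    then show ?thesis using assms(3) by (simp add: relative_change_def field_simps)
  next
    case 2
    then show ?thesis by (simp add: relative_change_def)
  next
    case 3
    then show ?thesis by (simp add: relative_change_def algebra_simps)
  qed
qed

lemma word_loops_append_diff:
  assumes "w \<in> words" "e \<in> E"
  shows "real (word_loops V (w @ [(e, m)])) =
    real (word_loops V w) + relative_change 1 (loop_change w e m)"
proof -
  have "relative_change 1 (loop_change w e m) = of_int (loop_change w e m)"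
    using loop_change_cases[OF assms, of m] by (auto simp: relative_change_def)
  then show ?thesis by (simp add: loop_change_def)
qed

lemma growth_rate_le_card:
  assumes "w \<in> words" "\<theta> > 0" "u \<in> {0..1}"
  shows "growth_rate \<theta> u w \<le> real (card E)"
proof -
  have "relative_change \<theta> k \<le> 1" for k
  proof -
    have "- 1 / \<theta> \<le> 0" using assms(2) by simp
    then show ?thesis unfolding relative_change_def by (auto simp del: divide_minus_left)
  qed
  then have "(\<Sum>m\<in>UNIV. mark_weight u m * relative_change \<theta> (k m)) \<le> (\<Sum>m\<in>UNIV. mark_weight u m * 1)" for k
    using assms(3) by (intro sum_mono mult_left_mono) (auto simp: mark_weight_def split: mark.split)
  also have "(\<Sum>m\<in>UNIV. mark_weight u m * 1) = 1" by (simp add: sum_mark mark_weight_def)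
  finally have "growth_rate \<theta> u w \<le> (\<Sum>e\<in>E. 1)"
    unfolding growth_rate_def by (intro sum_mono)
  then show ?thesis by simp
qed

text \<open>An edge between different loops contributes \<open>- 1 / \<theta>\<close>. An edge
  inside a loop contributes the probability of the type of mark that splits the loop.\<close>

lemma growth_rate_le_internal:
  assumes "w \<in> words" "\<theta> > 0" "u \<in> {0..1}"
  shows "growth_rate \<theta> u w \<le>
    (real (card (internal_edges w)) * (1 + \<theta> * max u (1 - u)) - real (card E)) / \<theta>"
proof -
  let ?I = "internal_edges w"
  have I: "?I \<subseteq> E" by (auto simp: internal_edges_def)
  have "(\<Sum>m\<in>UNIV. mark_weight u m * relative_change \<theta> (loop_change w e m))
      \<le> (if e \<in> ?I then max u (1 - u) else - 1 / \<theta>)" if e: "e \<in> E" for e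
  proof (cases "e \<in> ?I")
    case True
    then show ?thesis
      using loop_change_internal[OF assms(1) True]
      by (auto simp: sum_mark mark_weight_def relative_change_def)
  next
    case False
    then show ?thesis using loop_change_external[OF assms(1) e False] assms(2)
      by (simp add: sum_mark mark_weight_def relative_change_def field_simps)
  qed
  then have "growth_rate \<theta> u w \<le> (\<Sum>e\<in>E. if e \<in> ?I then max u (1 - u) else - 1 / \<theta>)"
    unfolding growth_rate_def by (rule sum_mono)
  also have "\<dots> = (\<Sum>e\<in>?I. max u (1 - u)) + (\<Sum>e\<in>E - ?I. - 1 / \<theta>)"
    using finite_E I by (subst sum.subset_diff[OF I finite_E]) auto
  also have "\<dots> = real (card ?I) * max u (1 - u) + (real (card E) - real (card ?I)) * (- 1 / \<theta>)"
    using card_Diff_subset[OF finite_subset[OF I finite_E] I] card_mono[OF finite_E I]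
    by (simp add: of_nat_diff)
  also have "\<dots> = (real (card ?I) * (1 + \<theta> * max u (1 - u)) - real (card E)) / \<theta>"
    using assms(2) by (simp add: field_simps)
  finally show ?thesis .
qed

lemma word_loops_le:
  "w \<in> words \<Longrightarrow> word_loops V w \<le> word_loops V [] + length w"
proof (induction w rule: rev_induct)
  case (snoc l w)
  obtain e m where l: "l = (e, m)" by (cases l)
  have w: "w \<in> words" "e \<in> E" using snoc.prems by (auto simp: words_def l)
  show ?case using loop_change_cases[OF w, of m] snoc.IH[OF w(1)] by (auto simp: loop_change_def l)
qed simp

end

section \<open>Samples of the Poisson processes\<close>

abbreviation uniform_time :: "real measure" where
  "uniform_time \<equiv> restrict_space lborel {0..<1}"

lemma prob_space_uniform_time: "prob_space uniform_time"
  by (rule prob_spaceI) (simp add: emeasure_restrict_space space_restrict_space)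

definition increasing_times :: "nat \<Rightarrow> real \<Rightarrow> (nat \<Rightarrow> real) set" where
  "increasing_times k x = {y \<in> space (PiM {..<k} (\<lambda>_. uniform_time)).
     (\<forall>j<k. 0 < y j \<and> y j < x) \<and> (\<forall>j<k. \<forall>i<j. y i < y j)}"

lemma measurable_time_component:
  "j < k \<Longrightarrow> (\<lambda>y. y j) \<in> borel_measurable (PiM {..<k} (\<lambda>_. uniform_time))"
  by (rule measurable_compose[OF measurable_component_singleton[of j "{..<k}" "\<lambda>_. uniform_time"]])
     (auto intro: measurable_restrict_space1)

lemma sets_increasing_times [measurable]:
  "increasing_times k x \<in> sets (PiM {..<k} (\<lambda>_. uniform_time))"
proof -
  have [measurable]: "(\<lambda>y. y j) \<in> borel_measurable (PiM {..<k} (\<lambda>_. uniform_time))" if "j < k" for j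
    using that by (rule measurable_time_component)
  have "increasing_times k x = {y \<in> space (PiM {..<k} (\<lambda>_. uniform_time)).
     (\<forall>j\<in>{..<k}. 0 < y j \<and> y j < x) \<and> (\<forall>j\<in>{..<k}. \<forall>i\<in>{..<j}. y i < y j)}"
    by (auto simp: increasing_times_def)
  also have "\<dots> \<in> sets (PiM {..<k} (\<lambda>_. uniform_time))"
  proof (intro sets.sets_Collect_conj sets.sets_Collect_finite_All)
    fix i j assume h: "j \<in> {..<k}" "i \<in> {..<j}"
    have [measurable]: "(\<lambda>y. y j) \<in> borel_measurable (PiM {..<k} (\<lambda>_. uniform_time))"
      "(\<lambda>y. y i) \<in> borel_measurable (PiM {..<k} (\<lambda>_. uniform_time))"
      using h by (auto intro!: measurable_time_component)
    show "{y \<in> space (PiM {..<k} (\<lambda>_. uniform_time)). y i < y j} \<in> sets (PiM {..<k} (\<lambda>_. uniform_time))"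
      by measurable
  next
    fix j assume h: "j \<in> {..<k}"
    have [measurable]: "(\<lambda>y. y j) \<in> borel_measurable (PiM {..<k} (\<lambda>_. uniform_time))"
      using h by (auto intro!: measurable_time_component)
    show "{y \<in> space (PiM {..<k} (\<lambda>_. uniform_time)). 0 < y j} \<in> sets (PiM {..<k} (\<lambda>_. uniform_time))"
      "{y \<in> space (PiM {..<k} (\<lambda>_. uniform_time)). y j < x} \<in> sets (PiM {..<k} (\<lambda>_. uniform_time))"
      by measurable
  qed auto
  finally show ?thesis .
qed

text \<open>The volume of a simplex, by integration over the largest time.\<close>

lemma emeasure_increasing_times:
  assumes "0 \<le> x" "x \<le> 1"
  shows "emeasure (PiM {..<k} (\<lambda>_. uniform_time)) (increasing_times k x) = ennreal (x ^ k / fact k)"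
  using assms
proof (induction k arbitrary: x)
  case 0
  interpret prob_space uniform_time by (rule prob_space_uniform_time)
  have "increasing_times 0 x = {\<lambda>_. undefined}"
    by (auto simp: increasing_times_def space_PiM)
  then show ?case by (simp add: PiM_empty)
next
  case (Suc k)
  interpret prob_space uniform_time by (rule prob_space_uniform_time)
  interpret product_sigma_finite "\<lambda>_::nat. uniform_time" ..
  let ?P = "\<lambda>k. PiM {..<k} (\<lambda>_::nat. uniform_time)"
  have ind: "indicator (increasing_times (Suc k) x) (z(k := y)) =
      (indicator {0<..<x} y * indicator (increasing_times k y) z :: ennreal)"
    if z: "z \<in> space (?P k)" and y: "y \<in> space uniform_time" for z y
  proof -
    have sp: "z(k := y) \<in> space (?P (Suc k))"
      using z y by (auto simp: space_PiM PiE_iff extensional_def less_Suc_eq)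
    have "z(k := y) \<in> increasing_times (Suc k) x \<longleftrightarrow> y \<in> {0<..<x} \<and> z \<in> increasing_times k y"
    proof
      assume "z(k := y) \<in> increasing_times (Suc k) x"
      then have h: "\<And>j. j < Suc k \<Longrightarrow> 0 < (z(k := y)) j \<and> (z(k := y)) j < x"
        "\<And>i j. j < Suc k \<Longrightarrow> i < j \<Longrightarrow> (z(k := y)) i < (z(k := y)) j"
        by (auto simp: increasing_times_def)
      have "0 < z j \<and> z j < y" if "j < k" for j
        using h(1)[of j] h(2)[of k j] that by simp
      moreover have "z i < z j" if "j < k" "i < j" for i j
        using h(2)[of j i] that by simp
      ultimately show "y \<in> {0<..<x} \<and> z \<in> increasing_times k y"
        using h(1)[of k] z by (auto simp: increasing_times_def)
    next
      assume h: "y \<in> {0<..<x} \<and> z \<in> increasing_times k y"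
      then have *: "0 < y" "y < x" "\<And>j. j < k \<Longrightarrow> 0 < z j \<and> z j < y"
        "\<And>i j. j < k \<Longrightarrow> i < j \<Longrightarrow> z i < z j"
        by (auto simp: increasing_times_def)
      have zx: "z j < x" if "j < k" for j using *(2) *(3)[OF that] by linarith
      show "z(k := y) \<in> increasing_times (Suc k) x"
        unfolding increasing_times_def using sp * zx by (auto simp: less_Suc_eq)
    qed
    then show ?thesis by (auto simp: indicator_def)
  qed
  have "emeasure (?P (Suc k)) (increasing_times (Suc k) x)
      = (\<integral>\<^sup>+ y. indicator (increasing_times (Suc k) x) y \<partial>?P (Suc k))" by simp
  also have "\<dots> = (\<integral>\<^sup>+ y. (\<integral>\<^sup>+ z. indicator (increasing_times (Suc k) x) (z(k := y)) \<partial>?P k) \<partial>uniform_time)"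
    unfolding lessThan_Suc
    by (rule product_nn_integral_insert_rev) (auto simp: lessThan_Suc[symmetric])
  also have "\<dots> = (\<integral>\<^sup>+ y. indicator {0<..<x} y * ennreal (y ^ k / fact k) \<partial>uniform_time)"
  proof (rule nn_integral_cong)
    fix y assume y: "y \<in> space uniform_time"
    then have y01: "0 \<le> y" "y \<le> 1" by (auto simp: space_restrict_space)
    have "(\<integral>\<^sup>+ z. indicator (increasing_times (Suc k) x) (z(k := y)) \<partial>?P k)
        = (\<integral>\<^sup>+ z. indicator {0<..<x} y * indicator (increasing_times k y) z \<partial>?P k)"
      using ind[OF _ y] by (intro nn_integral_cong) simp
    also have "\<dots> = indicator {0<..<x} y * emeasure (?P k) (increasing_times k y)"
      by (subst nn_integral_cmult) auto
    finally show "(\<integral>\<^sup>+ z. indicator (increasing_times (Suc k) x) (z(k := y)) \<partial>?P k)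
        = indicator {0<..<x} y * ennreal (y ^ k / fact k)"
      using Suc.IH[OF y01] by simp
  qed
  also have "\<dots> = (\<integral>\<^sup>+ y. indicator {0<..<x} y * ennreal (y ^ k / fact k) * indicator {0..<1} y \<partial>lborel)"
    by (subst nn_integral_restrict_space) auto
  also have "\<dots> = (\<integral>\<^sup>+ y. ennreal (y ^ k / fact k) * indicator {0..x} y \<partial>lborel)"
  proof (rule nn_integral_cong_AE)
    have "AE y in lborel. y \<noteq> 0 \<and> y \<noteq> x" using AE_lborel_singleton[of 0] AE_lborel_singleton[of x] by auto
    then show "AE y in lborel. indicator {0<..<x} y * ennreal (y ^ k / fact k) * indicator {0..<1} y =
        ennreal (y ^ k / fact k) * indicator {0..x} y"
      using Suc.prems by (auto split: split_indicator)
  qed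
  also have "\<dots> = ennreal (x ^ Suc k / fact (Suc k) - 0 ^ Suc k / fact (Suc k))"
  proof -
    have d: "((\<lambda>y. y ^ Suc k / fact (Suc k)) has_real_derivative y ^ k / fact k) (at y)" for y :: real
      by (rule derivative_eq_intros refl | simp)+
    show ?thesis
      using nn_integral_FTC_Icc[of "\<lambda>y. y ^ k / fact k" 0 x "\<lambda>y. y ^ Suc k / fact (Suc k)"] d Suc.prems
      by simp
  qed
  finally show ?case by simp
qed

lemma prob_space_marks: "prob_space (\<Pi>\<^sub>M i\<in>(UNIV :: nat set). mark_measure u)"
  by (rule prob_space_PiM) (rule prob_space_mark_measure)

lemma emeasure_mark_measure:
  assumes "A \<in> sets uniform_time" "u \<in> {0..1}"
  shows "emeasure (mark_measure u) (A \<times> {m}) = emeasure uniform_time A * ennreal (mark_weight u m)"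
proof -
  let ?q = "map_pmf (\<lambda>b. if b then Cross else Bar) (bernoulli_pmf u)"
  have "emeasure (measure_pmf ?q) {m} = ennreal (mark_weight u m)"
  proof -
    have "pmf ?q m = mark_weight u m"
    proof (cases m)
      case Cross
      have "pmf ?q Cross = measure (bernoulli_pmf u) ((\<lambda>b. if b then Cross else Bar) -` {Cross})"
        by (simp add: pmf_map)
      also have "(\<lambda>b. if b then Cross else Bar) -` {Cross} = {True}" by (auto split: if_splits)
      finally show ?thesis using assms(2) Cross by (simp add: measure_pmf_single mark_weight_def)
    next
      case Bar
      have "pmf ?q Bar = measure (bernoulli_pmf u) ((\<lambda>b. if b then Cross else Bar) -` {Bar})"
        by (simp add: pmf_map)
      also have "(\<lambda>b. if b then Cross else Bar) -` {Bar} = {False}" by (auto split: if_splits)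
      finally show ?thesis using assms(2) Bar by (simp add: measure_pmf_single mark_weight_def)
    qed
    then show ?thesis by (simp add: emeasure_pmf_single)
  qed
  then show ?thesis
    unfolding mark_measure_def using assms(1)
    by (subst measure_pmf.emeasure_pair_measure_Times) auto
qed

lemma pmf_poisson0:
  assumes "t \<ge> 0"
  shows "pmf (poisson0_pmf t) k = t ^ k / fact k * exp (- t)"
  using assms by (cases "k = 0") (auto simp: poisson0_pmf_def pmf_return)

lemma measurable_mark_time: "fst \<in> borel_measurable (mark_measure u)"
  unfolding mark_measure_def
  by (rule measurable_compose[OF measurable_fst]) (auto intro: measurable_restrict_space1)

lemma measurable_mark_type: "snd \<in> measurable (mark_measure u) (count_space UNIV)"
  unfolding mark_measure_def
  by (rule measurable_compose[OF measurable_snd]) simp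

lemma space_mark_measure: "space (mark_measure u) = {0..<1} \<times> UNIV"
  by (simp add: mark_measure_def space_pair_measure space_restrict_space)

lemma space_poisson_process: "space (poisson_process t u) = UNIV \<times> (UNIV \<rightarrow>\<^sub>E {0..<1} \<times> UNIV)"
  by (simp add: poisson_process_def space_pair_measure space_PiM space_mark_measure)

lemma space_config_law: "space (config_law E t u) = (E \<rightarrow>\<^sub>E UNIV \<times> (UNIV \<rightarrow>\<^sub>E {0..<1} \<times> UNIV))"
  by (simp add: config_law_def space_PiM space_poisson_process)

lemma measurable_sample_count:
  assumes "e \<in> E"
  shows "(\<lambda>s. fst (s e)) \<in> measurable (config_law E t u) (count_space UNIV)"
proof -
  have "(\<lambda>s. s e) \<in> measurable (config_law E t u) (poisson_process t u)"
    unfolding config_law_def using assms by (rule measurable_component_singleton)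
  moreover have "fst \<in> measurable (poisson_process t u) (count_space UNIV)"
    unfolding poisson_process_def by (rule measurable_compose[OF measurable_fst]) simp
  ultimately show ?thesis by (rule measurable_compose)
qed

lemma measurable_sample_mark:
  assumes "e \<in> E"
  shows "(\<lambda>s. snd (s e) i) \<in> measurable (config_law E t u) (mark_measure u)"
proof -
  have "(\<lambda>s. s e) \<in> measurable (config_law E t u) (poisson_process t u)"
    unfolding config_law_def using assms by (rule measurable_component_singleton)
  moreover have "(\<lambda>p. snd p i) \<in> measurable (poisson_process t u) (mark_measure u)"
    unfolding poisson_process_def
    by (rule measurable_compose[OF measurable_snd measurable_component_singleton]) simp
  ultimately show ?thesis by (rule measurable_compose)
qed

lemmas measurable_sample_time = measurable_compose[OF measurable_sample_mark measurable_mark_time]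
lemmas measurable_sample_type = measurable_compose[OF measurable_sample_mark measurable_mark_type]

lemma config_of_circle:
  assumes "s \<in> space (config_law E t u)"
  shows "circle_config (config_of E s)"
  unfolding circle_config_def
proof
  fix e
  show "fst ` config_of E s e \<subseteq> {0..<1}"
  proof (cases "e \<in> E")
    case True
    have "fst (snd (s e) i) \<in> {0..<1}" for i
      using assms True unfolding space_config_law by (auto simp: PiE_iff mem_Times_iff)
    then show ?thesis using True by (auto simp: config_of_def)
  qed (simp add: config_of_def)
qed

definition sample_time :: "'v sample \<Rightarrow> 'v set \<times> nat \<Rightarrow> real" where
  "sample_time s a = fst (snd (s (fst a)) (snd a))"

definition sample_type :: "'v sample \<Rightarrow> 'v set \<times> nat \<Rightarrow> mark" where
  "sample_type s a = snd (snd (s (fst a)) (snd a))"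

text \<open>Two samples with the same numbers and types of marks and the same order of their
  times, coincidences and the time \<open>0\<close> included, differ by a time change.\<close>

lemma same_pattern_transport:
  fixes s s' :: "'v sample"
  assumes fin: "finite E" and sp: "s \<in> space (config_law E t u)" "s' \<in> space (config_law E t u)"
    and count: "\<And>e. e \<in> E \<Longrightarrow> fst (s e) = N e" "\<And>e. e \<in> E \<Longrightarrow> fst (s' e) = N e"
  defines "I \<equiv> Sigma E (\<lambda>e. {..<N e})"
  assumes order: "\<And>a b. a \<in> I \<Longrightarrow> b \<in> I \<Longrightarrow>
      sample_time s a < sample_time s b \<longleftrightarrow> sample_time s' a < sample_time s' b"
    and zero: "\<And>a. a \<in> I \<Longrightarrow> sample_time s a = 0 \<longleftrightarrow> sample_time s' a = 0"
    and type: "\<And>a. a \<in> I \<Longrightarrow> sample_type s a = sample_type s' a"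
  shows "\<exists>\<phi>. time_change \<phi> \<and> config_of E s' = transport \<phi> (config_of E s)"
proof -
  let ?T = sample_time
  have finI: "finite I" using fin by (simp add: I_def)
  have eq: "?T s a = ?T s b \<longleftrightarrow> ?T s' a = ?T s' b" if "a \<in> I" "b \<in> I" for a b
    using order[OF that] order[OF that(2,1)] by (metis linorder_neq_iff)
  have range: "?T s a \<in> {0..<1}" "?T s' a \<in> {0..<1}" if "a \<in> I" for a
    using that sp unfolding space_config_law I_def sample_time_def
    by (auto simp: PiE_iff mem_Times_iff)
  \<comment> \<open>The choice is immaterial because coincidences of times in one sample are
    coincidences in the other.\<close>
  define f where "f x = ?T s' (SOME a. a \<in> I \<and> ?T s a = x)" for x
  have f: "f (?T s a) = ?T s' a" if "a \<in> I" for a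
  proof -
    have "(SOME b. b \<in> I \<and> ?T s b = ?T s a) \<in> I \<and> ?T s (SOME b. b \<in> I \<and> ?T s b = ?T s a) = ?T s a"
      by (rule someI[of _ a]) (use that in simp)
    then show ?thesis unfolding f_def using eq that by blast
  qed
  have "\<exists>\<phi>. time_change \<phi> \<and> (\<forall>x\<in>?T s ` I. \<phi> x = f x)"
  proof (rule time_change_exists)
    show "strict_mono_on (?T s ` I) f"
      by (rule strict_mono_onI) (use f order in auto)
  qed (use finI range f zero in auto)
  then obtain \<phi> where \<phi>: "time_change \<phi>" "\<And>a. a \<in> I \<Longrightarrow> \<phi> (?T s a) = ?T s' a" using f by auto
  have "config_of E s' e = transport \<phi> (config_of E s) e" for e
  proof (cases "e \<in> E")
    case True
    have "snd (s' e) i = map_prod \<phi> id (snd (s e) i)" if "i < N e" for i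
    proof -
      have "(e, i) \<in> I" using that True by (simp add: I_def)
      then show ?thesis using \<phi>(2)[of "(e, i)"] type[of "(e, i)"]
        by (simp add: sample_time_def sample_type_def prod_eq_iff)
    qed
    then show ?thesis
      unfolding config_of_def transport_def using True count[OF True] by (simp add: image_image)
  qed (simp add: config_of_def transport_def)
  then show ?thesis using \<phi>(1) by blast
qed

text \<open>An invariant property is constant on each set of samples with given numbers of marks
  and a given pattern of order and types. There are countably many such sets and all are
  measurable. Samples with coinciding times have to be included: they form a null set, but the
  measures are not complete.\<close>

lemma measurable_invariant:
  fixes E :: "'v set set"
  assumes fin: "finite E"
    and inv: "\<And>\<phi> \<omega>. time_change \<phi> \<Longrightarrow> circle_config \<omega> \<Longrightarrow> P (transport \<phi> \<omega>) = P \<omega>"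
  shows "{s \<in> space (config_law E t u). P (config_of E s)} \<in> sets (config_law E t u)"
proof -
  let ?M = "config_law E t u"
  let ?T = sample_time
  define I where "I = (\<lambda>N. Sigma E (\<lambda>e. {..<N e :: nat}))"
  define pat where "pat = (\<lambda>N (s :: 'v sample). ({(a, b) \<in> I N \<times> I N. ?T s a < ?T s b},
    {a \<in> I N. ?T s a = 0}, {a \<in> I N. sample_type s a = Cross}))"
  define Q where "Q = (\<lambda>N p. {s \<in> space ?M. (\<forall>e\<in>E. fst (s e) = N e) \<and> pat N s = p})"
  have finI: "finite (I N)" for N using fin by (simp add: I_def)
  define Pats where "Pats = (\<lambda>N. Pow (I N \<times> I N) \<times> Pow (I N) \<times> Pow (I N))"
  have finP: "finite (Pats N)" for N using finI by (simp add: Pats_def)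
  have Q_meas: "Q N p \<in> sets ?M" for N p
  proof -
    obtain p1 p2 p3 where p: "p = (p1, p2, p3)" by (cases p) auto
    have mT [measurable]: "(\<lambda>s. ?T s a) \<in> borel_measurable ?M" if "a \<in> I N" for a
      using that measurable_sample_time[of "fst a" E "snd a" t u] by (auto simp: sample_time_def I_def)
    have "Q N p = (if p1 \<subseteq> I N \<times> I N \<and> p2 \<subseteq> I N \<and> p3 \<subseteq> I N then
      {s \<in> space ?M. (\<forall>e\<in>E. fst (s e) = N e) \<and>
        (\<forall>a\<in>I N. \<forall>b\<in>I N. (?T s a < ?T s b) = ((a, b) \<in> p1)) \<and>
        (\<forall>a\<in>I N. (?T s a = 0) = (a \<in> p2)) \<and>
        (\<forall>a\<in>I N. (sample_type s a = Cross) = (a \<in> p3))} else {})"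
    proof -
      have A: "{(a, b) \<in> I N \<times> I N. ?T s a < ?T s b} = p1 \<longleftrightarrow>
          p1 \<subseteq> I N \<times> I N \<and> (\<forall>a\<in>I N. \<forall>b\<in>I N. (?T s a < ?T s b) = ((a, b) \<in> p1))" for s by blast
      have B: "{a \<in> I N. ?T s a = 0} = p2 \<longleftrightarrow> p2 \<subseteq> I N \<and> (\<forall>a\<in>I N. (?T s a = 0) = (a \<in> p2))" for s
        by blast
      have C: "{a \<in> I N. sample_type s a = Cross} = p3 \<longleftrightarrow>
          p3 \<subseteq> I N \<and> (\<forall>a\<in>I N. (sample_type s a = Cross) = (a \<in> p3))" for s :: "'v sample"
        by blast
      show ?thesis unfolding Q_def pat_def p prod.inject A B C by auto
    qed
    also have "\<dots> \<in> sets ?M"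
    proof -
      have 1: "{s \<in> space ?M. fst (s e) = N e} \<in> sets ?M" if "e \<in> E" for e
      proof -
        have "(\<lambda>s. fst (s e)) -` {N e} \<inter> space ?M \<in> sets ?M"
          using measurable_sample_count[OF that] by (rule measurable_sets) simp
        also have "(\<lambda>s. fst (s e)) -` {N e} \<inter> space ?M = {s \<in> space ?M. fst (s e) = N e}" by auto
        finally show ?thesis .
      qed
      have 2: "{s \<in> space ?M. (?T s a < ?T s b) = c} \<in> sets ?M" if "a \<in> I N" "b \<in> I N" for a b c
        using mT[OF that(1)] mT[OF that(2)] by measurable
      have 3: "{s \<in> space ?M. (?T s a = 0) = c} \<in> sets ?M" if "a \<in> I N" for a c
        using mT[OF that(1)] by measurable
      have 4: "{s \<in> space ?M. (sample_type s a = Cross) = c} \<in> sets ?M" if "a \<in> I N" for a c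
      proof -
        have "fst a \<in> E" using that by (auto simp: I_def)
        then have "(\<lambda>s. sample_type s a) -` {m. (m = Cross) = c} \<inter> space ?M \<in> sets ?M"
          unfolding sample_type_def by (intro measurable_sets[OF measurable_sample_type]) auto
        also have "(\<lambda>s. sample_type s a) -` {m. (m = Cross) = c} \<inter> space ?M
            = {s \<in> space ?M. (sample_type s a = Cross) = c}" by auto
        finally show ?thesis .
      qed
      have "{s \<in> space ?M. (\<forall>e\<in>E. fst (s e) = N e) \<and>
        (\<forall>a\<in>I N. \<forall>b\<in>I N. (?T s a < ?T s b) = ((a, b) \<in> p1)) \<and>
        (\<forall>a\<in>I N. (?T s a = 0) = (a \<in> p2)) \<and>
        (\<forall>a\<in>I N. (sample_type s a = Cross) = (a \<in> p3))} \<in> sets ?M"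
        using 1 2 3 4 fin finI
        by (intro sets.sets_Collect_conj sets.sets_Collect_finite_All) auto
      then show ?thesis by simp
    qed
    finally show ?thesis .
  qed
  have const: "P (config_of E s) = P (config_of E s')" if "s \<in> Q N p" "s' \<in> Q N p" for s s' N p
  proof -
    have s: "s \<in> space ?M" "s' \<in> space ?M" "\<And>e. e \<in> E \<Longrightarrow> fst (s e) = N e" "\<And>e. e \<in> E \<Longrightarrow> fst (s' e) = N e"
      "pat N s = pat N s'" using that by (auto simp: Q_def)
    have E: "{(a, b) \<in> I N \<times> I N. ?T s a < ?T s b} = {(a, b) \<in> I N \<times> I N. ?T s' a < ?T s' b}"
      "{a \<in> I N. ?T s a = 0} = {a \<in> I N. ?T s' a = 0}"
      "{a \<in> I N. sample_type s a = Cross} = {a \<in> I N. sample_type s' a = Cross}"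
      using s(5) unfolding pat_def prod.inject by blast+
    have "\<exists>\<phi>. time_change \<phi> \<and> config_of E s' = transport \<phi> (config_of E s)"
    proof (rule same_pattern_transport[OF fin s(1,2), where N = N])
      show "(?T s a < ?T s b) = (?T s' a < ?T s' b)"
        if "a \<in> Sigma E (\<lambda>e. {..<N e})" "b \<in> Sigma E (\<lambda>e. {..<N e})" for a b
        using arg_cong[OF E(1), of "\<lambda>A. (a, b) \<in> A"] that by (simp add: I_def)
      show "(?T s a = 0) = (?T s' a = 0)" if "a \<in> Sigma E (\<lambda>e. {..<N e})" for a
        using arg_cong[OF E(2), of "\<lambda>A. a \<in> A"] that by (simp add: I_def)
      show "sample_type s a = sample_type s' a" if "a \<in> Sigma E (\<lambda>e. {..<N e})" for a
      proof -
        have "(sample_type s a = Cross) = (sample_type s' a = Cross)"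
          using arg_cong[OF E(3), of "\<lambda>A. a \<in> A"] that by (simp add: I_def)
        then show ?thesis by (metis mark.exhaust)
      qed
    qed (fact s(3), fact s(4))
    then show ?thesis using inv config_of_circle[OF s(1)] by metis
  qed
  have "{s \<in> space ?M. P (config_of E s)} =
    (\<Union>N\<in>E \<rightarrow>\<^sub>E UNIV. \<Union>p\<in>{p \<in> Pats N. \<exists>s\<in>Q N p. P (config_of E s)}. Q N p)"
  proof (intro equalityI subsetI)
    fix s assume s: "s \<in> {s \<in> space ?M. P (config_of E s)}"
    define N where "N = (\<lambda>e\<in>E. fst (s e))"
    have "s \<in> Q N (pat N s)" using s by (simp add: Q_def N_def)
    moreover have "pat N s \<in> Pats N" by (auto simp: pat_def Pats_def)
    moreover have "N \<in> E \<rightarrow>\<^sub>E UNIV" by (simp add: N_def)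
    ultimately show "s \<in> (\<Union>N\<in>E \<rightarrow>\<^sub>E UNIV. \<Union>p\<in>{p \<in> Pats N. \<exists>s\<in>Q N p. P (config_of E s)}. Q N p)"
      using s by blast
  next
    fix s assume "s \<in> (\<Union>N\<in>E \<rightarrow>\<^sub>E UNIV. \<Union>p\<in>{p \<in> Pats N. \<exists>s\<in>Q N p. P (config_of E s)}. Q N p)"
    then obtain N p s' where h: "s \<in> Q N p" "s' \<in> Q N p" "P (config_of E s')" by blast
    have "P (config_of E s)" using const[OF h(1,2)] h(3) by blast
    moreover have "s \<in> space ?M" using h(1) by (simp add: Q_def)
    ultimately show "s \<in> {s \<in> space ?M. P (config_of E s)}" by blast
  qed
  also have "\<dots> \<in> sets ?M"
  proof (rule sets.countable_UN'')
    show "countable (E \<rightarrow>\<^sub>E (UNIV :: nat set))" using fin by (intro countable_PiE) auto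
    show "(\<Union>p\<in>{p \<in> Pats N. \<exists>s\<in>Q N p. P (config_of E s)}. Q N p) \<in> sets ?M" for N
      using finP[of N] Q_meas by (intro sets.finite_UN) auto
  qed
  finally show ?thesis .
qed

section \<open>The law of the word of marks\<close>

definition letter_positions :: "'v word \<Rightarrow> 'v set \<Rightarrow> nat set" where
  "letter_positions w e = {j \<in> {..<length w}. fst (w ! j) = e}"

definition word_weight :: "real \<Rightarrow> 'v word \<Rightarrow> real" where
  "word_weight u w = prod_list (map (\<lambda>l. mark_weight u (snd l)) w)"

lemma finite_letter_positions [simp]: "finite (letter_positions w e)"
  by (simp add: letter_positions_def)

text \<open>The sorted list of the times is determined by the configuration, and the marks at
  these times determine the letters.\<close>

lemma represents_unique:
  assumes "represents \<omega> w" "represents \<omega> w'"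
  shows "w = w'"
proof -
  obtain ts where ts: "length ts = length w" "sorted_wrt (<) ts"
    "\<omega> = (\<lambda>e. {(ts ! j, m) | j m. j < length w \<and> w ! j = (e, m)})"
    using assms(1) unfolding represents_def by blast
  obtain ss where ss: "length ss = length w'" "sorted_wrt (<) ss"
    "\<omega> = (\<lambda>e. {(ss ! j, m) | j m. j < length w' \<and> w' ! j = (e, m)})"
    using assms(2) unfolding represents_def by blast
  have set1: "set ts = {t. \<exists>e m. (t, m) \<in> \<omega> e}"
  proof (intro equalityI subsetI)
    fix t assume "t \<in> set ts"
    then obtain j where "j < length w" "t = ts ! j" using ts(1) by (metis in_set_conv_nth)
    then show "t \<in> {t. \<exists>e m. (t, m) \<in> \<omega> e}"
      unfolding ts(3) by (intro CollectI exI[of _ "fst (w ! j)"] exI[of _ "snd (w ! j)"]) auto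
  next
    fix t assume "t \<in> {t. \<exists>e m. (t, m) \<in> \<omega> e}"
    then show "t \<in> set ts" unfolding ts(3) using ts(1) by auto
  qed
  have set2: "set ss = {t. \<exists>e m. (t, m) \<in> \<omega> e}"
  proof (intro equalityI subsetI)
    fix t assume "t \<in> set ss"
    then obtain j where "j < length w'" "t = ss ! j" using ss(1) by (metis in_set_conv_nth)
    then show "t \<in> {t. \<exists>e m. (t, m) \<in> \<omega> e}"
      unfolding ss(3) by (intro CollectI exI[of _ "fst (w' ! j)"] exI[of _ "snd (w' ! j)"]) auto
  next
    fix t assume "t \<in> {t. \<exists>e m. (t, m) \<in> \<omega> e}"
    then show "t \<in> set ss" unfolding ss(3) using ss(1) by auto
  qed
  have eq: "ts = ss"
    using set1 set2 ts(2) ss(2) by (metis strict_sorted_equal)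
  have dist: "distinct ts" using ts(2) by (simp add: strict_sorted_iff)
  show ?thesis
  proof (rule nth_equalityI)
    show len: "length w = length w'" using eq ts(1) ss(1) by simp
    fix j assume j: "j < length w"
    obtain e m where em: "w' ! j = (e, m)" by (cases "w' ! j")
    then have "(ss ! j, m) \<in> \<omega> e" unfolding ss(3) using j len by auto
    then have "(ts ! j, m) \<in> \<omega> e" using eq by simp
    then obtain i where i: "ts ! j = ts ! i" "i < length w" "w ! i = (e, m)"
      unfolding ts(3) by blast
    then have "i = j" using dist j ts(1) nth_eq_iff_index_eq by metis
    then show "w ! j = w' ! j" using i em by simp
  qed
qed

lemma represents_cong_invariant:
  assumes "\<And>\<phi> \<omega>. time_change \<phi> \<Longrightarrow> circle_config \<omega> \<Longrightarrow> h (transport \<phi> \<omega>) = h \<omega>"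
    and "represents \<omega> w"
  shows "h \<omega> = h (word_config w)"
  using represents_time_change[OF assms(2) represents_padded[of w 0]] assms(1)
  unfolding word_config_def by metis

context loop_graph
begin

text \<open>The marks of a sample on an edge \<open>e\<close> are numbered independently of
  their times. A labelling tells for each edge which number the mark of each occurrence of
  \<open>e\<close> in the word has.\<close>

definition labellings :: "'v word \<Rightarrow> ('v set \<Rightarrow> nat \<Rightarrow> nat) set" where
  "labellings w = (\<Pi>\<^sub>E e\<in>E. {f \<in> letter_positions w e \<rightarrow>\<^sub>E {..<card (letter_positions w e)}.
     inj_on f (letter_positions w e)})"

definition label :: "'v word \<Rightarrow> ('v set \<Rightarrow> nat \<Rightarrow> nat) \<Rightarrow> nat \<Rightarrow> 'v set \<times> nat" where
  "label w \<rho> j = (fst (w ! j), \<rho> (fst (w ! j)) j)"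

definition word_event :: "real \<Rightarrow> real \<Rightarrow> 'v word \<Rightarrow> ('v set \<Rightarrow> nat \<Rightarrow> nat) \<Rightarrow> 'v sample set" where
  "word_event t u w \<rho> = {s \<in> space (config_law E t u).
     (\<forall>e\<in>E. fst (s e) = card (letter_positions w e)) \<and>
     (\<forall>j<length w. sample_type s (label w \<rho> j) = snd (w ! j)) \<and>
     (\<lambda>j\<in>{..<length w}. sample_time s (label w \<rho> j)) \<in> increasing_times (length w) 1}"

lemma letter_in_E:
  assumes "w \<in> words" "j < length w"
  shows "fst (w ! j) \<in> E"
  using assms unfolding words_def by (metis lists_eq_set mem_Collect_eq mem_Times_iff nth_mem subsetD)

lemma labelling_bij:
  assumes "\<rho> \<in> labellings w" "e \<in> E"
  shows "bij_betw (\<rho> e) (letter_positions w e) {..<card (letter_positions w e)}"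
proof -
  have f: "\<rho> e \<in> letter_positions w e \<rightarrow>\<^sub>E {..<card (letter_positions w e)}"
    "inj_on (\<rho> e) (letter_positions w e)"
    using assms unfolding labellings_def by auto
  then have "\<rho> e ` letter_positions w e = {..<card (letter_positions w e)}"
    by (intro card_subset_eq) (auto simp: card_image)
  then show ?thesis using f(2) by (simp add: bij_betw_def)
qed

lemma card_labellings: "card (labellings w) = (\<Prod>e\<in>E. fact (card (letter_positions w e)))"
proof -
  have fallfact: "prod ((-) n) {0..<n} = (fact n :: nat)" for n
    by (simp add: fact_prod_rev)
  have "card {f \<in> letter_positions w e \<rightarrow>\<^sub>E {..<card (letter_positions w e)}.
     inj_on f (letter_positions w e)} = fact (card (letter_positions w e))" for e
    using card_inj_on_subset_funcset[of "letter_positions w e"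
        "{..<card (letter_positions w e)}" "letter_positions w e"] fallfact by simp
  then show ?thesis unfolding labellings_def using finite_E by (simp add: card_PiE)
qed

lemma word_event_represents:
  assumes "w \<in> words" "\<rho> \<in> labellings w" "s \<in> word_event t u w \<rho>"
  shows "represents (config_of E s) w"
proof -
  let ?t = "\<lambda>j. sample_time s (label w \<rho> j)"
  define ts where "ts = map ?t [0..<length w]"
  have s: "\<And>e. e \<in> E \<Longrightarrow> fst (s e) = card (letter_positions w e)"
    "\<And>j. j < length w \<Longrightarrow> sample_type s (label w \<rho> j) = snd (w ! j)"
    "(\<lambda>j\<in>{..<length w}. ?t j) \<in> increasing_times (length w) 1"
    using assms(3) by (auto simp: word_event_def)
  have inc: "0 < ?t j" "?t j < 1" if "j < length w" for j
    using s(3) that by (auto simp: increasing_times_def)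
  have mono: "?t i < ?t j" if "j < length w" "i < j" for i j
    using s(3) that by (auto simp: increasing_times_def)
  have "sorted_wrt (<) ts" unfolding ts_def sorted_wrt_iff_nth_less using mono by auto
  moreover have "set ts \<subseteq> {0<..<1}" using inc by (auto simp: ts_def)
  moreover have "config_of E s = (\<lambda>e. {(ts ! j, m) | j m. j < length w \<and> w ! j = (e, m)})"
  proof
    fix e
    show "config_of E s e = {(ts ! j, m) | j m. j < length w \<and> w ! j = (e, m)}"
    proof (cases "e \<in> E")
      case False
      then have "{(ts ! j, m) | j m. j < length w \<and> w ! j = (e, m)} = {}"
        using letter_in_E[OF assms(1)] by fastforce
      then show ?thesis using False by (simp add: config_of_def)
    next
      case True
      have "config_of E s e = snd (s e) ` (\<rho> e ` letter_positions w e)"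
        using True s(1) labelling_bij[OF assms(2) True] by (simp add: config_of_def bij_betw_def)
      also have "\<dots> = (\<lambda>j. (?t j, snd (w ! j))) ` letter_positions w e"
        unfolding image_image
      proof (rule image_cong[OF refl])
        fix j assume "j \<in> letter_positions w e"
        then have j: "j < length w" "fst (w ! j) = e" by (auto simp: letter_positions_def)
        then show "snd (s e) (\<rho> e j) = (?t j, snd (w ! j))"
          using s(2)[OF j(1)] by (simp add: sample_time_def sample_type_def label_def prod_eq_iff)
      qed
      also have "\<dots> = {(ts ! j, m) | j m. j < length w \<and> w ! j = (e, m)}"
      proof (intro equalityI subsetI)
        fix p assume "p \<in> (\<lambda>j. (?t j, snd (w ! j))) ` letter_positions w e"
        then obtain j where "j < length w" "fst (w ! j) = e" "p = (?t j, snd (w ! j))"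
          by (auto simp: letter_positions_def)
        then show "p \<in> {(ts ! j, m) | j m. j < length w \<and> w ! j = (e, m)}"
          by (intro CollectI exI[of _ j] exI[of _ "snd (w ! j)"]) (auto simp: ts_def)
      next
        fix p assume "p \<in> {(ts ! j, m) | j m. j < length w \<and> w ! j = (e, m)}"
        then obtain j m where "p = (ts ! j, m)" "j < length w" "w ! j = (e, m)" by blast
        then show "p \<in> (\<lambda>j. (?t j, snd (w ! j))) ` letter_positions w e"
          by (intro image_eqI[of _ _ j]) (auto simp: ts_def letter_positions_def)
      qed
      finally show ?thesis .
    qed
  qed
  moreover have "length ts = length w" by (simp add: ts_def)
  ultimately show ?thesis unfolding represents_def by blast
qed

lemma word_event_label_unique:
  assumes "w \<in> words" "\<rho> \<in> labellings w" "\<rho>' \<in> labellings w"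
    and "s \<in> word_event t u w \<rho>" "s \<in> word_event t u w \<rho>'"
  shows "\<rho> = \<rho>'"
proof -
  have mono: "sample_time s (label w \<rho> i) < sample_time s (label w \<rho> j)" if "j < length w" "i < j" for i j
    using assms(4) that by (auto simp: word_event_def increasing_times_def)
  have mono': "sample_time s (label w \<rho>' i) < sample_time s (label w \<rho>' j)" if "j < length w" "i < j" for i j
    using assms(5) that by (auto simp: word_event_def increasing_times_def)
  let ?I = "Sigma E (\<lambda>e. {..<card (letter_positions w e)})"
  have labels: "label w \<sigma> ` {..<length w} = ?I" if \<sigma>: "\<sigma> \<in> labellings w" for \<sigma>
  proof (intro equalityI subsetI)
    fix a assume "a \<in> label w \<sigma> ` {..<length w}"
    then obtain j where j: "j < length w" "a = label w \<sigma> j" by blast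
    have "j \<in> letter_positions w (fst (w ! j))" using j by (simp add: letter_positions_def)
    then show "a \<in> ?I"
      using letter_in_E[OF assms(1) j(1)] labelling_bij[OF \<sigma> letter_in_E[OF assms(1) j(1)]] j
      by (auto simp: label_def bij_betw_def)
  next
    fix a assume "a \<in> ?I"
    then obtain e i where a: "a = (e, i)" "e \<in> E" "i < card (letter_positions w e)" by auto
    have "i \<in> \<sigma> e ` letter_positions w e"
      using labelling_bij[OF \<sigma> a(2)] a(3) by (simp add: bij_betw_def)
    then obtain j where "j \<in> letter_positions w e" "i = \<sigma> e j" by blast
    then show "a \<in> label w \<sigma> ` {..<length w}"
      using a by (intro image_eqI[of _ _ j]) (auto simp: letter_positions_def label_def)
  qed
  let ?ts = "map (\<lambda>j. sample_time s (label w \<rho> j)) [0..<length w]"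
  let ?ss = "map (\<lambda>j. sample_time s (label w \<rho>' j)) [0..<length w]"
  have "set ?ts = sample_time s ` (label w \<rho> ` {..<length w})"
    "set ?ss = sample_time s ` (label w \<rho>' ` {..<length w})"
    by (auto simp: image_image atLeast0LessThan)
  then have "set ?ts = set ?ss" using labels[OF assms(2)] labels[OF assms(3)] by simp
  moreover have "sorted_wrt (<) ?ts" "sorted_wrt (<) ?ss"
    unfolding sorted_wrt_iff_nth_less using mono mono' by auto
  ultimately have "?ts = ?ss" by (metis strict_sorted_equal)
  then have times: "sample_time s (label w \<rho> j) = sample_time s (label w \<rho>' j)" if "j < length w" for j
    using that by (simp only: map_eq_conv set_upt) simp
  have labels_eq: "label w \<rho> j = label w \<rho>' j" if j: "j < length w" for j
  proof -
    have "label w \<rho>' j \<in> label w \<rho> ` {..<length w}" using labels assms(2,3) j by blast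
    then obtain i where i: "i < length w" "label w \<rho>' j = label w \<rho> i" by blast
    have "sample_time s (label w \<rho> i) = sample_time s (label w \<rho> j)" using times[OF j] i by simp
    then have "i = j" using mono[OF i(1), of j] mono[OF j, of i] by (metis linorder_neq_iff order_less_irrefl)
    then show ?thesis using i by simp
  qed
  show ?thesis
  proof (rule PiE_ext[OF assms(2,3)[unfolded labellings_def]])
    fix e assume e: "e \<in> E"
    have "\<rho> e \<in> letter_positions w e \<rightarrow>\<^sub>E {..<card (letter_positions w e)}"
      "\<rho>' e \<in> letter_positions w e \<rightarrow>\<^sub>E {..<card (letter_positions w e)}"
      using assms(2,3) e unfolding labellings_def by auto
    then show "\<rho> e = \<rho>' e"
    proof (rule PiE_ext)
      fix j assume "j \<in> letter_positions w e"
      then show "\<rho> e j = \<rho>' e j" using labels_eq[of j] by (auto simp: letter_positions_def label_def)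
    qed
  qed
qed

lemma measurable_label_time:
  assumes "w \<in> words"
  shows "(\<lambda>s. \<lambda>j\<in>{..<length w}. sample_time s (label w \<rho> j))
    \<in> measurable (config_law E t u) (PiM {..<length w} (\<lambda>_. uniform_time))"
proof (rule measurable_restrict)
  fix j assume "j \<in> {..<length w}"
  then have "fst (w ! j) \<in> E" using letter_in_E[OF assms] by simp
  then have "(\<lambda>s. snd (s (fst (w ! j))) (\<rho> (fst (w ! j)) j)) \<in> measurable (config_law E t u) (mark_measure u)"
    by (rule measurable_sample_mark)
  moreover have "fst \<in> measurable (mark_measure u) uniform_time"
    unfolding mark_measure_def by (rule measurable_fst)
  ultimately show "(\<lambda>s. sample_time s (label w \<rho> j)) \<in> measurable (config_law E t u) uniform_time"
    unfolding sample_time_def label_def fst_conv snd_conv by (rule measurable_compose)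
qed

lemma sets_word_types:
  assumes "w \<in> words"
  shows "{s \<in> space (config_law E t u). (\<forall>e\<in>E. fst (s e) = n e) \<and>
     (\<forall>j<length w. sample_type s (label w \<rho> j) = snd (w ! j))} \<in> sets (config_law E t u)"
proof -
  let ?M = "config_law E t u"
  have 1: "{s \<in> space ?M. fst (s e) = n e} \<in> sets ?M" if "e \<in> E" for e
  proof -
    have "(\<lambda>s. fst (s e)) -` {n e} \<inter> space ?M \<in> sets ?M"
      using measurable_sample_count[OF that] by (rule measurable_sets) simp
    also have "(\<lambda>s. fst (s e)) -` {n e} \<inter> space ?M = {s \<in> space ?M. fst (s e) = n e}" by auto
    finally show ?thesis .
  qed
  have 2: "{s \<in> space ?M. sample_type s (label w \<rho> j) = snd (w ! j)} \<in> sets ?M" if "j < length w" for j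
  proof -
    have "(\<lambda>s. snd (snd (s (fst (w ! j))) (\<rho> (fst (w ! j)) j))) -` {snd (w ! j)} \<inter> space ?M \<in> sets ?M"
      using letter_in_E[OF assms that] by (intro measurable_sets[OF measurable_sample_type]) auto
    also have "(\<lambda>s. snd (snd (s (fst (w ! j))) (\<rho> (fst (w ! j)) j))) -` {snd (w ! j)} \<inter> space ?M
        = {s \<in> space ?M. sample_type s (label w \<rho> j) = snd (w ! j)}"
      by (auto simp: sample_type_def label_def)
    finally show ?thesis .
  qed
  have "{s \<in> space ?M. (\<forall>e\<in>E. fst (s e) = n e) \<and>
     (\<forall>j\<in>{..<length w}. sample_type s (label w \<rho> j) = snd (w ! j))} \<in> sets ?M"
    using 1 2 finite_E by (intro sets.sets_Collect_conj sets.sets_Collect_finite_All) auto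
  then show ?thesis by (simp only: Ball_def lessThan_iff)
qed

text \<open>Counts, types and times of different marks are independent, and the labelling is a
  bijection between the positions in the word and the marks of the sample, so the product over
  the edges rearranges to a product over the positions.\<close>

lemma emeasure_label_box:
  assumes "w \<in> words" "\<rho> \<in> labellings w" "t \<ge> 0" "u \<in> {0..1}"
    and A: "\<And>j. j < length w \<Longrightarrow> A j \<in> sets uniform_time"
  shows "emeasure (config_law E t u) {s \<in> space (config_law E t u).
      (\<forall>e\<in>E. fst (s e) = card (letter_positions w e)) \<and>
      (\<forall>j<length w. sample_type s (label w \<rho> j) = snd (w ! j)) \<and>
      (\<forall>j<length w. sample_time s (label w \<rho> j) \<in> A j)} =
    (\<Prod>e\<in>E. ennreal (pmf (poisson0_pmf t) (card (letter_positions w e)))) *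
    (\<Prod>j<length w. emeasure uniform_time (A j) * ennreal (mark_weight u (snd (w ! j))))"
    (is "emeasure ?M ?B = _")
proof -
  let ?n = "\<lambda>e. card (letter_positions w e)" and ?J = "letter_positions w"
  define inv where "inv e = the_inv_into (?J e) (\<rho> e)" for e
  define C where "C e i = A (inv e i) \<times> {snd (w ! inv e i)}" for e i
  let ?X = "\<Pi>\<^sub>M i\<in>(UNIV :: nat set). mark_measure u"
  define Box where "Box e = {x \<in> space ?X. \<forall>i\<in>{..<?n e}. x i \<in> C e i}" for e
  have inv: "inv e (\<rho> e j) = j" if "e \<in> E" "j \<in> ?J e" for e j
    unfolding inv_def using labelling_bij[OF assms(2) that(1)] that(2)
    by (simp add: bij_betw_def the_inv_into_f_f)
  have C\<rho>: "C e (\<rho> e j) = A j \<times> {snd (w ! j)}" if "e \<in> E" "j \<in> ?J e" for e j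
    using inv[OF that] by (simp add: C_def)
  have C_sets: "C e i \<in> sets (mark_measure u)" if e: "e \<in> E" and i: "i < ?n e" for e i
  proof -
    obtain j where j: "j \<in> ?J e" "i = \<rho> e j"
      using labelling_bij[OF assms(2) e] i by (auto simp: bij_betw_def)
    have "A j \<in> sets uniform_time" using A j by (simp add: letter_positions_def)
    then show ?thesis unfolding j(2) C\<rho>[OF e j(1)] mark_measure_def by simp
  qed
  have B: "?B = (\<Pi>\<^sub>E e\<in>E. {?n e} \<times> Box e)"
  proof (intro equalityI subsetI)
    fix s assume s: "s \<in> ?B"
    show "s \<in> (\<Pi>\<^sub>E e\<in>E. {?n e} \<times> Box e)"
    proof (rule PiE_I)
      fix e assume e: "e \<in> E"
      have "s \<in> E \<rightarrow>\<^sub>E UNIV \<times> (UNIV \<rightarrow>\<^sub>E {0..<1} \<times> UNIV)"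
        using s by (simp only: space_config_law mem_Collect_eq)
      then have "s e \<in> UNIV \<times> (UNIV \<rightarrow>\<^sub>E {0..<1} \<times> UNIV)" using e by (rule PiE_mem)
      then have "snd (s e) \<in> space ?X"
        by (simp only: space_PiM space_mark_measure mem_Times_iff)
      moreover have "snd (s e) i \<in> C e i" if i: "i < ?n e" for i
      proof -
        obtain j where j: "j \<in> ?J e" "i = \<rho> e j"
          using labelling_bij[OF assms(2) e] i by (auto simp: bij_betw_def)
        then have "j < length w" "fst (w ! j) = e" by (auto simp: letter_positions_def)
        then show ?thesis unfolding j(2) C\<rho>[OF e j(1)]
          using s by (auto simp: sample_time_def sample_type_def label_def mem_Times_iff)
      qed
      ultimately show "s e \<in> {?n e} \<times> Box e" using s e by (auto simp: Box_def mem_Times_iff)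
    next
      fix e assume "e \<notin> E"
      then show "s e = undefined" using s unfolding space_config_law by (auto simp: PiE_def extensional_def)
    qed
  next
    fix s assume s: "s \<in> (\<Pi>\<^sub>E e\<in>E. {?n e} \<times> Box e)"
    have Box_sub: "Box e \<subseteq> UNIV \<rightarrow>\<^sub>E {0..<1} \<times> UNIV" for e
      unfolding Box_def space_PiM space_mark_measure by (rule Collect_restrict)
    have "(\<Pi>\<^sub>E e\<in>E. {?n e} \<times> Box e) \<subseteq> E \<rightarrow>\<^sub>E UNIV \<times> (UNIV \<rightarrow>\<^sub>E {0..<1} \<times> UNIV)"
      by (intro PiE_mono Sigma_mono subset_UNIV Box_sub)
    then have sp: "s \<in> space ?M" unfolding space_config_law using s by (rule subsetD)
    have "snd (s (fst (w ! j))) (\<rho> (fst (w ! j)) j) \<in> A j \<times> {snd (w ! j)}" if j: "j < length w" for j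
    proof -
      let ?e = "fst (w ! j)"
      have e: "?e \<in> E" by (rule letter_in_E[OF assms(1) j])
      have J: "j \<in> ?J ?e" using j by (simp add: letter_positions_def)
      have "\<rho> ?e j < ?n ?e" using labelling_bij[OF assms(2) e] J by (auto simp: bij_betw_def)
      then have "snd (s ?e) (\<rho> ?e j) \<in> C ?e (\<rho> ?e j)"
        using PiE_mem[OF s e] unfolding Box_def by (auto simp: mem_Times_iff)
      then show ?thesis unfolding C\<rho>[OF e J] .
    qed
    then show "s \<in> ?B"
      using sp s by (auto simp: sample_time_def sample_type_def label_def mem_Times_iff PiE_iff)
  qed
  interpret mm: prob_space "mark_measure u" by (rule prob_space_mark_measure)
  interpret X: product_prob_space "\<lambda>_. mark_measure u" "UNIV :: nat set" ..
  interpret pp: prob_space "poisson_process t u" by (rule prob_space_poisson_process)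
  interpret PP: product_sigma_finite "\<lambda>_ :: 'v set. poisson_process t u" ..
  have Box_sets: "Box e \<in> sets ?X" if "e \<in> E" for e
    unfolding Box_def
  proof (rule sets.sets_Collect_finite_All)
    fix i assume "i \<in> {..<?n e}"
    then have "(\<lambda>x. x i) -` C e i \<inter> space ?X \<in> sets ?X"
      using C_sets[OF \<open>e \<in> E\<close>] by (intro measurable_sets[OF measurable_component_singleton]) auto
    also have "(\<lambda>x. x i) -` C e i \<inter> space ?X = {x \<in> space ?X. x i \<in> C e i}" by auto
    finally show "{x \<in> space ?X. x i \<in> C e i} \<in> sets ?X" .
  qed simp
  have Box_measure: "emeasure ?X (Box e) =
      (\<Prod>j\<in>?J e. emeasure uniform_time (A j) * ennreal (mark_weight u (snd (w ! j))))" if e: "e \<in> E" for e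
  proof -
    have "emeasure ?X (Box e) = (\<Prod>i<?n e. emeasure (mark_measure u) (C e i))"
      unfolding Box_def using C_sets[OF e] by (intro X.emeasure_PiM_Collect) auto
    also have "\<dots> = (\<Prod>j\<in>?J e. emeasure (mark_measure u) (C e (\<rho> e j)))"
      by (rule prod.reindex_bij_betw[OF labelling_bij[OF assms(2) e], symmetric])
    also have "\<dots> = (\<Prod>j\<in>?J e. emeasure uniform_time (A j) * ennreal (mark_weight u (snd (w ! j))))"
      using C\<rho>[OF e] A assms(4)
      by (intro prod.cong) (auto simp: emeasure_mark_measure letter_positions_def)
    finally show ?thesis .
  qed
  have "emeasure ?M ?B = (\<Prod>e\<in>E. emeasure (poisson_process t u) ({?n e} \<times> Box e))"
    unfolding B unfolding config_law_def
    by (rule PP.emeasure_PiM[OF finite_E]) (use Box_sets in \<open>auto simp: poisson_process_def\<close>)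
  also have "\<dots> = (\<Prod>e\<in>E. ennreal (pmf (poisson0_pmf t) (?n e)) *
      (\<Prod>j\<in>?J e. emeasure uniform_time (A j) * ennreal (mark_weight u (snd (w ! j)))))"
  proof (rule prod.cong[OF refl])
    fix e assume e: "e \<in> E"
    show "emeasure (poisson_process t u) ({?n e} \<times> Box e) = ennreal (pmf (poisson0_pmf t) (?n e)) *
      (\<Prod>j\<in>?J e. emeasure uniform_time (A j) * ennreal (mark_weight u (snd (w ! j))))"
      unfolding poisson_process_def using Box_sets[OF e] Box_measure[OF e]
      by (subst sigma_finite_measure.emeasure_pair_measure_Times[OF
            prob_space_imp_sigma_finite[OF prob_space_marks]]) (auto simp: emeasure_pmf_single)
  qed
  also have "\<dots> = (\<Prod>e\<in>E. ennreal (pmf (poisson0_pmf t) (?n e))) *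
      (\<Prod>e\<in>E. \<Prod>j\<in>?J e. emeasure uniform_time (A j) * ennreal (mark_weight u (snd (w ! j))))"
    by (rule prod.distrib)
  also have "(\<Prod>e\<in>E. \<Prod>j\<in>?J e. emeasure uniform_time (A j) * ennreal (mark_weight u (snd (w ! j)))) =
      (\<Prod>j<length w. emeasure uniform_time (A j) * ennreal (mark_weight u (snd (w ! j))))"
    unfolding letter_positions_def
    by (rule prod.group) (use finite_E letter_in_E[OF assms(1)] in auto)
  finally show ?thesis .
qed

text \<open>By \<open>emeasure_label_box\<close>, on the event that the counts and types fit the
  word, the times of its letters are distributed as independent uniform times, up to a constant
  factor. They are in increasing order with probability \<open>1 / k!\<close>.\<close>

lemma emeasure_word_event:
  assumes "w \<in> words" "\<rho> \<in> labellings w" "t \<ge> 0" "u \<in> {0..1}"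
  shows "word_event t u w \<rho> \<in> sets (config_law E t u)"
    and "emeasure (config_law E t u) (word_event t u w \<rho>) =
      (\<Prod>e\<in>E. ennreal (pmf (poisson0_pmf t) (card (letter_positions w e)))) *
      (\<Prod>j<length w. ennreal (mark_weight u (snd (w ! j)))) * ennreal (1 / fact (length w))"
proof -
  let ?M = "config_law E t u" and ?k = "length w"
  let ?U = "PiM {..<?k} (\<lambda>_. uniform_time)"
  define Q where "Q = {s \<in> space ?M. (\<forall>e\<in>E. fst (s e) = card (letter_positions w e)) \<and>
     (\<forall>j<length w. sample_type s (label w \<rho> j) = snd (w ! j))}"
  define T where "T s = (\<lambda>j\<in>{..<?k}. sample_time s (label w \<rho> j))" for s :: "'v sample"
  have Q: "Q \<in> sets ?M" unfolding Q_def by (rule sets_word_types[OF assms(1)])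
  have T: "T \<in> measurable ?M ?U" unfolding T_def by (rule measurable_label_time[OF assms(1)])
  have event: "word_event t u w \<rho> = Q \<inter> (T -` increasing_times ?k 1 \<inter> space ?M)"
    by (auto simp: word_event_def Q_def T_def)
  show "word_event t u w \<rho> \<in> sets ?M"
    unfolding event using Q measurable_sets[OF T sets_increasing_times] by auto
  define c where "c = (\<Prod>e\<in>E. ennreal (pmf (poisson0_pmf t) (card (letter_positions w e)))) *
      (\<Prod>j<?k. ennreal (mark_weight u (snd (w ! j))))"
  define \<mu> where "\<mu> = distr (density ?M (indicator Q)) ?U T"
  have \<mu>: "emeasure \<mu> X = emeasure ?M (Q \<inter> (T -` X \<inter> space ?M))" if "X \<in> sets ?U" for X
    unfolding \<mu>_def using T Q that measurable_sets[OF T that]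
    by (subst emeasure_distr) (auto simp: emeasure_restricted)
  interpret M: prob_space ?M by (rule prob_space_config_law)
  interpret ut: prob_space uniform_time by (rule prob_space_uniform_time)
  interpret UT: product_sigma_finite "\<lambda>_ :: nat. uniform_time" ..
  \<comment> \<open>Both measures agree on boxes.\<close>
  have "\<mu> = density ?U (\<lambda>_. c)"
  proof (rule measure_eqI_PiM_finite)
    show "finite {..<?k}" by simp
    show "sets \<mu> = sets ?U" "sets (density ?U (\<lambda>_. c)) = sets ?U" by (simp_all add: \<mu>_def)
    fix A assume A: "\<And>j. j \<in> {..<?k} \<Longrightarrow> A j \<in> sets uniform_time"
    have "Pi\<^sub>E {..<?k} A \<in> sets ?U" using A by (intro sets_PiM_I_finite) auto
    then have "emeasure \<mu> (Pi\<^sub>E {..<?k} A) = emeasure ?M (Q \<inter> (T -` Pi\<^sub>E {..<?k} A \<inter> space ?M))"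
      by (rule \<mu>)
    also have "Q \<inter> (T -` Pi\<^sub>E {..<?k} A \<inter> space ?M) = {s \<in> space ?M.
      (\<forall>e\<in>E. fst (s e) = card (letter_positions w e)) \<and>
      (\<forall>j<length w. sample_type s (label w \<rho> j) = snd (w ! j)) \<and>
      (\<forall>j<length w. sample_time s (label w \<rho> j) \<in> A j)}"
      unfolding Q_def T_def by (auto simp: PiE_iff)
    also have "emeasure ?M \<dots> = (\<Prod>e\<in>E. ennreal (pmf (poisson0_pmf t) (card (letter_positions w e)))) *
      (\<Prod>j<length w. emeasure uniform_time (A j) * ennreal (mark_weight u (snd (w ! j))))"
      using A by (intro emeasure_label_box assms) auto
    also have "\<dots> = c * (\<Prod>j<?k. emeasure uniform_time (A j))"
      unfolding c_def prod.distrib by (simp add: mult_ac)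
    also have "(\<Prod>j<?k. emeasure uniform_time (A j)) = emeasure ?U (Pi\<^sub>E {..<?k} A)"
      using A by (subst UT.emeasure_PiM) auto
    also have "c * \<dots> = emeasure (density ?U (\<lambda>_. c)) (Pi\<^sub>E {..<?k} A)"
      using \<open>Pi\<^sub>E {..<?k} A \<in> sets ?U\<close> by (simp add: emeasure_density_const)
    finally show "emeasure \<mu> (Pi\<^sub>E {..<?k} A) = emeasure (density ?U (\<lambda>_. c)) (Pi\<^sub>E {..<?k} A)" .
  next
    show "range (\<lambda>_ :: nat. space ?U) \<subseteq> prod_algebra {..<?k} (\<lambda>_. uniform_time)"
    proof (rule image_subsetI)
      show "space ?U \<in> prod_algebra {..<?k} (\<lambda>_. uniform_time)"
        unfolding space_PiM by (rule prod_algebraI_finite[OF finite_lessThan]) (rule ballI, rule sets.top)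
    qed
    fix i :: nat
    have "emeasure \<mu> (space ?U) = emeasure ?M (Q \<inter> (T -` space ?U \<inter> space ?M))" by (rule \<mu>) simp
    also have "\<dots> \<le> 1" by (rule M.emeasure_le_1)
    finally show "emeasure \<mu> (space ?U) \<noteq> \<infinity>" by (auto simp: top_unique)
  qed auto
  then have "emeasure \<mu> (increasing_times ?k 1) = c * emeasure ?U (increasing_times ?k 1)"
    by (simp add: emeasure_density_const)
  then show "emeasure ?M (word_event t u w \<rho>) =
      (\<Prod>e\<in>E. ennreal (pmf (poisson0_pmf t) (card (letter_positions w e)))) *
      (\<Prod>j<length w. ennreal (mark_weight u (snd (w ! j)))) * ennreal (1 / fact (length w))"
    unfolding event \<mu>[OF sets_increasing_times] c_def by (simp add: emeasure_increasing_times)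
qed

lemma word_weight_nonneg: "u \<in> {0..1} \<Longrightarrow> 0 \<le> word_weight u w"
  unfolding word_weight_def
  by (intro prod_list_nonneg) (auto simp: mark_weight_def split: mark.splits)

lemma sum_letter_positions:
  assumes "w \<in> words"
  shows "(\<Sum>e\<in>E. card (letter_positions w e)) = length w"
proof -
  have "(\<Sum>e\<in>E. \<Sum>j\<in>letter_positions w e. 1) = (\<Sum>j\<in>{..<length w}. 1 :: nat)"
    unfolding letter_positions_def
    by (rule sum.group) (use finite_E letter_in_E[OF assms] in auto)
  then show ?thesis by simp
qed

text \<open>The number of labellings cancels the factorials in the Poisson weights.\<close>

lemma sum_emeasure_word_event:
  assumes "w \<in> words" "t \<ge> 0" "u \<in> {0..1}"
  shows "(\<Sum>\<rho>\<in>labellings w. emeasure (config_law E t u) (word_event t u w \<rho>)) =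
    ennreal (exp (- t * card E) * (t ^ length w / fact (length w) * word_weight u w))"
proof -
  let ?n = "\<lambda>e. card (letter_positions w e)" and ?k = "length w"
  have mw: "mark_weight u m \<ge> 0" for m using assms(3) by (auto simp: mark_weight_def split: mark.splits)
  have "(\<Prod>j<?k. mark_weight u (snd (w ! j))) = word_weight u w"
    unfolding word_weight_def by (simp add: prod.list_conv_set_nth atLeast0LessThan)
  then have "(\<Prod>e\<in>E. ennreal (pmf (poisson0_pmf t) (?n e))) *
      (\<Prod>j<?k. ennreal (mark_weight u (snd (w ! j)))) * ennreal (1 / fact ?k) =
      ennreal ((\<Prod>e\<in>E. pmf (poisson0_pmf t) (?n e)) * word_weight u w * (1 / fact ?k))"
    using mw word_weight_nonneg[OF assms(3), of w]
    by (simp add: prod_ennreal ennreal_mult[symmetric] prod_nonneg)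
  then have "(\<Sum>\<rho>\<in>labellings w. emeasure (config_law E t u) (word_event t u w \<rho>)) =
      of_nat (card (labellings w)) * ennreal ((\<Prod>e\<in>E. pmf (poisson0_pmf t) (?n e)) * word_weight u w * (1 / fact ?k))"
    using emeasure_word_event(2)[OF assms(1) _ assms(2,3)] by simp
  also have "\<dots> = ennreal (real (card (labellings w)) *
      ((\<Prod>e\<in>E. pmf (poisson0_pmf t) (?n e)) * word_weight u w * (1 / fact ?k)))"
    by (simp only: ennreal_mult'[OF of_nat_0_le_iff] ennreal_of_nat_eq_real_of_nat)
  also have "real (card (labellings w)) * ((\<Prod>e\<in>E. pmf (poisson0_pmf t) (?n e)) * word_weight u w * (1 / fact ?k))
     = (\<Prod>e\<in>E. fact (?n e) * pmf (poisson0_pmf t) (?n e)) * (word_weight u w / fact ?k)"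
    unfolding card_labellings prod.distrib by simp
  also have "(\<Prod>e\<in>E. fact (?n e) * pmf (poisson0_pmf t) (?n e)) = (\<Prod>e\<in>E. t ^ ?n e * exp (- t))"
    using assms(2) by (intro prod.cong) (auto simp: pmf_poisson0)
  also have "\<dots> = t ^ (\<Sum>e\<in>E. ?n e) * exp (- t) ^ card E"
    by (simp add: prod.distrib power_sum)
  also have "\<dots> = t ^ ?k * exp (- t * card E)"
    by (simp add: sum_letter_positions[OF assms(1)] exp_of_nat_mult[symmetric] mult.commute)
  finally show ?thesis by (simp add: mult_ac)
qed

definition words_of :: "nat \<Rightarrow> 'v word set" where
  "words_of k = {w \<in> words. length w = k}"

lemma finite_words_of: "finite (words_of k)"
proof -
  have "words_of k = {w. set w \<subseteq> E \<times> UNIV \<and> length w = k}"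
    by (auto simp: words_of_def words_def)
  then show ?thesis using finite_E by (simp add: finite_lists_length_eq)
qed

lemma words_of_0: "words_of 0 = {[]}"
  by (auto simp: words_of_def words_def)

lemma sum_words_Suc:
  "(\<Sum>w\<in>words_of (Suc k). F w) = (\<Sum>w\<in>words_of k. \<Sum>e\<in>E. \<Sum>m\<in>UNIV. F (w @ [(e, m)]))"
proof -
  have "words_of (Suc k) = (\<lambda>(w, l). w @ [l]) ` (words_of k \<times> (E \<times> UNIV))"
  proof (intro equalityI subsetI)
    fix w assume w: "w \<in> words_of (Suc k)"
    then have "w \<noteq> []" by (auto simp: words_of_def)
    then have "w = butlast w @ [last w]" by simp
    moreover have "last w \<in> E \<times> UNIV" "butlast w \<in> words_of k"
      using w \<open>w \<noteq> []\<close> by (auto simp: words_of_def words_def dest: in_set_butlastD)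
    ultimately show "w \<in> (\<lambda>(w, l). w @ [l]) ` (words_of k \<times> (E \<times> UNIV))"
      by (intro image_eqI[of _ _ "(butlast w, last w)"]) auto
  qed (auto simp: words_of_def words_def)
  moreover have "inj_on (\<lambda>(w, l). w @ [l]) (words_of k \<times> (E \<times> UNIV))" by (auto simp: inj_on_def)
  ultimately have "(\<Sum>w\<in>words_of (Suc k). F w) = (\<Sum>(w, l)\<in>words_of k \<times> (E \<times> UNIV). F (w @ [l]))"
    by (simp add: sum.reindex case_prod_unfold)
  also have "\<dots> = (\<Sum>w\<in>words_of k. \<Sum>l\<in>E \<times> UNIV. F (w @ [l]))"
    by (simp add: sum.cartesian_product)
  also have "\<dots> = (\<Sum>w\<in>words_of k. \<Sum>e\<in>E. \<Sum>m\<in>UNIV. F (w @ [(e, m)]))"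
    by (simp add: sum.cartesian_product)
  finally show ?thesis .
qed

lemma word_weight_append: "word_weight u (w @ w') = word_weight u w * word_weight u w'"
  by (simp add: word_weight_def)

lemma sum_word_weight: "(\<Sum>w\<in>words_of k. word_weight u w) = real (card E) ^ k"
proof (induction k)
  case 0
  then show ?case by (simp add: words_of_0 word_weight_def)
next
  case (Suc k)
  have "(\<Sum>w\<in>words_of (Suc k). word_weight u w) = (\<Sum>w\<in>words_of k. \<Sum>e\<in>E. word_weight u w)"
    unfolding sum_words_Suc
    by (intro sum.cong refl) (simp add: word_weight_append sum_mark word_weight_def mark_weight_def algebra_simps)
  then show ?case using Suc by (simp add: sum_distrib_left[symmetric])
qed

text \<open>The events \<^const>\<open>word_event\<close> are disjoint, and their probabilities
  add up to \<open>1\<close> by the exponential series; hence almost every sample belongs to one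
  of them.\<close>

theorem nn_integral_config_law:
  fixes h :: "'v config \<Rightarrow> ennreal"
  assumes "t \<ge> 0" "u \<in> {0..1}"
    and inv: "\<And>\<phi> \<omega>. time_change \<phi> \<Longrightarrow> circle_config \<omega> \<Longrightarrow> h (transport \<phi> \<omega>) = h \<omega>"
  shows "(\<lambda>s. h (config_of E s)) \<in> borel_measurable (config_law E t u)"
    and "(\<integral>\<^sup>+ s. h (config_of E s) \<partial>config_law E t u) =
      (\<Sum>k. \<Sum>w\<in>words_of k. h (word_config w) *
         ennreal (exp (- t * card E) * (t ^ k / fact k * word_weight u w)))"
proof -
  let ?M = "config_law E t u" and ?g = "\<lambda>s. h (config_of E s)"
  interpret M: prob_space ?M by (rule prob_space_config_law)
  show meas: "?g \<in> borel_measurable ?M"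
  proof (rule measurableI)
    fix A :: "ennreal set"
    have "{s \<in> space ?M. h (config_of E s) \<in> A} \<in> sets ?M"
      by (rule measurable_invariant[OF finite_E]) (simp add: inv)
    moreover have "?g -` A \<inter> space ?M = {s \<in> space ?M. h (config_of E s) \<in> A}" by auto
    ultimately show "?g -` A \<inter> space ?M \<in> sets ?M" by simp
  qed simp
  define idx where "idx k = Sigma (words_of k) labellings" for k
  define ev where "ev = (\<lambda>(w, \<rho>). word_event t u w \<rho>)"
  define Ev where "Ev k = (\<Union>i\<in>idx k. ev i)" for k
  have fin_lab: "finite (labellings w)" for w
  proof -
    have "finite (letter_positions w e \<rightarrow>\<^sub>E {..<card (letter_positions w e)})" for e
      by (intro finite_PiE) auto
    then have "finite {f \<in> letter_positions w e \<rightarrow>\<^sub>E {..<card (letter_positions w e)}.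
        inj_on f (letter_positions w e)}" for e
      by (rule finite_subset[rotated]) auto
    then show ?thesis unfolding labellings_def using finite_E by (intro finite_PiE) auto
  qed
  have fin: "finite (idx k)" for k using finite_words_of fin_lab by (simp add: idx_def)
  have wI: "w \<in> words" if "(w, \<rho>) \<in> idx k" for w \<rho> k using that by (simp add: idx_def words_of_def)
  have ev_sets: "ev i \<in> sets ?M" if "i \<in> idx k" for i k
    using that emeasure_word_event(1)[OF _ _ assms(1,2)] by (auto simp: ev_def idx_def words_of_def)
  have unique: "i = i' \<and> k = k'" if "i \<in> idx k" "i' \<in> idx k'" "s \<in> ev i" "s \<in> ev i'" for i i' k k' s
  proof -
    obtain w \<rho> w' \<rho>' where i: "i = (w, \<rho>)" "i' = (w', \<rho>')" by (cases i, cases i')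
    have h: "w \<in> words" "\<rho> \<in> labellings w" "w' \<in> words" "\<rho>' \<in> labellings w'" "length w = k" "length w' = k'"
      using that i by (auto simp: idx_def words_of_def)
    have s: "s \<in> word_event t u w \<rho>" "s \<in> word_event t u w' \<rho>'" using that i by (auto simp: ev_def)
    have "w = w'"
      by (rule represents_unique[OF word_event_represents[OF h(1,2) s(1)] word_event_represents[OF h(3,4) s(2)]])
    moreover from this have "\<rho> = \<rho>'"
      using word_event_label_unique[OF h(1,2) _ s(1)] h s by simp
    ultimately show ?thesis using i h by simp
  qed
  have disj: "disjoint_family_on ev (idx k)" for k
    unfolding disjoint_family_on_def using unique by blast
  have Ev_sets: "Ev k \<in> sets ?M" for k unfolding Ev_def using fin ev_sets by (intro sets.finite_UN) auto
  have Ev_disj: "disjoint_family Ev"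
    unfolding disjoint_family_on_def Ev_def using unique by blast
  have ev_sum: "(\<Sum>(w, \<rho>)\<in>idx k. H w * emeasure ?M (word_event t u w \<rho>)) =
      (\<Sum>w\<in>words_of k. H w * ennreal (exp (- t * card E) * (t ^ k / fact k * word_weight u w)))" for k H
  proof -
    have "(\<Sum>(w, \<rho>)\<in>idx k. H w * emeasure ?M (word_event t u w \<rho>)) =
        (\<Sum>w\<in>words_of k. \<Sum>\<rho>\<in>labellings w. H w * emeasure ?M (word_event t u w \<rho>))"
      unfolding idx_def by (rule sum.Sigma[symmetric]) (use finite_words_of fin_lab in auto)
    also have "\<dots> = (\<Sum>w\<in>words_of k. H w * ennreal (exp (- t * card E) * (t ^ k / fact k * word_weight u w)))"
      unfolding sum_distrib_left[symmetric]
      using sum_emeasure_word_event[OF _ assms(1,2)] by (intro sum.cong refl) (auto simp: words_of_def)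
    finally show ?thesis .
  qed
  have "emeasure ?M (Ev k) = ennreal (exp (- t * card E) * ((t * card E) ^ k / fact k))" for k
  proof -
    have "emeasure ?M (Ev k) = (\<Sum>i\<in>idx k. emeasure ?M (ev i))"
      unfolding Ev_def by (rule sum_emeasure[symmetric]) (use fin ev_sets disj in auto)
    also have "\<dots> = (\<Sum>(w, \<rho>)\<in>idx k. 1 * emeasure ?M (word_event t u w \<rho>))"
      by (intro sum.cong) (auto simp: ev_def)
    also have "\<dots> = (\<Sum>w\<in>words_of k. ennreal (exp (- t * card E) * (t ^ k / fact k * word_weight u w)))"
      unfolding ev_sum by simp
    also have "\<dots> = ennreal (\<Sum>w\<in>words_of k. exp (- t * card E) * (t ^ k / fact k * word_weight u w))"
      using assms(1) word_weight_nonneg[OF assms(2)]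
      by (intro sum_ennreal mult_nonneg_nonneg divide_nonneg_nonneg) auto
    also have "(\<Sum>w\<in>words_of k. exp (- t * card E) * (t ^ k / fact k * word_weight u w)) =
        exp (- t * card E) * ((t * card E) ^ k / fact k)"
      unfolding sum_distrib_left[symmetric] sum_word_weight by (simp add: power_mult_distrib)
    finally show ?thesis .
  qed
  moreover have "(\<Sum>k. ennreal (exp (- t * card E) * ((t * card E) ^ k / fact k))) = ennreal 1"
  proof (rule suminf_ennreal_eq)
    have "(\<lambda>k. (t * card E) ^ k / fact k) sums exp (t * card E)"
      using exp_converges[of "t * card E"] by (simp add: divide_inverse mult.commute)
    from sums_mult[OF this, of "exp (- t * card E)"]
    show "(\<lambda>k. exp (- t * card E) * ((t * card E) ^ k / fact k)) sums 1"
      by (simp add: exp_minus_inverse mult.commute flip: exp_add)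
  qed (use assms in auto)
  ultimately have "emeasure ?M (\<Union>k. Ev k) = 1"
    using suminf_emeasure[of Ev ?M] Ev_sets Ev_disj by auto
  then have AE: "AE s in ?M. s \<in> (\<Union>k. Ev k)"
    by (intro M.AE_in_set_eq_1[THEN iffD2]) (use Ev_sets in \<open>auto simp: M.emeasure_eq_measure\<close>)
  have "(\<integral>\<^sup>+ s. ?g s \<partial>?M) = (\<integral>\<^sup>+ s \<in> (\<Union>k. Ev k). ?g s \<partial>?M)"
    by (rule nn_integral_cong_AE) (use AE in \<open>auto simp: indicator_def\<close>)
  also have "\<dots> = (\<Sum>k. \<integral>\<^sup>+ s \<in> Ev k. ?g s \<partial>?M)"
    by (rule nn_integral_disjoint_family[OF meas Ev_sets Ev_disj])
  also have "\<dots> = (\<Sum>k. \<Sum>w\<in>words_of k. h (word_config w) *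
         ennreal (exp (- t * card E) * (t ^ k / fact k * word_weight u w)))"
  proof (rule suminf_cong)
    fix k
    have "(\<integral>\<^sup>+ s \<in> Ev k. ?g s \<partial>?M) = (\<integral>\<^sup>+ s. (\<Sum>i\<in>idx k. h (word_config (fst i)) * indicator (ev i) s) \<partial>?M)"
    proof (rule nn_integral_cong)
      fix s
      have "?g s * indicator (Ev k) s = (\<Sum>i\<in>idx k. ?g s * indicator (ev i) s)"
        unfolding Ev_def indicator_UN_disjoint[OF fin disj] by (rule sum_distrib_left)
      also have "\<dots> = (\<Sum>i\<in>idx k. h (word_config (fst i)) * indicator (ev i) s)"
      proof (rule sum.cong[OF refl])
        fix i assume i: "i \<in> idx k"
        obtain w \<rho> where w: "i = (w, \<rho>)" by (cases i)
        show "?g s * indicator (ev i) s = h (word_config (fst i)) * indicator (ev i) s"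
        proof (cases "s \<in> ev i")
          case True
          then have "s \<in> word_event t u w \<rho>" by (simp add: ev_def w)
          then have "represents (config_of E s) w"
            using i w by (intro word_event_represents) (auto simp: idx_def words_of_def)
          then have "?g s = h (word_config w)" using inv represents_cong_invariant[of h] by blast
          then show ?thesis by (simp add: w)
        qed simp
      qed
      finally show "?g s * indicator (Ev k) s = (\<Sum>i\<in>idx k. h (word_config (fst i)) * indicator (ev i) s)" .
    qed
    also have "\<dots> = (\<Sum>i\<in>idx k. \<integral>\<^sup>+ s. h (word_config (fst i)) * indicator (ev i) s \<partial>?M)"
      by (rule nn_integral_sum) (use ev_sets in auto)
    also have "\<dots> = (\<Sum>i\<in>idx k. h (word_config (fst i)) * emeasure ?M (ev i))"
      using ev_sets by (intro sum.cong refl) (simp add: nn_integral_cmult_indicator)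
    also have "\<dots> = (\<Sum>(w, \<rho>)\<in>idx k. h (word_config w) * emeasure ?M (word_event t u w \<rho>))"
      by (intro sum.cong) (auto simp: ev_def)
    also have "\<dots> = (\<Sum>w\<in>words_of k. h (word_config w) *
         ennreal (exp (- t * card E) * (t ^ k / fact k * word_weight u w)))" by (rule ev_sum)
    finally show "(\<integral>\<^sup>+ s \<in> Ev k. ?g s \<partial>?M) = (\<Sum>w\<in>words_of k. h (word_config w) *
         ennreal (exp (- t * card E) * (t ^ k / fact k * word_weight u w)))" .
  qed
  finally show "(\<integral>\<^sup>+ s. h (config_of E s) \<partial>config_law E t u) =
      (\<Sum>k. \<Sum>w\<in>words_of k. h (word_config w) *
         ennreal (exp (- t * card E) * (t ^ k / fact k * word_weight u w)))" .
qed

end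

section \<open>Series over words and the growth of the partition function\<close>

locale weighted_loop_graph = loop_graph V E for V :: "'v set" and E +
  fixes u \<theta> :: real
  assumes u: "u \<in> {0..1}" and \<theta>: "\<theta> > 0"
begin

abbreviation m :: real where "m \<equiv> real (card E)"

definition word_sum :: "('v word \<Rightarrow> real) \<Rightarrow> nat \<Rightarrow> real" where
  "word_sum f k = (\<Sum>w\<in>words_of k. word_weight u w * f w)"

definition word_series :: "('v word \<Rightarrow> real) \<Rightarrow> real \<Rightarrow> real" where
  "word_series f t = (\<Sum>k. word_sum f k / fact k * t ^ k)"

text \<open>This growth condition makes the series converge on the whole line.\<close>

definition exp_bounded :: "('v word \<Rightarrow> real) \<Rightarrow> bool" where
  "exp_bounded f \<longleftrightarrow> (\<exists>C\<ge>0. \<exists>B\<ge>0. \<forall>w\<in>words. \<bar>f w\<bar> \<le> C * B ^ length w)"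

lemma exp_boundedI:
  "0 \<le> C \<Longrightarrow> 0 \<le> B \<Longrightarrow> (\<And>w. w \<in> words \<Longrightarrow> \<bar>f w\<bar> \<le> C * B ^ length w) \<Longrightarrow> exp_bounded f"
  unfolding exp_bounded_def by blast

text \<open>The operator on functions of words that corresponds to differentiation of the
  series.\<close>

definition append_letter :: "('v word \<Rightarrow> real) \<Rightarrow> 'v word \<Rightarrow> real" where
  "append_letter f w = (\<Sum>e\<in>E. \<Sum>x\<in>UNIV. mark_weight u x * f (w @ [(e, x)]))"

lemma word_sum_cong: "(\<And>w. w \<in> words \<Longrightarrow> f w = g w) \<Longrightarrow> word_sum f k = word_sum g k"
  unfolding word_sum_def by (intro sum.cong refl) (auto simp: words_of_def)

lemma word_series_cong: "(\<And>w. w \<in> words \<Longrightarrow> f w = g w) \<Longrightarrow> word_series f t = word_series g t"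
  unfolding word_series_def by (subst word_sum_cong[of f g]) auto

lemma word_sum_mono: "(\<And>w. w \<in> words \<Longrightarrow> f w \<le> g w) \<Longrightarrow> word_sum f k \<le> word_sum g k"
  unfolding word_sum_def
  by (intro sum_mono mult_left_mono word_weight_nonneg[OF u]) (auto simp: words_of_def)

lemma word_sum_const: "word_sum (\<lambda>_. c) k = c * m ^ k"
  by (simp add: word_sum_def sum_word_weight flip: sum_distrib_right)

lemma word_sum_bound:
  assumes "\<forall>w\<in>words. \<bar>f w\<bar> \<le> C * B ^ length w"
  shows "\<bar>word_sum f k\<bar> \<le> C * (B * m) ^ k"
proof -
  have "\<bar>word_sum f k\<bar> \<le> (\<Sum>w\<in>words_of k. \<bar>word_weight u w * f w\<bar>)"
    unfolding word_sum_def by (rule sum_abs)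
  also have "\<dots> \<le> (\<Sum>w\<in>words_of k. word_weight u w * (C * B ^ k))"
    using assms word_weight_nonneg[OF u]
    by (intro sum_mono)
      (auto simp: abs_mult abs_of_nonneg[OF word_weight_nonneg[OF u]] words_of_def intro!: mult_left_mono)
  also have "\<dots> = C * (B * m) ^ k"
    unfolding sum_distrib_right[symmetric] sum_word_weight by (simp add: power_mult_distrib)
  finally show ?thesis .
qed

lemma summable_word_series:
  assumes "exp_bounded f"
  shows "summable (\<lambda>k. norm (word_sum f k / fact k * t ^ k))"
proof -
  obtain C B where CB: "C \<ge> 0" "B \<ge> 0" "\<forall>w\<in>words. \<bar>f w\<bar> \<le> C * B ^ length w"
    using assms unfolding exp_bounded_def by blast
  show ?thesis
  proof (rule summable_comparison_test')
    have "summable (\<lambda>k. (B * m * \<bar>t\<bar>) ^ k / fact k)"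
      using summable_exp[of "B * m * \<bar>t\<bar>"] by (simp add: divide_inverse mult.commute)
    then show "summable (\<lambda>k. C * ((B * m * \<bar>t\<bar>) ^ k / fact k))" by (rule summable_mult)
    fix k :: nat
    have "norm (word_sum f k / fact k * t ^ k) = \<bar>word_sum f k\<bar> * (\<bar>t\<bar> ^ k / fact k)"
      by (simp add: abs_mult power_abs)
    also have "\<dots> \<le> (C * (B * m) ^ k) * (\<bar>t\<bar> ^ k / fact k)"
      by (intro mult_right_mono word_sum_bound CB) simp
    also have "\<dots> = C * ((B * m * \<bar>t\<bar>) ^ k / fact k)" by (simp add: power_mult_distrib)
    finally show "norm (norm (word_sum f k / fact k * t ^ k)) \<le> C * ((B * m * \<bar>t\<bar>) ^ k / fact k)" by simp
  qed
qed

lemma summable_word_series': "exp_bounded f \<Longrightarrow> summable (\<lambda>k. word_sum f k / fact k * t ^ k)"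
  using summable_norm_cancel[OF summable_word_series] .

lemma exp_bounded_add: "exp_bounded f \<Longrightarrow> exp_bounded g \<Longrightarrow> exp_bounded (\<lambda>w. f w + g w)"
proof -
  assume "exp_bounded f" "exp_bounded g"
  then obtain C B C' B' where CB: "C \<ge> 0" "B \<ge> 0" "\<forall>w\<in>words. \<bar>f w\<bar> \<le> C * B ^ length w"
    "C' \<ge> 0" "B' \<ge> 0" "\<forall>w\<in>words. \<bar>g w\<bar> \<le> C' * B' ^ length w"
    unfolding exp_bounded_def by blast
  have "\<bar>f w + g w\<bar> \<le> (C + C') * max B B' ^ length w" if "w \<in> words" for w
  proof -
    have "\<bar>f w\<bar> \<le> C * max B B' ^ length w"
      using CB that by (intro order_trans[OF CB(3)[rule_format, OF that]] mult_left_mono power_mono) auto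
    moreover have "\<bar>g w\<bar> \<le> C' * max B B' ^ length w"
      using CB that by (intro order_trans[OF CB(6)[rule_format, OF that]] mult_left_mono power_mono) auto
    ultimately show ?thesis unfolding distrib_right by linarith
  qed
  then show ?thesis using CB by (intro exp_boundedI[of "C + C'" "max B B'"]) auto
qed

lemma exp_bounded_mult:
  assumes "exp_bounded f" "\<And>w. w \<in> words \<Longrightarrow> \<bar>g w\<bar> \<le> D"
  shows "exp_bounded (\<lambda>w. g w * f w)"
proof -
  obtain C B where CB: "C \<ge> 0" "B \<ge> 0" "\<forall>w\<in>words. \<bar>f w\<bar> \<le> C * B ^ length w"
    using assms(1) unfolding exp_bounded_def by blast
  have "\<bar>g w * f w\<bar> \<le> (max D 0 * C) * B ^ length w" if "w \<in> words" for w
    unfolding abs_mult mult.assoc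
    using CB assms(2)[OF that] that by (intro mult_mono) auto
  then show ?thesis using CB by (intro exp_boundedI[of "max D 0 * C" B]) auto
qed

lemma exp_bounded_const: "exp_bounded (\<lambda>_. c)"
  by (rule exp_boundedI[of "\<bar>c\<bar>" 1]) auto

lemma word_series_add:
  "exp_bounded f \<Longrightarrow> exp_bounded g \<Longrightarrow>
    word_series (\<lambda>w. f w + g w) t = word_series f t + word_series g t"
  unfolding word_series_def
  by (subst suminf_add[OF summable_word_series' summable_word_series'])
     (auto simp: word_sum_def distrib_left sum.distrib distrib_right add_divide_distrib)

lemma word_series_cmult:
  "exp_bounded f \<Longrightarrow> word_series (\<lambda>w. c * f w) t = c * word_series f t"
proof -
  assume "exp_bounded f"
  have "word_sum (\<lambda>w. c * f w) k = c * word_sum f k" for k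
    unfolding word_sum_def sum_distrib_left by (intro sum.cong refl) (simp add: mult_ac)
  then show ?thesis unfolding word_series_def
    by (subst suminf_mult[OF summable_word_series'[OF \<open>exp_bounded f\<close>], symmetric]) (simp add: mult_ac)
qed

lemma word_series_mono:
  assumes "exp_bounded f" "exp_bounded g" "\<And>w. w \<in> words \<Longrightarrow> f w \<le> g w" "t \<ge> 0"
  shows "word_series f t \<le> word_series g t"
  unfolding word_series_def
  by (intro suminf_le summable_word_series' assms mult_right_mono divide_right_mono word_sum_mono)
     (use assms in auto)

lemma word_series_const: "word_series (\<lambda>_. 1) t = exp (m * t)"
proof -
  have "(\<lambda>k. (m * t) ^ k /\<^sub>R fact k) sums exp (m * t)" by (rule exp_converges)
  moreover have "word_sum (\<lambda>_. 1) k / fact k * t ^ k = (m * t) ^ k /\<^sub>R fact k" for k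
    by (simp add: word_sum_const power_mult_distrib divide_inverse mult_ac)
  ultimately show ?thesis unfolding word_series_def by (simp add: sums_iff)
qed

lemma word_series_nonneg:
  assumes "exp_bounded f" "\<And>w. w \<in> words \<Longrightarrow> 0 \<le> f w" "t \<ge> 0"
  shows "0 \<le> word_series f t"
proof -
  have "word_series (\<lambda>_. 0) t = 0" by (simp add: word_series_def word_sum_def)
  then show ?thesis using word_series_mono[OF exp_bounded_const assms(1) assms(2,3)] by simp
qed

lemma word_sum_Suc: "word_sum f (Suc k) = word_sum (append_letter f) k"
  unfolding word_sum_def sum_words_Suc append_letter_def sum_distrib_left
  by (intro sum.cong refl) (simp add: word_weight_append mult_ac, simp add: word_weight_def)

lemma word_series_deriv:
  assumes "exp_bounded f"
  shows "(word_series f has_real_derivative word_series (append_letter f) t) (at t)"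
proof -
  have "((\<lambda>x. \<Sum>k. word_sum f k / fact k * x ^ k) has_field_derivative
      (\<Sum>k. diffs (\<lambda>k. word_sum f k / fact k) k * t ^ k)) (at t)"
    by (rule termdiffs_strong_converges_everywhere) (rule summable_word_series'[OF assms])
  moreover have "diffs (\<lambda>k. word_sum f k / fact k) k = word_sum (append_letter f) k / fact k" for k
    by (simp add: diffs_def word_sum_Suc field_simps del: of_nat_Suc)
  ultimately show ?thesis unfolding word_series_def[abs_def] by simp
qed

lemma word_series_continuous: "exp_bounded f \<Longrightarrow> isCont (word_series f) t"
  using word_series_deriv DERIV_isCont by blast

lemma sum_words_concat:
  "(\<Sum>w\<in>words_of (i + j). F w) = (\<Sum>w\<in>words_of i. \<Sum>w'\<in>words_of j. F (w @ w'))" for F :: "_ \<Rightarrow> real"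
proof (induction j arbitrary: F)
  case 0
  then show ?case by (simp add: words_of_0)
next
  case (Suc j)
  then show ?case by (simp add: sum_words_Suc)
qed

lemma word_sum_concat_ge:
  assumes "\<And>w w'. w \<in> words \<Longrightarrow> w' \<in> words \<Longrightarrow> g w \<le> f (w @ w')"
  shows "word_sum g i * m ^ j \<le> word_sum f (i + j)"
proof -
  have "word_sum g i * m ^ j = (\<Sum>w\<in>words_of i. \<Sum>w'\<in>words_of j. word_weight u w * g w * word_weight u w')"
    unfolding word_sum_def sum_word_weight[of u j, symmetric] by (rule sum_product)
  also have "\<dots> \<le> (\<Sum>w\<in>words_of i. \<Sum>w'\<in>words_of j. word_weight u (w @ w') * f (w @ w'))"
  proof (intro sum_mono)
    fix w w' assume "w \<in> words_of i" "w' \<in> words_of j"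
    then have "g w \<le> f (w @ w')" using assms by (auto simp: words_of_def)
    then have "word_weight u w * word_weight u w' * g w \<le> word_weight u w * word_weight u w' * f (w @ w')"
      using word_weight_nonneg[OF u] by (intro mult_left_mono mult_nonneg_nonneg)
    then show "word_weight u w * g w * word_weight u w' \<le> word_weight u (w @ w') * f (w @ w')"
      by (simp add: word_weight_append mult_ac)
  qed
  also have "\<dots> = word_sum f (i + j)" unfolding word_sum_def sum_words_concat ..
  finally show ?thesis .
qed

text \<open>The binomial expansion of \<open>(a + s)\<^sup>k\<close> splits a word of length
  \<open>k\<close> into a word belonging to \<open>a\<close> and a word belonging to
  \<open>s\<close>; the sum over the second word contributes the factor \<open>exp (m *
  s)\<close>.\<close>

lemma word_series_concat_ge:
  assumes "exp_bounded f" "exp_bounded g" "a \<ge> 0" "s \<ge> 0"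
    and "\<And>w w'. w \<in> words \<Longrightarrow> w' \<in> words \<Longrightarrow> g w \<le> f (w @ w')"
  shows "exp (m * s) * word_series g a \<le> word_series f (a + s)"
proof -
  let ?A = "\<lambda>k. word_sum g k / fact k * a ^ k" and ?B = "\<lambda>k. (m * s) ^ k /\<^sub>R fact k"
  have "summable (\<lambda>k. norm (?B k))" by (rule summable_norm_exp)
  from Cauchy_product_sums[OF summable_word_series[OF assms(2)] this]
  have C: "(\<lambda>k. \<Sum>i\<le>k. ?A i * ?B (k - i)) sums (word_series g a * exp (m * s))"
    unfolding word_series_def exp_def by simp
  have "word_series g a * exp (m * s) \<le> word_series f (a + s)"
    unfolding word_series_def[of f]
  proof (rule sums_le[OF _ C summable_sums[OF summable_word_series'[OF assms(1)]]])
    fix k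
    \<comment> \<open>The binomial theorem, divided by \<open>k!\<close>.\<close>
    have bin: "(a + s) ^ k / fact k = (\<Sum>i\<le>k. (a ^ i / fact i) * (s ^ (k - i) / fact (k - i)))"
      using exp_series_add_commuting[of a s k] by (simp add: divide_inverse mult.commute)
    have "(\<Sum>i\<le>k. ?A i * ?B (k - i)) =
        (\<Sum>i\<le>k. word_sum g i * m ^ (k - i) * ((a ^ i / fact i) * (s ^ (k - i) / fact (k - i))))"
      by (intro sum.cong refl) (simp add: power_mult_distrib divide_inverse mult_ac)
    also have "\<dots> \<le> (\<Sum>i\<le>k. word_sum f k * ((a ^ i / fact i) * (s ^ (k - i) / fact (k - i))))"
    proof (rule sum_mono)
      fix i assume "i \<in> {..k}"
      then have "word_sum g i * m ^ (k - i) \<le> word_sum f k"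
        using word_sum_concat_ge[of g f i "k - i"] assms(5) by simp
      then show "word_sum g i * m ^ (k - i) * ((a ^ i / fact i) * (s ^ (k - i) / fact (k - i)))
          \<le> word_sum f k * ((a ^ i / fact i) * (s ^ (k - i) / fact (k - i)))"
        using assms(3,4) by (intro mult_right_mono) auto
    qed
    also have "\<dots> = word_sum f k / fact k * (a + s) ^ k"
      unfolding sum_distrib_left[symmetric] bin[symmetric] by simp
    finally show "(\<Sum>i\<le>k. ?A i * ?B (k - i)) \<le> word_sum f k / fact k * (a + s) ^ k" .
  qed
  then show ?thesis by (simp add: mult.commute)
qed

definition loop_weight :: "'v word \<Rightarrow> real" where
  "loop_weight w = \<theta> ^ word_loops V w"

lemma loop_weight_pos: "loop_weight w > 0"
  using \<theta> by (simp add: loop_weight_def)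

lemma exp_bounded_loops: "exp_bounded (\<lambda>w. real (word_loops V w))"
proof (rule exp_boundedI[of "real (word_loops V []) + 1" 2])
  fix w assume "w \<in> words"
  then have "real (word_loops V w) \<le> real (word_loops V []) + real (length w)"
    using word_loops_le[of w] by linarith
  also have "\<dots> \<le> real (word_loops V []) * 2 ^ length w + 2 ^ length w"
  proof -
    have "real (length w) < 2 ^ length w" by (rule of_nat_less_two_power)
    moreover have "real (word_loops V []) * 1 \<le> real (word_loops V []) * 2 ^ length w"
      by (intro mult_left_mono) auto
    ultimately show ?thesis by linarith
  qed
  finally show "\<bar>real (word_loops V w)\<bar> \<le> (real (word_loops V []) + 1) * 2 ^ length w"
    by (simp add: algebra_simps)
qed auto

lemma exp_bounded_loop_weight: "exp_bounded loop_weight"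
proof (rule exp_boundedI[of "max 1 \<theta> ^ word_loops V []" "max 1 \<theta>"])
  fix w assume "w \<in> words"
  have "\<bar>loop_weight w\<bar> = \<theta> ^ word_loops V w" using \<theta> by (simp add: loop_weight_def)
  also have "\<dots> \<le> max 1 \<theta> ^ word_loops V w" using \<theta> by (intro power_mono) auto
  also have "\<dots> \<le> max 1 \<theta> ^ (word_loops V [] + length w)"
    using word_loops_le[OF \<open>w \<in> words\<close>] by (intro power_increasing) auto
  finally show "\<bar>loop_weight w\<bar> \<le> max 1 \<theta> ^ word_loops V [] * max 1 \<theta> ^ length w"
    by (simp add: power_add)
qed auto

abbreviation W :: "real \<Rightarrow> real" where "W \<equiv> word_series loop_weight"

lemma W_pos:
  assumes "t \<ge> 0"
  shows "W t > 0"
proof -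
  let ?f = "\<lambda>k. word_sum loop_weight k / fact k * t ^ k"
  have "summable ?f" by (rule summable_word_series'[OF exp_bounded_loop_weight])
  moreover have "0 \<le> ?f k" for k
    using assms word_weight_nonneg[OF u] loop_weight_pos unfolding word_sum_def
    by (intro mult_nonneg_nonneg divide_nonneg_nonneg sum_nonneg) (auto intro: less_imp_le)
  moreover have "0 < ?f 0"
    using loop_weight_pos by (simp add: word_sum_def words_of_0 word_weight_def)
  ultimately have "0 < suminf ?f" by (rule suminf_pos2)
  then show ?thesis by (simp add: word_series_def)
qed

lemma nn_integral_word_series:
  fixes h :: "'v config \<Rightarrow> real"
  assumes "t \<ge> 0" and nn: "\<And>\<omega>. h \<omega> \<ge> 0"
    and inv: "\<And>\<phi> \<omega>. time_change \<phi> \<Longrightarrow> circle_config \<omega> \<Longrightarrow> h (transport \<phi> \<omega>) = h \<omega>"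
    and eb: "exp_bounded (\<lambda>w. h (word_config w))"
  shows "(\<lambda>s. h (config_of E s)) \<in> borel_measurable (config_law E t u)"
    and "(\<integral>\<^sup>+ s. ennreal (h (config_of E s)) \<partial>config_law E t u) =
      ennreal (exp (- t * m) * word_series (\<lambda>w. h (word_config w)) t)"
proof -
  let ?h = "\<lambda>\<omega>. ennreal (h \<omega>)"
  have inv': "?h (transport \<phi> \<omega>) = ?h \<omega>" if "time_change \<phi>" "circle_config \<omega>" for \<phi> \<omega>
    using inv[OF that] by simp
  note nn_integral_config_law[of t u ?h, OF assms(1) u inv']
  then have meas: "(\<lambda>s. ?h (config_of E s)) \<in> borel_measurable (config_law E t u)"
    and int: "(\<integral>\<^sup>+ s. ?h (config_of E s) \<partial>config_law E t u) =
      (\<Sum>k. \<Sum>w\<in>words_of k. ?h (word_config w) * ennreal (exp (- t * m) * (t ^ k / fact k * word_weight u w)))"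
    by auto
  have "(\<lambda>s. enn2real (?h (config_of E s))) \<in> borel_measurable (config_law E t u)"
    using meas by measurable
  then show "(\<lambda>s. h (config_of E s)) \<in> borel_measurable (config_law E t u)" using nn by simp
  have "(\<Sum>w\<in>words_of k. ?h (word_config w) * ennreal (exp (- t * m) * (t ^ k / fact k * word_weight u w)))
      = ennreal (exp (- t * m) * (word_sum (\<lambda>w. h (word_config w)) k / fact k * t ^ k))" for k
  proof -
    have "(\<Sum>w\<in>words_of k. ?h (word_config w) * ennreal (exp (- t * m) * (t ^ k / fact k * word_weight u w)))
      = (\<Sum>w\<in>words_of k. ennreal (h (word_config w) * (exp (- t * m) * (t ^ k / fact k * word_weight u w))))"
      by (intro sum.cong refl) (simp only: ennreal_mult'[OF nn])
    also have "\<dots> = ennreal (\<Sum>w\<in>words_of k. h (word_config w) * (exp (- t * m) * (t ^ k / fact k * word_weight u w)))"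
      using nn word_weight_nonneg[OF u] assms(1)
      by (intro sum_ennreal mult_nonneg_nonneg divide_nonneg_nonneg) auto
    also have "(\<Sum>w\<in>words_of k. h (word_config w) * (exp (- t * m) * (t ^ k / fact k * word_weight u w)))
        = exp (- t * m) * (word_sum (\<lambda>w. h (word_config w)) k / fact k * t ^ k)"
      unfolding word_sum_def sum_divide_distrib sum_distrib_left sum_distrib_right
      by (intro sum.cong refl) (simp add: mult_ac)
    finally show ?thesis .
  qed
  then have "(\<integral>\<^sup>+ s. ?h (config_of E s) \<partial>config_law E t u) =
      (\<Sum>k. ennreal (exp (- t * m) * (word_sum (\<lambda>w. h (word_config w)) k / fact k * t ^ k)))"
    using int by simp
  also have "\<dots> = ennreal (exp (- t * m) * word_series (\<lambda>w. h (word_config w)) t)"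
  proof (rule suminf_ennreal_eq)
    show "0 \<le> exp (- t * m) * (word_sum (\<lambda>w. h (word_config w)) k / fact k * t ^ k)" for k
      using assms(1) nn word_weight_nonneg[OF u] unfolding word_sum_def
      by (intro mult_nonneg_nonneg divide_nonneg_nonneg sum_nonneg) auto
    show "(\<lambda>k. exp (- t * m) * (word_sum (\<lambda>w. h (word_config w)) k / fact k * t ^ k)) sums
        (exp (- t * m) * word_series (\<lambda>w. h (word_config w)) t)"
      unfolding word_series_def by (intro sums_mult summable_sums summable_word_series' eb)
  qed
  finally show "(\<integral>\<^sup>+ s. ?h (config_of E s) \<partial>config_law E t u) =
      ennreal (exp (- t * m) * word_series (\<lambda>w. h (word_config w)) t)" .
qed

lemma partition_function_eq:
  assumes "t \<ge> 0"
  shows "partition_function V E \<theta> t u = exp (- t * m) * W t"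
    and "(\<lambda>s. \<theta> ^ num_loops V (config_of E s)) \<in> borel_measurable (config_law E t u)"
proof -
  let ?h = "\<lambda>\<omega>. \<theta> ^ num_loops V \<omega>"
  have eb: "exp_bounded (\<lambda>w. ?h (word_config w))"
    using exp_bounded_loop_weight unfolding loop_weight_def[abs_def] word_loops_def .
  have inv: "?h (transport \<phi> \<omega>) = ?h \<omega>" if "time_change \<phi>" "circle_config \<omega>"
    for \<phi> and \<omega> :: "'v config" using num_loops_transport[OF that] by simp
  have nn: "0 \<le> ?h \<omega>" for \<omega> :: "'v config" using \<theta> by simp
  note * = nn_integral_word_series[where h = ?h, OF assms nn inv eb]
  show "(\<lambda>s. \<theta> ^ num_loops V (config_of E s)) \<in> borel_measurable (config_law E t u)" by (rule *(1))
  have "partition_function V E \<theta> t u = enn2real (\<integral>\<^sup>+ s. ennreal (?h (config_of E s)) \<partial>config_law E t u)"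
    unfolding partition_function_def using *(1) nn by (intro integral_eq_nn_integral) auto
  also have "\<dots> = exp (- t * m) * W t"
    using *(2) W_pos[OF assms] by (simp add: loop_weight_def[abs_def] word_loops_def)
  finally show "partition_function V E \<theta> t u = exp (- t * m) * W t" .
qed

definition large_word :: "real \<Rightarrow> 'v word \<Rightarrow> real" where
  "large_word \<eta> w = of_bool (large_loop V \<eta> (word_config w))"

lemma exp_bounded_large: "exp_bounded (\<lambda>w. large_word \<eta> w * loop_weight w)"
  by (rule exp_bounded_mult[OF exp_bounded_loop_weight, of _ 1]) (simp add: large_word_def)

lemma prob_large_loop_eq:
  assumes "t \<ge> 0"
  shows "prob_large_loop V E \<theta> t u \<eta> = word_series (\<lambda>w. large_word \<eta> w * loop_weight w) t / W t"
proof -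
  let ?M = "config_law E t u"
  let ?h = "\<lambda>\<omega> :: 'v config. of_bool (large_loop V \<eta> \<omega>) * \<theta> ^ num_loops V \<omega> :: real"
  let ?Z = "partition_function V E \<theta> t u"
  let ?A = "{s \<in> space ?M. large_loop V \<eta> (config_of E s)}"
  have eq: "(\<lambda>w. ?h (word_config w)) = (\<lambda>w. large_word \<eta> w * loop_weight w)"
    by (simp add: large_word_def loop_weight_def word_loops_def)
  have eb: "exp_bounded (\<lambda>w. ?h (word_config w))" unfolding eq by (rule exp_bounded_large)
  have inv: "?h (transport \<phi> \<omega>) = ?h \<omega>" if "time_change \<phi>" "circle_config \<omega>" for \<phi> \<omega>
    using num_loops_transport[OF that] large_loop_transport[OF that] by simp
  have nn: "0 \<le> ?h \<omega>" for \<omega> using \<theta> by simp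
  note * = nn_integral_word_series[where h = ?h, OF assms nn inv eb]
  have A: "?A \<in> sets ?M"
    by (rule measurable_invariant[OF finite_E]) (rule large_loop_transport)
  have Z: "?Z > 0" unfolding partition_function_eq(1)[OF assms] using W_pos[OF assms] by simp
  have dens: "(\<lambda>s. ennreal (\<theta> ^ num_loops V (config_of E s) / ?Z)) \<in> borel_measurable ?M"
    using partition_function_eq(2)[OF assms] by measurable
  have "emeasure (loop_measure V E \<theta> t u) ?A =
      (\<integral>\<^sup>+ s. ennreal (\<theta> ^ num_loops V (config_of E s) / ?Z) * indicator ?A s \<partial>?M)"
    unfolding loop_measure_def using dens A by (simp add: emeasure_density)
  also have "\<dots> = (\<integral>\<^sup>+ s. ennreal (1 / ?Z) * ennreal (?h (config_of E s)) \<partial>?M)"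
  proof (rule nn_integral_cong)
    fix s assume "s \<in> space ?M"
    then show "ennreal (\<theta> ^ num_loops V (config_of E s) / ?Z) * indicator ?A s =
        ennreal (1 / ?Z) * ennreal (?h (config_of E s))"
      using Z \<theta> by (auto simp: indicator_def ennreal_mult'[symmetric])
  qed
  also have "\<dots> = ennreal (1 / ?Z) * (\<integral>\<^sup>+ s. ennreal (?h (config_of E s)) \<partial>?M)"
    using *(1) by (intro nn_integral_cmult) auto
  also have "\<dots> = ennreal (1 / ?Z * (exp (- t * m) * word_series (\<lambda>w. large_word \<eta> w * loop_weight w) t))"
  proof -
    have "(\<integral>\<^sup>+ s. ennreal (?h (config_of E s)) \<partial>?M) =
        ennreal (exp (- t * m) * word_series (\<lambda>w. large_word \<eta> w * loop_weight w) t)"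
      using *(2) unfolding eq .
    moreover have "ennreal (1 / ?Z) * ennreal x = ennreal (1 / ?Z * x)" for x
      using Z by (simp only: ennreal_mult'[of "1 / ?Z"] divide_nonneg_nonneg less_imp_le zero_le_one)
    ultimately show ?thesis by metis
  qed
  finally have "emeasure (loop_measure V E \<theta> t u) ?A =
      ennreal (1 / ?Z * (exp (- t * m) * word_series (\<lambda>w. large_word \<eta> w * loop_weight w) t))" .
  moreover have "0 \<le> 1 / ?Z * (exp (- t * m) * word_series (\<lambda>w. large_word \<eta> w * loop_weight w) t)"
    using Z word_series_nonneg[OF exp_bounded_large, of \<eta> t] loop_weight_pos assms
    by (auto simp: large_word_def less_imp_le)
  ultimately have "prob_large_loop V E \<theta> t u \<eta> =
      1 / ?Z * (exp (- t * m) * word_series (\<lambda>w. large_word \<eta> w * loop_weight w) t)"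
    unfolding prob_large_loop_def loop_measure_def by (simp add: measure_def)
  then show ?thesis unfolding partition_function_eq(1)[OF assms] by simp
qed

lemma append_letter_loop_weight:
  assumes "w \<in> words"
  shows "append_letter loop_weight w =
    m * loop_weight w + (\<theta> - 1) * (growth_rate \<theta> u w * loop_weight w)"
proof -
  have "append_letter loop_weight w = (\<Sum>e\<in>E. \<Sum>x\<in>UNIV. mark_weight u x * loop_weight w +
      (\<theta> - 1) * (mark_weight u x * relative_change \<theta> (loop_change w e x) * loop_weight w))"
    unfolding append_letter_def loop_weight_def
    by (intro sum.cong refl) (simp only: power_word_loops_append[OF assms _ \<theta>], simp add: algebra_simps)
  also have "\<dots> = (\<Sum>e\<in>E. loop_weight w) + (\<theta> - 1) * (growth_rate \<theta> u w * loop_weight w)"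
    unfolding growth_rate_def sum.distrib sum_distrib_left sum_distrib_right
    by (simp add: sum_mark mark_weight_def flip: distrib_right)
  finally show ?thesis by simp
qed

lemma append_letter_loops:
  assumes "w \<in> words"
  shows "append_letter (\<lambda>w. real (word_loops V w)) w =
    m * real (word_loops V w) + growth_rate 1 u w"
proof -
  have "append_letter (\<lambda>w. real (word_loops V w)) w =
    (\<Sum>e\<in>E. \<Sum>x\<in>UNIV. mark_weight u x * real (word_loops V w) +
      mark_weight u x * relative_change 1 (loop_change w e x))"
    unfolding append_letter_def
    using word_loops_append_diff[OF assms]
    by (intro sum.cong refl) (simp add: distrib_left)
  also have "\<dots> = (\<Sum>e\<in>E. real (word_loops V w)) + growth_rate 1 u w"
    unfolding growth_rate_def sum.distrib
    by (simp add: sum_mark mark_weight_def flip: distrib_right)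
  finally show ?thesis by simp
qed

lemma abs_growth_rate_le: "\<bar>growth_rate \<theta> u w\<bar> \<le> m * max 1 (1 / \<theta>)"
proof -
  have "\<bar>\<Sum>x\<in>UNIV. mark_weight u x * relative_change \<theta> (loop_change w e x)\<bar> \<le> max 1 (1 / \<theta>)" for e
  proof -
    have "\<bar>relative_change \<theta> k\<bar> \<le> max 1 (1 / \<theta>)" for k
      using \<theta> by (auto simp: relative_change_def le_max_iff_disj)
    then have "\<bar>\<Sum>x\<in>UNIV. mark_weight u x * relative_change \<theta> (loop_change w e x)\<bar>
        \<le> (\<Sum>x\<in>UNIV. mark_weight u x * max 1 (1 / \<theta>))"
      using u by (intro order_trans[OF sum_abs sum_mono])
        (auto simp: abs_mult mark_weight_def split: mark.splits intro!: mult_left_mono)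
    also have "\<dots> = max 1 (1 / \<theta>)"
      by (simp add: sum_mark mark_weight_def flip: distrib_right)
    finally show ?thesis .
  qed
  then have "\<bar>growth_rate \<theta> u w\<bar> \<le> (\<Sum>e\<in>E. max 1 (1 / \<theta>))"
    unfolding growth_rate_def by (intro order_trans[OF sum_abs sum_mono])
  then show ?thesis by simp
qed

lemma exp_bounded_growth: "exp_bounded (\<lambda>w. growth_rate \<theta> u w * loop_weight w)"
  by (rule exp_bounded_mult[OF exp_bounded_loop_weight abs_growth_rate_le])

text \<open>The expectation of \<^const>\<open>growth_rate\<close> under the weighted loop
  measure.\<close>

definition mean_growth :: "real \<Rightarrow> real" where
  "mean_growth t = word_series (\<lambda>w. growth_rate \<theta> u w * loop_weight w) t / W t"

lemma mean_growth_continuous: "t \<ge> 0 \<Longrightarrow> isCont mean_growth t"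
  unfolding mean_growth_def[abs_def]
  using W_pos[of t] word_series_continuous[OF exp_bounded_growth] word_series_continuous[OF exp_bounded_loop_weight]
  by (intro continuous_intros) auto

text \<open>The derivative of \<open>ln\<close> at \<open>1\<close> gives the value at
  \<open>\<theta> = 1\<close>, where \<open>ln \<theta> / (\<theta> - 1)\<close> extends
  continuously.\<close>

definition loop_bound :: real where
  "loop_bound = (if \<theta> = 1 then 1 else ln \<theta> / (\<theta> - 1))"

text \<open>\<open>H\<close> is the logarithm of the partition function divided by
  \<open>\<theta> - 1\<close>. Prolonging words loses at most \<open>card V\<close> loops, so
  the partition function decreases by a factor of at most \<open>\<theta> ^ card V\<close> if
  \<open>\<theta> > 1\<close>, and increases by at most the inverse of this number if
  \<open>\<theta> < 1\<close>; division by \<open>\<theta> - 1\<close> turns both into the same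
  lower bound.\<close>

lemma potential_ne_1:
  assumes "\<theta> \<noteq> 1"
  defines "H \<equiv> \<lambda>t. (ln (W t) - m * t) / (\<theta> - 1)"
  shows "t \<ge> 0 \<Longrightarrow> (H has_real_derivative mean_growth t) (at t)"
    and "a \<ge> 0 \<Longrightarrow> s \<ge> 0 \<Longrightarrow> H (a + s) - H a \<ge> - loop_bound * card V"
proof -
  let ?S = "word_series (\<lambda>w. growth_rate \<theta> u w * loop_weight w)"
  have dW: "word_series (append_letter loop_weight) t = m * W t + (\<theta> - 1) * ?S t" for t
  proof -
    have "word_series (append_letter loop_weight) t =
        word_series (\<lambda>w. m * loop_weight w + (\<theta> - 1) * (growth_rate \<theta> u w * loop_weight w)) t"
      by (rule word_series_cong) (rule append_letter_loop_weight)
    also have "\<dots> = m * W t + (\<theta> - 1) * ?S t"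
      using exp_bounded_loop_weight exp_bounded_growth
      by (subst word_series_add) (auto intro!: exp_bounded_mult[where g = "\<lambda>_. _"] simp: word_series_cmult)
    finally show ?thesis .
  qed
  show "(H has_real_derivative mean_growth t) (at t)" if "t \<ge> 0"
  proof -
    have W: "(W has_real_derivative (m * W t + (\<theta> - 1) * ?S t)) (at t)"
      using word_series_deriv[OF exp_bounded_loop_weight, of t] unfolding dW .
    have "(H has_real_derivative (((m * W t + (\<theta> - 1) * ?S t) / W t) - m) / (\<theta> - 1)) (at t)"
      unfolding H_def using W_pos[OF that]
      by (auto intro!: derivative_eq_intros W simp: divide_inverse)
    moreover have "(((m * W t + (\<theta> - 1) * ?S t) / W t) - m) / (\<theta> - 1) = mean_growth t"
      using W_pos[OF that] assms(1) by (simp add: mean_growth_def field_simps)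
    ultimately show ?thesis by simp
  qed
  assume as: "a \<ge> 0" "s \<ge> 0"
  have pos: "W a > 0" "W (a + s) > 0" using as by (auto intro: W_pos)
  have n: "\<theta> ^ card V > 0" using \<theta> by simp
  have eb: "exp_bounded (\<lambda>w. c * loop_weight w)" for c
    by (rule exp_bounded_mult[OF exp_bounded_loop_weight, of "\<lambda>_. c" "\<bar>c\<bar>"]) simp
  have ln_eq: "ln (exp (m * s) * (1 / \<theta> ^ card V * W a)) = m * s + ln (W a) - card V * ln \<theta>"
    using pos \<theta> by (simp add: ln_mult ln_div ln_realpow)
  show "H (a + s) - H a \<ge> - loop_bound * card V"
  proof (cases "\<theta> > 1")
    case True
    have "exp (m * s) * word_series (\<lambda>w. 1 / \<theta> ^ card V * loop_weight w) a \<le> W (a + s)"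
    proof (rule word_series_concat_ge[OF exp_bounded_loop_weight eb as])
      fix w w' assume ww: "w \<in> words" "w' \<in> words"
      have "\<theta> ^ word_loops V w \<le> \<theta> ^ (word_loops V (w @ w') + card V)"
        using word_loops_concat[OF ww] True by (intro power_increasing) auto
      then show "1 / \<theta> ^ card V * loop_weight w \<le> loop_weight (w @ w')"
        using n by (simp add: loop_weight_def power_add field_simps)
    qed
    then have "exp (m * s) * (1 / \<theta> ^ card V * W a) \<le> W (a + s)"
      unfolding word_series_cmult[OF exp_bounded_loop_weight] .
    then have "ln (exp (m * s) * (1 / \<theta> ^ card V * W a)) \<le> ln (W (a + s))"
      using pos n by (intro ln_mono) auto
    then have "- (card V * ln \<theta>) \<le> (ln (W (a + s)) - m * (a + s)) - (ln (W a) - m * a)"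
      unfolding ln_eq by (simp add: algebra_simps)
    then have "- (card V * ln \<theta>) / (\<theta> - 1) \<le> ((ln (W (a + s)) - m * (a + s)) - (ln (W a) - m * a)) / (\<theta> - 1)"
      using True by (intro divide_right_mono) auto
    then show ?thesis unfolding H_def loop_bound_def using assms(1) by (simp add: diff_divide_distrib mult.commute)
  next
    case False
    then have less: "\<theta> < 1" using assms(1) by simp
    have "exp (m * s) * word_series (\<lambda>w. - (1 / \<theta> ^ card V) * loop_weight w) a
        \<le> word_series (\<lambda>w. - 1 * loop_weight w) (a + s)"
    proof (rule word_series_concat_ge[OF eb eb as])
      fix w w' assume ww: "w \<in> words" "w' \<in> words"
      have "\<theta> ^ (word_loops V (w @ w') + card V) \<le> \<theta> ^ word_loops V w"
        using word_loops_concat[OF ww] less \<theta> by (intro power_decreasing) auto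
      then show "- (1 / \<theta> ^ card V) * loop_weight w \<le> - 1 * loop_weight (w @ w')"
        using n by (simp add: loop_weight_def power_add field_simps)
    qed
    then have "W (a + s) \<le> exp (m * s) * (1 / \<theta> ^ card V * W a)"
      unfolding word_series_cmult[OF exp_bounded_loop_weight] by simp
    then have "ln (W (a + s)) \<le> ln (exp (m * s) * (1 / \<theta> ^ card V * W a))"
      using pos n by (intro ln_mono) auto
    then have "(ln (W (a + s)) - m * (a + s)) - (ln (W a) - m * a) \<le> - (card V * ln \<theta>)"
      unfolding ln_eq by (simp add: algebra_simps)
    then have "- (card V * ln \<theta>) / (\<theta> - 1) \<le> ((ln (W (a + s)) - m * (a + s)) - (ln (W a) - m * a)) / (\<theta> - 1)"
      using less by (intro divide_right_mono_neg) auto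
    then show ?thesis unfolding H_def loop_bound_def using assms(1) by (simp add: diff_divide_distrib mult.commute)
  qed
qed

text \<open>Here the weight is constant and \<open>H\<close> is the mean number of loops, the
  limit of the potential of \<open>potential_ne_1\<close> as \<open>\<theta>\<close> tends to
  \<open>1\<close>.\<close>

lemma potential_eq_1:
  assumes "\<theta> = 1"
  defines "H \<equiv> \<lambda>t. word_series (\<lambda>w. real (word_loops V w)) t * exp (- (m * t))"
  shows "(H has_real_derivative mean_growth t) (at t)"
    and "a \<ge> 0 \<Longrightarrow> s \<ge> 0 \<Longrightarrow> H (a + s) - H a \<ge> - loop_bound * card V"
proof -
  let ?L = "\<lambda>w. real (word_loops V w)"
  have lw: "loop_weight = (\<lambda>_. 1)" unfolding loop_weight_def[abs_def] using assms(1) by simp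
  have W: "W t = exp (m * t)" for t unfolding lw by (rule word_series_const)
  have gl: "(\<lambda>w. growth_rate \<theta> u w * loop_weight w) = growth_rate 1 u"
    unfolding lw using assms(1) by simp
  have eg: "exp_bounded (growth_rate 1 u)"
    using exp_bounded_growth unfolding gl .
  have "word_series (append_letter ?L) t = word_series (\<lambda>w. m * ?L w + growth_rate 1 u w) t"
    by (rule word_series_cong) (rule append_letter_loops)
  also have "\<dots> = m * word_series ?L t + word_series (growth_rate 1 u) t"
    using exp_bounded_loops eg
    by (subst word_series_add) (auto intro!: exp_bounded_mult[where g = "\<lambda>_. _"] simp: word_series_cmult)
  finally have dL: "(word_series ?L has_real_derivative
      (m * word_series ?L t + word_series (growth_rate 1 u) t)) (at t)"
    using word_series_deriv[OF exp_bounded_loops, of t] by simp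
  have "(H has_real_derivative (m * word_series ?L t + word_series (growth_rate 1 u) t) * exp (- (m * t))
      + word_series ?L t * (exp (- (m * t)) * (- m))) (at t)"
    unfolding H_def by (auto intro!: derivative_eq_intros dL)
  moreover have "(m * word_series ?L t + word_series (growth_rate 1 u) t) * exp (- (m * t))
      + word_series ?L t * (exp (- (m * t)) * (- m)) = mean_growth t"
    unfolding mean_growth_def gl W by (simp add: algebra_simps exp_minus divide_inverse)
  ultimately show "(H has_real_derivative mean_growth t) (at t)" by simp
  assume as: "a \<ge> 0" "s \<ge> 0"
  have eb: "exp_bounded (\<lambda>w. ?L w + (- real (card V)))"
    by (rule exp_bounded_add[OF exp_bounded_loops exp_bounded_const])
  have "exp (m * s) * word_series (\<lambda>w. ?L w + (- real (card V))) a \<le> word_series ?L (a + s)"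
  proof (rule word_series_concat_ge[OF exp_bounded_loops eb as])
    fix w w' assume "w \<in> words" "w' \<in> words"
    from word_loops_concat[OF this]
    show "?L w + (- real (card V)) \<le> ?L (w @ w')" by linarith
  qed
  also have "word_series (\<lambda>w. ?L w + (- real (card V))) a = word_series ?L a - card V * exp (m * a)"
    using word_series_add[OF exp_bounded_loops exp_bounded_const, of "- real (card V)" a]
      word_series_cmult[OF exp_bounded_const, of "- real (card V)" 1 a] word_series_const[of a] by simp
  finally have "exp (m * s) * (word_series ?L a - card V * exp (m * a)) * exp (- (m * (a + s)))
      \<le> word_series ?L (a + s) * exp (- (m * (a + s)))" by (rule mult_right_mono) simp
  moreover have "exp (m * s) * (word_series ?L a - card V * exp (m * a)) * exp (- (m * (a + s)))
      = H a - card V"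
  proof -
    have e: "exp (m * s) * exp (- (m * (a + s))) = exp (- (m * a))"
      by (simp add: algebra_simps flip: exp_add)
    have "exp (m * s) * (word_series ?L a - card V * exp (m * a)) * exp (- (m * (a + s)))
        = (word_series ?L a - card V * exp (m * a)) * (exp (m * s) * exp (- (m * (a + s))))"
      by (simp only: mult_ac)
    also have "\<dots> = H a - card V" unfolding e H_def by (simp add: left_diff_distrib exp_minus)
    finally show ?thesis .
  qed
  ultimately show "H (a + s) - H a \<ge> - loop_bound * card V"
    unfolding loop_bound_def using assms(1) by (simp add: H_def)
qed

lemma integral_mean_growth_ge:
  assumes "a \<ge> 0" "s \<ge> 0"
  shows "- loop_bound * card V \<le> (LBINT t:{a..a+s}. mean_growth t)"
proof -
  have "\<exists>H. (\<forall>t\<ge>0. (H has_real_derivative mean_growth t) (at t)) \<and>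
      H (a + s) - H a \<ge> - loop_bound * card V"
  proof (cases "\<theta> = 1")
    case True
    then show ?thesis using potential_eq_1[OF True] assms by blast
  next
    case False
    then show ?thesis using potential_ne_1[OF False] assms by blast
  qed
  then obtain H where H: "\<And>t. t \<ge> 0 \<Longrightarrow> (H has_real_derivative mean_growth t) (at t)"
    "H (a + s) - H a \<ge> - loop_bound * card V" by blast
  have "(LBINT t:{a..a+s}. mean_growth t) = H (a + s) - H a"
    unfolding set_lebesgue_integral_def
  proof (rule integral_FTC_Icc)
    show "(H has_vector_derivative mean_growth t) (at t within {a..a+s})" if "a \<le> t" "t \<le> a + s" for t
      using H(1)[of t] that assms
      by (auto simp: has_real_derivative_iff_has_vector_derivative[symmetric] intro: DERIV_subset)
    show "continuous_on {a..a+s} mean_growth"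
      using assms by (intro continuous_at_imp_continuous_on) (auto intro: mean_growth_continuous)
  qed (use assms in simp)
  then show ?thesis using H(2) by simp
qed

text \<open>Words without a large loop have growth rate at most \<open>- \<beta>\<close>, and
  all words have growth rate at most \<open>m\<close>. Taking means and integrating, the
  probability of a large loop must compensate for what is missing to the lower bound of
  \<open>integral_mean_growth_ge\<close>.\<close>

theorem integral_prob_large_loop_ge:
  assumes "a \<ge> 0" "s \<ge> 0"
    and sparse: "\<And>S. S \<subseteq> V \<Longrightarrow> real (card S) \<le> \<eta> * real (card V) \<Longrightarrow>
      real (edges_inside E S) \<le> c * real (card S)"
  defines "\<beta> \<equiv> (m - c * (1 + \<theta> * max u (1 - u)) * real (card V)) / \<theta>"
  assumes "\<beta> \<ge> 0"
  shows "s * \<beta> - loop_bound * card V \<le> (m + \<beta>) * (LBINT t:{a..a+s}. prob_large_loop V E \<theta> t u \<eta>)"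
proof -
  let ?P = "\<lambda>t. prob_large_loop V E \<theta> t u \<eta>"
  define Q where "Q = (\<lambda>t. word_series (\<lambda>w. large_word \<eta> w * loop_weight w) t / W t)"
  have rate: "growth_rate \<theta> u w \<le> - \<beta> + (m + \<beta>) * large_word \<eta> w" if w: "w \<in> words" for w
  proof (cases "large_loop V \<eta> (word_config w)")
    case True
    then show ?thesis using growth_rate_le_card[OF w \<theta> u] by (simp add: large_word_def)
  next
    case False
    have M: "1 + \<theta> * max u (1 - u) \<ge> 0" using \<theta> u by (auto simp: max_def)
    have "growth_rate \<theta> u w \<le> (real (card (internal_edges w)) * (1 + \<theta> * max u (1 - u)) - m) / \<theta>"
      by (rule growth_rate_le_internal[OF w \<theta> u])
    also have "\<dots> \<le> (c * real (card V) * (1 + \<theta> * max u (1 - u)) - m) / \<theta>"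
      using card_internal_edges[OF w False sparse] M \<theta>
      by (intro divide_right_mono diff_right_mono mult_right_mono) auto
    also have "\<dots> = - \<beta>" unfolding \<beta>_def using \<theta> by (simp add: field_simps)
    finally show ?thesis using False by (simp add: large_word_def)
  qed
  have mean: "mean_growth t \<le> - \<beta> + (m + \<beta>) * Q t" if t: "t \<ge> 0" for t
  proof -
    have "word_series (\<lambda>w. growth_rate \<theta> u w * loop_weight w) t \<le>
        word_series (\<lambda>w. - \<beta> * loop_weight w + (m + \<beta>) * (large_word \<eta> w * loop_weight w)) t"
    proof (rule word_series_mono[OF exp_bounded_growth _ _ t])
      show "exp_bounded (\<lambda>w. - \<beta> * loop_weight w + (m + \<beta>) * (large_word \<eta> w * loop_weight w))"
        by (intro exp_bounded_add exp_bounded_mult[OF exp_bounded_loop_weight, of "\<lambda>_. - \<beta>" "\<bar>\<beta>\<bar>"]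
            exp_bounded_mult[OF exp_bounded_large, of "\<lambda>_. m + \<beta>" "\<bar>m + \<beta>\<bar>"]) auto
      fix w assume "w \<in> words"
      then have "growth_rate \<theta> u w * loop_weight w \<le> (- \<beta> + (m + \<beta>) * large_word \<eta> w) * loop_weight w"
        using rate loop_weight_pos[of w] by (intro mult_right_mono) auto
      then show "growth_rate \<theta> u w * loop_weight w \<le>
          - \<beta> * loop_weight w + (m + \<beta>) * (large_word \<eta> w * loop_weight w)"
        by (simp add: algebra_simps)
    qed
    also have "\<dots> = - \<beta> * W t + (m + \<beta>) * word_series (\<lambda>w. large_word \<eta> w * loop_weight w) t"
      by (subst word_series_add)
        (auto intro!: exp_bounded_mult[OF exp_bounded_loop_weight, of "\<lambda>_. - \<beta>" "\<bar>\<beta>\<bar>", simplified]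
            exp_bounded_mult[OF exp_bounded_large, of "\<lambda>_. m + \<beta>" "\<bar>m + \<beta>\<bar>"]
          simp: word_series_cmult[OF exp_bounded_large] word_series_cmult[OF exp_bounded_loop_weight, of "- \<beta>", simplified])
    finally have "mean_growth t \<le>
        (- \<beta> * W t + (m + \<beta>) * word_series (\<lambda>w. large_word \<eta> w * loop_weight w) t) / W t"
      unfolding mean_growth_def using W_pos[OF t] by (intro divide_right_mono) auto
    also have "\<dots> = - \<beta> + (m + \<beta>) * Q t" using W_pos[OF t] by (simp add: Q_def add_divide_distrib diff_divide_distrib)
    finally show ?thesis .
  qed
  have contQ: "continuous_on {a..a+s} Q"
  proof (intro continuous_at_imp_continuous_on ballI)
    fix t assume "t \<in> {a..a+s}"
    then have "t \<ge> 0" using assms(1) by simp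
    then show "isCont Q t"
      unfolding Q_def
      using W_pos[of t] word_series_continuous[OF exp_bounded_large] word_series_continuous[OF exp_bounded_loop_weight]
      by (intro continuous_intros) auto
  qed
  have contG: "continuous_on {a..a+s} mean_growth"
    using assms by (intro continuous_at_imp_continuous_on) (auto intro: mean_growth_continuous)
  have "- loop_bound * card V \<le> (LBINT t:{a..a+s}. mean_growth t)"
    by (rule integral_mean_growth_ge[OF assms(1,2)])
  also have "\<dots> \<le> (LBINT t:{a..a+s}. - \<beta> + (m + \<beta>) * Q t)"
    using contQ contG mean assms(1)
    by (intro set_integral_mono borel_integrable_atLeastAtMost' continuous_intros) auto
  also have "\<dots> = (LBINT t:{a..a+s}. - \<beta>) + (LBINT t:{a..a+s}. (m + \<beta>) * Q t)"
    using contQ by (intro set_integral_add borel_integrable_atLeastAtMost' continuous_intros)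
  also have "(LBINT t:{a..a+s}. - \<beta>) = - (s * \<beta>)"
    using assms(2) by (simp add: set_integral_const)
  also have "(LBINT t:{a..a+s}. (m + \<beta>) * Q t) = (m + \<beta>) * (LBINT t:{a..a+s}. Q t)"
    by (rule set_integral_mult_right)
  also have "(LBINT t:{a..a+s}. Q t) = (LBINT t:{a..a+s}. ?P t)"
    by (rule set_lebesgue_integral_cong) (use assms(1) prob_large_loop_eq in \<open>auto simp: Q_def\<close>)
  finally show ?thesis by simp
qed

end

theorem theorem2p2:
  fixes G :: "nat \<Rightarrow> nat set set pmf"
    and u \<theta> \<alpha> :: real
  assumes graph: "\<And>n. set_pmf (G n) \<subseteq> Pow (simple_edges {1..n})"
    and u: "u \<in> {0..1}"
    and \<theta>: "\<theta> > 0"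
    and sparse: "\<And>\<epsilon>. \<epsilon> > 0 \<Longrightarrow> \<exists>\<eta>>0.
      (\<lambda>n. measure_pmf.prob (G n)
         {E. \<forall>S\<subseteq>{1..n}. real (card S) \<le> \<eta> * real n \<longrightarrow>
               real (edges_inside E S) \<le> (1 + \<epsilon>) * real (card S)}) \<longlonglongrightarrow> 1"
    and \<alpha>: "\<alpha> > 0"
    and edge_density: "\<And>\<delta>. \<delta> > 0 \<Longrightarrow>
      (\<lambda>n. measure_pmf.prob (G n) {E. \<bar>real (card E) / real n - \<alpha>\<bar> > \<delta>}) \<longlonglongrightarrow> 0"
    and supercritical: "\<alpha> > 1 + \<theta> * max u (1 - u)"
  shows "\<exists>\<eta>>0. \<exists>s>0. \<exists>c>0. \<forall>a\<ge>0.
    (\<lambda>n. measure_pmf.prob (G n)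
       {E. 1 / s * (LBINT t:{a..a+s}. prob_large_loop {1..n} E \<theta> t u \<eta>) \<ge> c}) \<longlonglongrightarrow> 1"
proof -
  define b where "b = 1 + \<theta> * max u (1 - u)"
  \<comment> \<open>The margin \<open>\<alpha> - b\<close> absorbs the error \<open>\<epsilon> *
    b = \<delta>\<close> of sparsity and the error \<open>\<delta>\<close> of the edge density,
    and \<open>2 * \<delta>\<close> is left.\<close>
  define \<delta> where "\<delta> = (\<alpha> - b) / 4"
  define \<epsilon> where "\<epsilon> = \<delta> / b"
  have b: "b > 0"
  proof -
    have "0 \<le> \<theta> * max u (1 - u)" using u \<theta> by (intro mult_nonneg_nonneg) (auto simp: le_max_iff_disj)
    then show ?thesis by (simp add: b_def)
  qed
  have \<delta>: "\<delta> > 0" "\<alpha> = b + 4 * \<delta>" using supercritical unfolding \<delta>_def b_def[symmetric] by (simp_all add: field_simps)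
  have \<epsilon>: "\<epsilon> > 0" "(1 + \<epsilon>) * b = b + \<delta>" using b \<delta> by (simp_all add: \<epsilon>_def field_simps)
  define sp where "sp = (\<lambda>\<eta> n. {E. \<forall>S\<subseteq>{1..n}. real (card S) \<le> \<eta> * real n \<longrightarrow>
               real (edges_inside E S) \<le> (1 + \<epsilon>) * real (card S)})"
  define dev where "dev = (\<lambda>n :: nat. {E :: nat set set. \<bar>real (card E) / real n - \<alpha>\<bar> > \<delta>})"
  obtain \<eta> where \<eta>: "\<eta> > 0" "(\<lambda>n. measure_pmf.prob (G n) (sp \<eta> n)) \<longlonglongrightarrow> 1"
    using sparse[OF \<epsilon>(1)] unfolding sp_def by blast
  have dev_lim: "(\<lambda>n. measure_pmf.prob (G n) (dev n)) \<longlonglongrightarrow> 0"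
    unfolding dev_def by (rule edge_density[OF \<delta>(1)])
  define \<kappa> where "\<kappa> = (if \<theta> = 1 then 1 else ln \<theta> / (\<theta> - 1))"
  have \<kappa>: "\<kappa> \<ge> 0"
    using \<theta> by (auto simp: \<kappa>_def zero_le_divide_iff ln_ge_zero_iff)
  \<comment> \<open>With this \<open>s\<close>, the gain \<open>s * \<beta>\<close> over the
    interval exceeds the possible loss \<open>\<kappa> * n\<close> by \<open>n\<close>, since
    \<open>\<beta> \<ge> 2 * \<delta> * n / \<theta>\<close>.\<close>
  define s where "s = \<theta> * (\<kappa> + 1) / (2 * \<delta>)"
  \<comment> \<open>An upper bound for \<open>(m + \<beta>) / n\<close>.\<close>
  define \<Gamma> where "\<Gamma> = (\<alpha> + \<delta>) * (1 + 1 / \<theta>)"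
  have s: "s > 0" using \<theta> \<kappa> \<delta> by (simp add: s_def)
  have \<Gamma>: "\<Gamma> > 0" using \<theta> \<alpha> \<delta> by (simp add: \<Gamma>_def add_pos_pos)
  have key: "1 / s * (LBINT t:{a..a+s}. prob_large_loop {1..n} E \<theta> t u \<eta>) \<ge> 1 / (s * \<Gamma>)"
    if n: "n > 0" and a: "a \<ge> 0" and E: "E \<in> set_pmf (G n)" "E \<in> sp \<eta> n" "E \<notin> dev n" for n a E
  proof -
    interpret weighted_loop_graph "{1..n}" E u \<theta>
      by standard (use graph[of n] E(1) u \<theta> in auto)
    let ?I = "LBINT t:{a..a+s}. prob_large_loop {1..n} E \<theta> t u \<eta>"
    have "\<bar>m / real n - \<alpha>\<bar> \<le> \<delta>" using E(3) by (simp add: dev_def)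
    then have "\<alpha> - \<delta> \<le> m / real n" "m / real n \<le> \<alpha> + \<delta>" by linarith+
    then have m: "(\<alpha> - \<delta>) * real n \<le> m" "m \<le> (\<alpha> + \<delta>) * real n"
      using n by (simp_all add: field_simps)
    define \<beta> where "\<beta> = (m - (1 + \<epsilon>) * (1 + \<theta> * max u (1 - u)) * real (card {1..n})) / \<theta>"
    have \<beta>_eq: "\<beta> = (m - (b + \<delta>) * real n) / \<theta>"
      unfolding \<beta>_def b_def[symmetric] \<epsilon>(2) by simp
    have "2 * \<delta> * real n \<le> m - (b + \<delta>) * real n" using m(1) \<delta>(2) by (simp add: algebra_simps)
    then have \<beta>_ge: "2 * \<delta> * real n / \<theta> \<le> \<beta>" unfolding \<beta>_eq using \<theta> by (intro divide_right_mono) auto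
    then have \<beta>_nonneg: "\<beta> \<ge> 0" using \<delta> \<theta> by (smt (verit) divide_nonneg_pos mult_nonneg_nonneg of_nat_0_le_iff)
    have \<beta>_le: "\<beta> \<le> m / \<theta>" unfolding \<beta>_eq using \<theta> b \<delta> by (intro divide_right_mono) auto
    have "s * \<beta> - loop_bound * card {1..n} \<le> (m + \<beta>) * ?I"
      unfolding \<beta>_def
    proof (rule integral_prob_large_loop_ge)
      show "real (edges_inside E S) \<le> (1 + \<epsilon>) * real (card S)"
        if "S \<subseteq> {1..n}" "real (card S) \<le> \<eta> * real (card {1..n})" for S
        using E(2) that by (simp add: sp_def)
      show "0 \<le> (m - (1 + \<epsilon>) * (1 + \<theta> * max u (1 - u)) * real (card {1..n})) / \<theta>"
        using \<beta>_nonneg unfolding \<beta>_def .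
    qed (use a s in auto)
    then have main: "s * \<beta> - \<kappa> * real n \<le> (m + \<beta>) * ?I" unfolding loop_bound_def \<kappa>_def by simp
    have "s * (2 * \<delta> * real n / \<theta>) = (\<kappa> + 1) * real n" using \<delta> \<theta> by (simp add: s_def)
    then have "(\<kappa> + 1) * real n \<le> s * \<beta>" using mult_left_mono[OF \<beta>_ge, of s] s by simp
    then have lower: "real n \<le> (m + \<beta>) * ?I" using main by (simp add: algebra_simps)
    have "m + \<beta> \<le> m * (1 + 1 / \<theta>)" using \<beta>_le by (simp add: distrib_left)
    also have "\<dots> \<le> (\<alpha> + \<delta>) * real n * (1 + 1 / \<theta>)" using m(2) \<theta> by (intro mult_right_mono) auto
    finally have upper: "m + \<beta> \<le> \<Gamma> * real n" by (simp add: \<Gamma>_def mult_ac)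
    have "?I \<ge> 0" unfolding set_lebesgue_integral_def
      by (rule integral_nonneg_AE) (simp add: prob_large_loop_def)
    then have "real n \<le> \<Gamma> * real n * ?I"
      using lower mult_right_mono[OF upper, of ?I] by linarith
    then have "1 \<le> \<Gamma> * ?I" using n by (simp add: mult_ac)
    then have "1 / \<Gamma> \<le> ?I" using \<Gamma> by (simp add: field_simps)
    then have "1 / s * (1 / \<Gamma>) \<le> 1 / s * ?I" using s by (intro mult_left_mono) auto
    then show ?thesis by (simp add: mult.commute)
  qed
  have "(\<lambda>n. measure_pmf.prob (G n)
       {E. 1 / s * (LBINT t:{a..a+s}. prob_large_loop {1..n} E \<theta> t u \<eta>) \<ge> 1 / (s * \<Gamma>)}) \<longlonglongrightarrow> 1"
    if a: "a \<ge> 0" for a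
  proof (rule tendsto_sandwich)
    let ?A = "\<lambda>n. {E. 1 / s * (LBINT t:{a..a+s}. prob_large_loop {1..n} E \<theta> t u \<eta>) \<ge> 1 / (s * \<Gamma>)}"
    show "\<forall>\<^sub>F n in sequentially. measure_pmf.prob (G n) (sp \<eta> n) - measure_pmf.prob (G n) (dev n)
        \<le> measure_pmf.prob (G n) (?A n)"
      using eventually_gt_at_top[of 0]
    proof eventually_elim
      case (elim n)
      have "measure_pmf.prob (G n) (sp \<eta> n) \<le> measure_pmf.prob (G n) (?A n \<union> dev n)"
      proof (rule measure_pmf.finite_measure_mono_AE)
        show "AE E in measure_pmf (G n). E \<in> sp \<eta> n \<longrightarrow> E \<in> ?A n \<union> dev n"
          using key[OF elim a] by (auto simp: AE_measure_pmf_iff)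
      qed simp
      also have "\<dots> \<le> measure_pmf.prob (G n) (?A n) + measure_pmf.prob (G n) (dev n)"
        by (rule measure_Un_le) auto
      finally show ?case by simp
    qed
    show "\<forall>\<^sub>F n in sequentially. measure_pmf.prob (G n) (?A n) \<le> 1" by simp
    show "(\<lambda>n. measure_pmf.prob (G n) (sp \<eta> n) - measure_pmf.prob (G n) (dev n)) \<longlonglongrightarrow> 1"
      using tendsto_diff[OF \<eta>(2) dev_lim] by simp
  qed simp
  moreover have "1 / (s * \<Gamma>) > 0" using s \<Gamma> by simp
  ultimately show ?thesis using \<eta>(1) s by blast
qed

end
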